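(* Every subsymmetric basic sequence in the Banach space $Su(T^* )$ is equivalent to the canonical basis $(t_i^* )_{i=1}^\infty$ of $Su(T^* )$.
   Context: Basic sequences $(x_j)$ and $(y_j)$ are equivalent if, for all scalars $(a_j)$, $\sum_j a_jx_j$ converges if and only if $\sum_j a_jy_j$ converges. A basic sequence is subsymmetric if it is unconditional and equivalent to each of its subsequences. The Tsirelson space $T$ (Figiel–Johnson construction) is the completion of $c_{00}$, with unit vectors $(t_n)$, under the unique norm satisfying, for $x=\sum_n a_nt_n$, $$\|x\| = \max\Big\{ \max_n |a_n|,\ \tfrac12 \sup \sum_{j=1}^k \|E_jx\|\Big\},$$ where the supremum is over all $k\in\mathbb N$ and finite sets $E_1<E_2<\dots<E_k$ of natural numbers with $k\le \min E_1$; here $E<F$ means $\max E<\min F$, and $Ex=\sum_{n\in E}a_nt_n$. $T^*$ denotes the dual of $T$ and $(t_n^* )$ the biorthogonal functionals of $(t_n)$, which form a basis of $T^*$. The subsymmetrization $Su(T^* )$ is the completion of the space of finitely supported sequences under the norm $$\Big\|\sum_n a_nt_n^*\Big\|=\sup\Big\{\Big\|\sum_i a_{n_i}t^*_i\Big\|_{T^*} : n_1<n_2<\cdots \Big\},$$ and its unit vector basis is again denoted $(t_n^* )$. *)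

theory Defs
  imports "HOL-Analysis.Analysis"
begin

text \<open>
  Scalars are real. All sequences and bases are indexed from 0, so index \<open>n\<close> here is the
  customary index \<open>n + 1\<close>.
\<close>

subsection \<open>Basic sequences\<close>

text \<open>A basic sequence is a Schauder basis of its closed linear span.\<close>

definition basic_sequence :: "(nat \<Rightarrow> 'a::banach) \<Rightarrow> bool" where
  "basic_sequence x \<longleftrightarrow>
     (\<forall>v \<in> closure (span (range x)). \<exists>!a. (\<lambda>j. a j *\<^sub>R x j) sums v)"

text \<open>
  \<open>summable\<close> is convergence of the series in the given order, \<open>summable_on\<close> is unconditional
  convergence.
\<close>

definition unconditional_basic :: "(nat \<Rightarrow> 'a::banach) \<Rightarrow> bool" where
  "unconditional_basic x \<longleftrightarrow> basic_sequence x \<and>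
     (\<forall>a. summable (\<lambda>j. a j *\<^sub>R x j) \<longrightarrow> (\<lambda>j. a j *\<^sub>R x j) summable_on UNIV)"

definition equivalent_basic :: "(nat \<Rightarrow> 'a::banach) \<Rightarrow> (nat \<Rightarrow> 'b::banach) \<Rightarrow> bool" where
  "equivalent_basic x y \<longleftrightarrow>
     (\<forall>a. summable (\<lambda>j. a j *\<^sub>R x j) \<longleftrightarrow> summable (\<lambda>j. a j *\<^sub>R y j))"

definition subsymmetric :: "(nat \<Rightarrow> 'a::banach) \<Rightarrow> bool" where
  "subsymmetric x \<longleftrightarrow> unconditional_basic x \<and>
     (\<forall>\<sigma>. strict_mono \<sigma> \<longrightarrow> equivalent_basic x (x \<circ> \<sigma>))"

subsection \<open>Norms on finitely supported sequences and their completions\<close>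

definition c00 :: "(nat \<Rightarrow> real) set" where
  "c00 = {a. finite {n. a n \<noteq> 0}}"

definition c00_norm :: "((nat \<Rightarrow> real) \<Rightarrow> real) \<Rightarrow> bool" where
  "c00_norm N \<longleftrightarrow>
     (\<forall>a\<in>c00. N a = 0 \<longleftrightarrow> (\<forall>n. a n = 0)) \<and>
     (\<forall>a\<in>c00. \<forall>r. N (\<lambda>n. r * a n) = \<bar>r\<bar> * N a) \<and>
     (\<forall>a\<in>c00. \<forall>b\<in>c00. N (\<lambda>n. a n + b n) \<le> N a + N b)"

text \<open>Only meaningful for \<open>a\<close> in \<^const>\<open>c00\<close>.\<close>

definition lin_comb :: "(nat \<Rightarrow> 'a::real_vector) \<Rightarrow> (nat \<Rightarrow> real) \<Rightarrow> 'a" where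
  "lin_comb e a = (\<Sum>n | a n \<noteq> 0. a n *\<^sub>R e n)"

text \<open>
  The Banach space \<open>'a\<close> is a completion of \<^const>\<open>c00\<close> under the norm \<open>N\<close>, the unit vectors being
  mapped to \<open>e\<close>: the induced linear map is isometric with dense range. This determines \<open>'a\<close>
  together with \<open>e\<close> up to isometric isomorphism.
\<close>

definition c00_completion :: "((nat \<Rightarrow> real) \<Rightarrow> real) \<Rightarrow> (nat \<Rightarrow> 'a::banach) \<Rightarrow> bool" where
  "c00_completion N e \<longleftrightarrow>
     (\<forall>a\<in>c00. norm (lin_comb e a) = N a) \<and> closure (span (range e)) = UNIV"

subsection \<open>The Tsirelson norm\<close>

definition restrict_seq :: "nat set \<Rightarrow> (nat \<Rightarrow> real) \<Rightarrow> nat \<Rightarrow> real" where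
  "restrict_seq E a n = (if n \<in> E then a n else 0)"

text \<open>
  Lists \<open>[E\<^sub>1, \<dots>, E\<^sub>k]\<close> with \<open>E\<^sub>1 < \<dots> < E\<^sub>k\<close> and \<open>k \<le> min E\<^sub>1\<close>; the \<open>Suc\<close> accounts for indexing
  from 0.
\<close>

definition admissible :: "nat set list \<Rightarrow> bool" where
  "admissible Es \<longleftrightarrow> Es \<noteq> [] \<and> (\<forall>E \<in> set Es. finite E \<and> E \<noteq> {}) \<and>
     sorted_wrt (\<lambda>E F. Max E < Min F) Es \<and> length Es \<le> Suc (Min (hd Es))"

text \<open>
  The set under \<^const>\<open>Max\<close> is finite because \<open>a\<close> has finite support. The set under the supremum
  is bounded by the sum of all \<open>\<bar>a n\<bar> * N (t n)\<close>, with \<open>t n\<close> the unit vectors, so the real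
  supremum is the genuine one.
\<close>

definition tsirelson_norm :: "((nat \<Rightarrow> real) \<Rightarrow> real) \<Rightarrow> bool" where
  "tsirelson_norm N \<longleftrightarrow> c00_norm N \<and>
     (\<forall>a\<in>c00. N a = max (Max (range (\<lambda>n. \<bar>a n\<bar>)))
        (1/2 * (SUP Es \<in> {Es. admissible Es}. \<Sum>E\<leftarrow>Es. N (restrict_seq E a))))"

subsection \<open>Biorthogonal functionals and subsymmetrization\<close>

definition biorthogonal ::
    "(nat \<Rightarrow> 'a::real_normed_vector) \<Rightarrow> (nat \<Rightarrow> 'a \<Rightarrow>\<^sub>L real) \<Rightarrow> bool" where
  "biorthogonal e f \<longleftrightarrow> (\<forall>m n. blinfun_apply (f m) (e n) = (if m = n then 1 else 0))"

text \<open>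
  For \<open>a\<close> in \<^const>\<open>c00\<close> the supremum is over a set bounded by the sum of \<open>\<bar>a n\<bar>\<close> whenever the
  vectors \<open>f i\<close> have norm at most 1, as do the biorthogonal functionals of the Tsirelson basis.
\<close>

definition subsymm_norm :: "(nat \<Rightarrow> 'a::real_normed_vector) \<Rightarrow> (nat \<Rightarrow> real) \<Rightarrow> real" where
  "subsymm_norm f a = (SUP \<sigma> \<in> {\<sigma>. strict_mono \<sigma>}. norm (lin_comb f (\<lambda>i. a (\<sigma> i))))"

end

theory Submission
  imports Defs "HOL-Complex_Analysis.Great_Picard"
begin

text \<open>
  Why the theorem holds. Write \<open>N\<close> for the norm of \<open>T\<close> and \<open>M\<close> for the norm of \<open>Su(T\<^sup>*)\<close>. Then
  \<open>M a\<close> is the supremum of \<open>\<Sum>i. a (\<sigma> i) * w i\<close> over strictly increasing \<open>\<sigma>\<close> and \<open>w\<close> in the unit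
  ball of \<open>T\<close> (locale \<open>subsymmetrized_dual\<close>), so everything reduces to inequalities for \<open>N\<close>.

  Reduction to blocks. Let \<open>x\<close> be subsymmetric. Differences \<open>x (\<alpha> j) - x (\<beta> j)\<close> over disjoint pairs
  form a sequence equivalent to \<open>x\<close>: one direction is subsymmetry, the other uses unconditionality
  to split the differences again (\<open>subsymmetric_difference_iff\<close>; this needs the basis constant,
  which comes from Baire category). If the pairs are taken from a subsequence along which all
  coordinates converge, the coordinates of the differences tend to 0, and a gliding hump makes them
  a summable perturbation of a block sequence \<open>u\<close> of the unit vector basis \<open>e\<close>.

  Peaked blocks. If the coordinates of the blocks do not become uniformly small, choose the blocks
  with one coordinate of size at least \<open>\<delta>\<close>. Projecting on these coordinates shows that \<open>u\<close>
  dominates \<open>e\<close>. Conversely \<open>e\<close> dominates every bounded block sequence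
  (\<open>M_combination_le\<close>), because in \<open>T\<close> the sequence of the norms of successive pieces of a vector,
  placed at the coordinates 0, 1, 2, and so on, has norm at most that of the vector
  (\<open>N_block_norms_le\<close>). So \<open>x\<close> is equivalent to \<open>e\<close>.

  Flat blocks. Otherwise the blocks can be taken with rapidly decreasing coordinates. Then the sum
  of \<open>K\<close> sufficiently late blocks is bounded independently of \<open>K\<close> (\<open>M_flat_combination_le\<close>): the
  first \<open>K\<close> coordinates of a functional hardly see flat blocks, and \<open>K\<close> pieces beyond them form an
  admissible family. If \<open>x\<close> were subsymmetric, this \<open>c\<^sub>0\<close> behaviour of sparse subsequences would
  pass to the whole of \<open>u\<close>. But flat blocks have successive norming vectors in \<open>T\<close> whose combinations act
  on all the \<open>u k\<close> at once (\<open>flat_blocks_norming\<close>), so these vectors would span \<open>\<ell>\<^sub>1\<close> in \<open>T\<close>. This is impossible by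
  James's argument that \<open>\<ell>\<^sub>1\<close> is not distortable, combined with the averages of Figiel and Johnson
  (\<open>tail_averages_tend_to_0\<close>). Hence flat blocks do not occur.
\<close>

section \<open>Finitely supported sequences\<close>

lemma c00_bound: "a \<in> c00 \<Longrightarrow> \<exists>m. \<forall>n\<ge>m. a n = 0"
proof -
  assume "a \<in> c00"
  then have "finite {n. a n \<noteq> 0}" by (simp add: c00_def)
  then obtain m where "\<forall>n\<in>{n. a n \<noteq> 0}. n < m"
    using finite_nat_set_iff_bounded by blast
  then show ?thesis by (metis mem_Collect_eq not_less)
qed

lemma c00_I_bound: "(\<And>n. n \<ge> m \<Longrightarrow> a n = 0) \<Longrightarrow> a \<in> c00"
  unfolding c00_def mem_Collect_eq
  by (rule finite_subset[of _ "{..<m}"]) (auto simp: not_less[symmetric])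

lemma c00_subset: "a \<in> c00 \<Longrightarrow> (\<And>n. a n = 0 \<Longrightarrow> b n = 0) \<Longrightarrow> b \<in> c00"
  unfolding c00_def mem_Collect_eq by (erule finite_subset[rotated]) auto

lemma c00_zero [simp]: "(\<lambda>_. 0) \<in> c00"
  by (simp add: c00_def)

lemma c00_scale [simp]: "a \<in> c00 \<Longrightarrow> (\<lambda>n. r * a n) \<in> c00"
  by (erule c00_subset) auto

lemma c00_add [simp]: "a \<in> c00 \<Longrightarrow> b \<in> c00 \<Longrightarrow> (\<lambda>n. a n + b n) \<in> c00"
  unfolding c00_def mem_Collect_eq
  by (rule finite_subset[of _ "{n. a n \<noteq> 0} \<union> {n. b n \<noteq> 0}"]) auto

lemma c00_diff [simp]: "a \<in> c00 \<Longrightarrow> b \<in> c00 \<Longrightarrow> (\<lambda>n. a n - b n) \<in> c00"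
  using c00_add[OF _ c00_scale[of b "-1"], of a] by simp

lemma c00_restrict [simp]: "a \<in> c00 \<Longrightarrow> restrict_seq E a \<in> c00"
  by (erule c00_subset) (auto simp: restrict_seq_def)

lemma c00_restrict_finite: "finite E \<Longrightarrow> restrict_seq E a \<in> c00"
  unfolding c00_def mem_Collect_eq
  by (erule finite_subset[rotated]) (auto simp: restrict_seq_def)

lemma c00_sum: "(\<And>k. k \<in> A \<Longrightarrow> z k \<in> c00) \<Longrightarrow> (\<lambda>n. \<Sum>k\<in>A. z k n) \<in> c00"
proof (induction A rule: infinite_finite_induct)
  case (insert k A)
  then have "(\<lambda>n. z k n + (\<Sum>k\<in>A. z k n)) \<in> c00"
    by (intro c00_add) (blast intro: insert)+
  then show ?case unfolding sum.insert[OF insert.hyps(1,2)] .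
qed simp_all

lemma restrict_seq_add:
  "restrict_seq E (\<lambda>n. a n + b n) = (\<lambda>n. restrict_seq E a n + restrict_seq E b n)"
  by (auto simp: restrict_seq_def)

lemma restrict_seq_scale: "restrict_seq E (\<lambda>n. r * a n) = (\<lambda>n. r * restrict_seq E a n)"
  by (auto simp: restrict_seq_def)

lemma restrict_seq_sum:
  "restrict_seq E (\<lambda>n. \<Sum>k\<in>A. z k n) = (\<lambda>n. \<Sum>k\<in>A. restrict_seq E (z k) n)"
  by (auto simp: restrict_seq_def)

lemma restrict_seq_eq_0:
  "(\<And>n. n \<in> E \<Longrightarrow> a n = 0) \<Longrightarrow> restrict_seq E a = (\<lambda>_. 0)"
  by (auto simp: restrict_seq_def)

lemma restrict_seq_empty [simp]: "restrict_seq {} a = (\<lambda>_. 0)"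
  by (auto simp: restrict_seq_def)

lemma restrict_seq_id: "(\<And>n. a n \<noteq> 0 \<Longrightarrow> n \<in> E) \<Longrightarrow> restrict_seq E a = a"
  unfolding restrict_seq_def by fastforce

lemma abs_restrict_seq_le: "\<bar>restrict_seq E a n\<bar> \<le> \<bar>a n\<bar>"
  by (auto simp: restrict_seq_def)

lemma lin_comb_eq:
  assumes "finite A" "\<And>n. a n \<noteq> 0 \<Longrightarrow> n \<in> A"
  shows "lin_comb e a = (\<Sum>n\<in>A. a n *\<^sub>R e n)"
  unfolding lin_comb_def using assms by (intro sum.mono_neutral_left) auto

text \<open>
  Families of sets are indexed by natural numbers instead of being collected in lists; members may be
  empty or infinite, which spares normalisation when families are cut or combined.
\<close>

definition successive :: "nat set \<Rightarrow> (nat \<Rightarrow> nat set) \<Rightarrow> bool" where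
  "successive I F \<longleftrightarrow> (\<forall>i\<in>I. \<forall>j\<in>I. i < j \<longrightarrow> (\<forall>m\<in>F i. \<forall>n\<in>F j. m < n))"

lemma successiveD:
  "successive I F \<Longrightarrow> i \<in> I \<Longrightarrow> j \<in> I \<Longrightarrow> i < j \<Longrightarrow> m \<in> F i \<Longrightarrow> n \<in> F j \<Longrightarrow> m < n"
  unfolding successive_def by blast

section \<open>The Tsirelson norm\<close>

locale tsirelson =
  fixes N :: "(nat \<Rightarrow> real) \<Rightarrow> real"
  assumes tsirelson: "tsirelson_norm N"
begin

lemma c00_norm: "c00_norm N"
  using tsirelson by (simp add: tsirelson_norm_def)

lemma N_zero [simp]: "N (\<lambda>_. 0) = 0"
  using c00_norm c00_zero unfolding c00_norm_def by blast

lemma N_scale: "a \<in> c00 \<Longrightarrow> N (\<lambda>n. r * a n) = \<bar>r\<bar> * N a"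
  using c00_norm unfolding c00_norm_def by blast

lemma N_add: "a \<in> c00 \<Longrightarrow> b \<in> c00 \<Longrightarrow> N (\<lambda>n. a n + b n) \<le> N a + N b"
  using c00_norm unfolding c00_norm_def by blast

lemma N_nonneg [simp]:
  assumes "a \<in> c00" shows "0 \<le> N a"
proof -
  have "N (\<lambda>n. a n + (-1) * a n) \<le> N a + N (\<lambda>n. (-1) * a n)"
    by (intro N_add c00_scale assms)
  then show ?thesis using N_scale[OF assms, of "-1"] by simp
qed

lemma N_sum:
  assumes "\<And>k. k \<in> A \<Longrightarrow> z k \<in> c00"
  shows "N (\<lambda>n. \<Sum>k\<in>A. z k n) \<le> (\<Sum>k\<in>A. N (z k))"
  using assms
proof (induction A rule: infinite_finite_induct)
  case (insert k A)
  have "N (\<lambda>n. z k n + (\<Sum>k\<in>A. z k n)) \<le> N (z k) + N (\<lambda>n. \<Sum>k\<in>A. z k n)"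
    using insert.prems by (intro N_add c00_sum) auto
  then show ?case using insert by auto
qed auto

lemma N_unfold: "a \<in> c00 \<Longrightarrow> N a = max (Max (range (\<lambda>n. \<bar>a n\<bar>)))
        (1/2 * (SUP Es \<in> {Es. admissible Es}. \<Sum>E\<leftarrow>Es. N (restrict_seq E a)))"
  using tsirelson unfolding tsirelson_norm_def by blast

lemma finite_range_abs: "a \<in> c00 \<Longrightarrow> finite (range (\<lambda>n. \<bar>a n :: real\<bar>))"
proof -
  assume "a \<in> c00"
  then have "finite {n. a n \<noteq> 0}" by (simp add: c00_def)
  then have "finite (insert 0 ((\<lambda>n. \<bar>a n\<bar>) ` {n. a n \<noteq> 0}))" by simp
  then show ?thesis by (rule finite_subset[rotated]) auto
qed

lemma abs_le_N: "a \<in> c00 \<Longrightarrow> \<bar>a n\<bar> \<le> N a"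
  using Max_ge[OF finite_range_abs, of a "\<bar>a n\<bar>"] N_unfold[of a] by auto

lemma N_restrict_le_sum:
  assumes "a \<in> c00"
  shows "N (restrict_seq E a) \<le>
    (\<Sum>n\<in>{n. a n \<noteq> 0} \<inter> E. \<bar>a n\<bar> * N (\<lambda>k. if k = n then 1 else 0))"
proof -
  let ?S = "{n. a n \<noteq> 0} \<inter> E"
  have fin: "finite ?S" using assms by (auto simp: c00_def)
  have unit: "(\<lambda>k. if k = n then 1 else 0) \<in> c00" for n :: nat
    by (rule c00_I_bound[of "Suc n"]) auto
  have eq: "restrict_seq E a = (\<lambda>k. \<Sum>n\<in>?S. a n * (if k = n then 1 else 0))"
  proof
    fix k
    have "(\<Sum>n\<in>?S. a n * (if k = n then 1 else 0)) = (\<Sum>n\<in>?S. if k = n then a n else 0)"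
      by (intro sum.cong) auto
    also have "\<dots> = restrict_seq E a k"
      by (subst sum.delta'[OF fin]) (auto simp: restrict_seq_def)
    finally show "restrict_seq E a k = (\<Sum>n\<in>?S. a n * (if k = n then 1 else 0))" ..
  qed
  have "N (restrict_seq E a) \<le> (\<Sum>n\<in>?S. N (\<lambda>k. a n * (if k = n then 1 else 0)))"
    unfolding eq by (intro N_sum c00_scale unit)
  also have "\<dots> = (\<Sum>n\<in>?S. \<bar>a n\<bar> * N (\<lambda>k. if k = n then 1 else 0))"
    by (intro sum.cong refl N_scale unit)
  finally show ?thesis .
qed

text \<open>
  Without boundedness the supremum in the defining equation would be an arbitrary real number; the
  sets of an admissible family are disjoint, so the triangle inequality bounds all sums at once.
\<close>

lemma bdd_above_admissible_sums:
  assumes "a \<in> c00"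
  shows "bdd_above ((\<lambda>Es. \<Sum>E\<leftarrow>Es. N (restrict_seq E a)) ` {Es. admissible Es})"
proof -
  let ?S = "{n. a n \<noteq> 0}"
  let ?g = "\<lambda>n. \<bar>a n\<bar> * N (\<lambda>k. if k = n then 1 else 0)"
  have fin: "finite ?S" using assms by (auto simp: c00_def)
  have unit: "(\<lambda>k. if k = n then 1 else 0) \<in> c00" for n :: nat
    by (rule c00_I_bound[of "Suc n"]) auto
  have g: "0 \<le> ?g n" for n
    using N_nonneg[OF unit] by simp
  have *: "(\<Sum>E\<leftarrow>Es. N (restrict_seq E a)) \<le> (\<Sum>n\<in>?S \<inter> \<Union>(set Es). ?g n)"
    if "sorted_wrt (\<lambda>E F. Max E < Min F) Es" "\<forall>E\<in>set Es. finite E" for Es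
    using that
  proof (induction Es)
    case (Cons E Es)
    have disj: "E \<inter> F = {}" if "F \<in> set Es" for F
    proof -
      have "Max E < Min F" using Cons.prems that by auto
      moreover have "finite E" "finite F" using Cons.prems that by auto
      ultimately have "\<not> (n \<in> E \<and> n \<in> F)" for n
        by (meson Max_ge Min_le leD order.strict_trans1 order_trans)
      then show ?thesis by blast
    qed
    have "(\<Sum>E\<leftarrow>E # Es. N (restrict_seq E a)) \<le>
        (\<Sum>n\<in>?S \<inter> E. ?g n) + (\<Sum>n\<in>?S \<inter> \<Union>(set Es). ?g n)"
      using Cons N_restrict_le_sum[OF assms, of E] by simp
    also have "\<dots> = (\<Sum>n\<in>(?S \<inter> E) \<union> (?S \<inter> \<Union>(set Es)). ?g n)"
      using disj fin by (intro sum.union_disjoint[symmetric]) auto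
    also have "(?S \<inter> E) \<union> (?S \<inter> \<Union>(set Es)) = ?S \<inter> \<Union>(set (E # Es))" by auto
    finally show ?case .
  qed simp
  show ?thesis
  proof (rule bdd_aboveI2[where M = "\<Sum>n\<in>?S. ?g n"])
    fix Es assume "Es \<in> {Es. admissible Es}"
    then have "(\<Sum>E\<leftarrow>Es. N (restrict_seq E a)) \<le> (\<Sum>n\<in>?S \<inter> \<Union>(set Es). ?g n)"
      by (intro *) (auto simp: admissible_def)
    also have "\<dots> \<le> (\<Sum>n\<in>?S. ?g n)"
      using g fin by (intro sum_mono2) auto
    finally show "(\<Sum>E\<leftarrow>Es. N (restrict_seq E a)) \<le> (\<Sum>n\<in>?S. ?g n)" .
  qed
qed

text \<open>
  The lower half of the defining equation for indexed families: intersecting with the support and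
  discarding empty members gives an admissible list with the same sum.
\<close>

lemma N_ge_successive:
  assumes a: "a \<in> c00" and F: "successive {..<K} F"
    and K: "\<And>j m. j < K \<Longrightarrow> m \<in> F j \<Longrightarrow> K \<le> Suc m"
  shows "(\<Sum>j<K. N (restrict_seq (F j) a)) \<le> 2 * N a"
proof -
  define G where "G j = F j \<inter> {n. a n \<noteq> 0}" for j
  define js where "js = filter (\<lambda>j. G j \<noteq> {}) [0..<K]"
  have fin: "finite (G j)" for j using a by (auto simp: G_def c00_def)
  have RG: "restrict_seq (F j) a = restrict_seq (G j) a" for j
    by (auto simp: restrict_seq_def G_def)
  have "(\<Sum>j<K. N (restrict_seq (F j) a)) = (\<Sum>j\<leftarrow>[0..<K]. N (restrict_seq (G j) a))"
    by (simp add: RG interv_sum_list_conv_sum_set_nat atLeast0LessThan)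
  also have "\<dots> = (\<Sum>j\<leftarrow>js. N (restrict_seq (G j) a))"
    unfolding js_def by (rule sum_list_map_filter[symmetric]) simp
  finally have eq: "(\<Sum>j<K. N (restrict_seq (F j) a)) = (\<Sum>E\<leftarrow>map G js. N (restrict_seq E a))"
    by (simp add: comp_def)
  show ?thesis
  proof (cases "js = []")
    case True
    then show ?thesis using eq a by simp
  next
    case False
    have js: "j < K" "G j \<noteq> {}" if "j \<in> set js" for j
      using that by (auto simp: js_def)
    have "sorted_wrt (<) js"
      unfolding js_def by (intro sorted_wrt_filter) simp
    then have "sorted_wrt (\<lambda>i j. Max (G i) < Min (G j)) js"
    proof (rule sorted_wrt_mono_rel[rotated])
      fix i j assume "i \<in> set js" "j \<in> set js" "i < j"
      then have "Max (G i) \<in> G i" "Min (G j) \<in> G j" using js fin by auto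
      then show "Max (G i) < Min (G j)"
        using successiveD[OF F, of i j] js \<open>i \<in> set js\<close> \<open>j \<in> set js\<close> \<open>i < j\<close>
        by (auto simp: G_def)
    qed
    moreover have "length js \<le> Suc (Min (G (hd js)))"
    proof -
      have "length js \<le> K" unfolding js_def
        by (metis diff_zero length_filter_le length_upt)
      moreover have "hd js \<in> set js" using False by simp
      then have "Min (G (hd js)) \<in> G (hd js)" "hd js < K" using js fin by auto
      then have "K \<le> Suc (Min (G (hd js)))" using K by (auto simp: G_def)
      ultimately show ?thesis by simp
    qed
    ultimately have "admissible (map G js)"
      using False js fin by (auto simp: admissible_def sorted_wrt_map hd_map)
    then have "(\<Sum>E\<leftarrow>map G js. N (restrict_seq E a)) \<le>
        (SUP Es \<in> {Es. admissible Es}. \<Sum>E\<leftarrow>Es. N (restrict_seq E a))"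
      by (intro cSUP_upper bdd_above_admissible_sums a) auto
    then show ?thesis using eq N_unfold[OF a] by simp
  qed
qed

text \<open>
  A family in which one set already contains the whole support contributes at most half of the
  norm itself, so such families cannot determine the norm. This makes the implicit equation usable
  for induction on the size of the support.
\<close>

lemma N_leI:
  assumes a: "a \<in> c00" and B: "0 \<le> B" "\<And>n. \<bar>a n\<bar> \<le> B"
    and F: "\<And>K F. successive {..<K} F \<Longrightarrow> (\<And>j m. j < K \<Longrightarrow> m \<in> F j \<Longrightarrow> K \<le> Suc m) \<Longrightarrow>
      (\<And>j. j < K \<Longrightarrow> \<not> {n. a n \<noteq> 0} \<subseteq> F j) \<Longrightarrow>
      (\<Sum>j<K. N (restrict_seq (F j) a)) \<le> 2 * B"
  shows "N a \<le> B"
proof -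
  have "(SUP Es \<in> {Es. admissible Es}. \<Sum>E\<leftarrow>Es. N (restrict_seq E a)) \<le> max (2 * B) (N a)"
  proof (rule cSUP_least)
    have "admissible [{0}]" by (simp add: admissible_def)
    then show "{Es. admissible Es} \<noteq> {}" by blast
  next
    fix Es assume "Es \<in> {Es. admissible Es}"
    then have adm: "Es \<noteq> []" "\<And>E. E \<in> set Es \<Longrightarrow> finite E \<and> E \<noteq> {}"
        "sorted_wrt (\<lambda>E F. Max E < Min F) Es" "length Es \<le> Suc (Min (hd Es))"
      by (auto simp: admissible_def)
    define K where "K = length Es"
    define F where "F j = Es ! j" for j
    have fin: "finite (F j)" "F j \<noteq> {}" if "j < K" for j
      using adm(2) that by (auto simp: F_def K_def)
    have suc: "successive {..<K} F"
      unfolding successive_def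
    proof (intro ballI impI)
      fix i j m n assume *: "i \<in> {..<K}" "j \<in> {..<K}" "i < j" "m \<in> F i" "n \<in> F j"
      then have "Max (F i) < Min (F j)"
        using adm(3) by (auto simp: sorted_wrt_iff_nth_less F_def K_def)
      then show "m < n" using * fin
        by (meson Max_ge Min_le lessThan_iff order.strict_trans1 order.strict_trans2)
    qed
    have adK: "K \<le> Suc m" if "j < K" "m \<in> F j" for j m
    proof -
      have "0 < K" using that by simp
      have "Min (F 0) \<in> F 0" using fin \<open>0 < K\<close> by simp
      then have "Min (F 0) \<le> m"
        using successiveD[OF suc, of 0 j "Min (F 0)" m] that \<open>0 < K\<close> fin[of 0]
        by (cases "j = 0") simp_all
      then show ?thesis using adm(1,4) by (simp add: F_def K_def hd_conv_nth)
    qed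
    have sum: "(\<Sum>E\<leftarrow>Es. N (restrict_seq E a)) = (\<Sum>j<K. N (restrict_seq (F j) a))"
      by (simp add: sum_list_sum_nth F_def K_def atLeast0LessThan)
    show "(\<Sum>E\<leftarrow>Es. N (restrict_seq E a)) \<le> max (2 * B) (N a)"
    proof (cases "\<exists>j<K. {n. a n \<noteq> 0} \<subseteq> F j")
      case False
      then have "(\<Sum>j<K. N (restrict_seq (F j) a)) \<le> 2 * B"
        by (intro F suc adK) auto
      then show ?thesis using sum by simp
    next
      case True
      then obtain i where i: "i < K" "{n. a n \<noteq> 0} \<subseteq> F i" by blast
      have "restrict_seq (F j) a = (\<lambda>_. 0)" if "j < K" "j \<noteq> i" for j
      proof (rule restrict_seq_eq_0, rule ccontr)
        fix n assume "n \<in> F j" "a n \<noteq> 0"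
        moreover from this i have "n \<in> F i" by auto
        ultimately show False
          using successiveD[OF suc, of i j n n] successiveD[OF suc, of j i n n] i that
          by (cases "i < j") auto
      qed
      then have "(\<Sum>j<K. N (restrict_seq (F j) a)) = (\<Sum>j\<in>{i}. N (restrict_seq (F j) a))"
        using i by (intro sum.mono_neutral_right) auto
      also have "\<dots> = N a" using i by (simp add: restrict_seq_id subset_eq)
      finally show ?thesis using sum by simp
    qed
  qed
  moreover have "Max (range (\<lambda>n. \<bar>a n\<bar>)) \<le> B"
    using finite_range_abs[OF a] B by (subst Max_le_iff) auto
  ultimately have "N a \<le> max B (1/2 * max (2 * B) (N a))"
    unfolding N_unfold[OF a, THEN arg_cong, of "\<lambda>x. x \<le> _"] by auto
  then show ?thesis using N_nonneg[OF a] B(1) by (auto simp: max_def split: if_splits)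
qed


text \<open>
  The Tsirelson basis is 1-unconditional; in particular signs of coordinates and restrictions to
  subsets are harmless.
\<close>

lemma N_mono:
  assumes "a \<in> c00" "b \<in> c00" "\<And>n. \<bar>a n\<bar> \<le> \<bar>b n\<bar>"
  shows "N a \<le> N b"
  using assms
proof (induction "card {n. a n \<noteq> 0}" arbitrary: a b rule: less_induct)
  case less
  show ?case
  proof (rule N_leI[OF less.prems(1)])
    show "0 \<le> N b" using less.prems by simp
    show "\<bar>a n\<bar> \<le> N b" for n
      using less.prems(3)[of n] abs_le_N[OF less.prems(2), of n] by linarith
  next
    fix K F
    assume F: "successive {..<K} F" "\<And>j m. j < K \<Longrightarrow> m \<in> F j \<Longrightarrow> K \<le> Suc m"
      "\<And>j. j < K \<Longrightarrow> \<not> {n. a n \<noteq> 0} \<subseteq> F j"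
    have "N (restrict_seq (F j) a) \<le> N (restrict_seq (F j) b)" if "j < K" for j
    proof (rule less.hyps)
      have "{n. restrict_seq (F j) a n \<noteq> 0} \<subset> {n. a n \<noteq> 0}"
        using F(3)[OF that] by (auto simp: restrict_seq_def)
      moreover have "finite {n. a n \<noteq> 0}" using less.prems(1) by (simp add: c00_def)
      ultimately show "card {n. restrict_seq (F j) a n \<noteq> 0} < card {n. a n \<noteq> 0}"
        by (intro psubset_card_mono)
      show "\<bar>restrict_seq (F j) a n\<bar> \<le> \<bar>restrict_seq (F j) b n\<bar>" for n
        using less.prems(3) by (auto simp: restrict_seq_def)
    qed (use less.prems in auto)
    then have "(\<Sum>j<K. N (restrict_seq (F j) a)) \<le> (\<Sum>j<K. N (restrict_seq (F j) b))"
      by (intro sum_mono) auto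
    also have "\<dots> \<le> 2 * N b"
      by (rule N_ge_successive) (use less.prems F in auto)
    finally show "(\<Sum>j<K. N (restrict_seq (F j) a)) \<le> 2 * N b" .
  qed
qed

lemma N_restrict_le: "a \<in> c00 \<Longrightarrow> N (restrict_seq E a) \<le> N a"
  by (intro N_mono c00_restrict abs_restrict_seq_le)

lemma N_unit_restrict:
  assumes "\<And>n. a n \<noteq> 0 \<Longrightarrow> n = m"
  shows "N a = \<bar>a m\<bar>"
proof (rule antisym)
  have a: "a \<in> c00" by (rule c00_I_bound[of "Suc m"]) (use assms in fastforce)
  show "\<bar>a m\<bar> \<le> N a" by (rule abs_le_N[OF a])
  show "N a \<le> \<bar>a m\<bar>"
  proof (rule N_leI[OF a])
    show "\<bar>a n\<bar> \<le> \<bar>a m\<bar>" for n using assms[of n] by (cases "a n = 0") auto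
  next
    fix K F assume F: "\<And>j. j < K \<Longrightarrow> \<not> {n. a n \<noteq> 0} \<subseteq> F j"
    have "restrict_seq (F j) a = (\<lambda>_. 0)" if "j < K" for j
      using F[OF that] assms by (intro restrict_seq_eq_0) blast
    then show "(\<Sum>j<K. N (restrict_seq (F j) a)) \<le> 2 * \<bar>a m\<bar>" by simp
  qed simp
qed

lemma block_norms_c00:
  assumes "x \<in> c00" "\<And>k m. m \<in> E k \<Longrightarrow> k \<le> m"
  shows "(\<lambda>k. N (restrict_seq (E k) x)) \<in> c00"
proof -
  obtain m where m: "\<forall>n\<ge>m. x n = 0" using c00_bound[OF assms(1)] by blast
  show ?thesis
  proof (rule c00_I_bound[of m])
    fix k assume "k \<ge> m"
    then have "restrict_seq (E k) x = (\<lambda>_. 0)"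
      using m assms(2) by (intro restrict_seq_eq_0) (meson order_trans)
    then show "N (restrict_seq (E k) x) = 0" by simp
  qed
qed

text \<open>
  The basic lower estimate of Tsirelson space. A family of index sets admissible for the sequence of
  block norms yields, by taking unions of the corresponding \<open>E k\<close>, a family admissible for \<open>x\<close>,
  because a union over indices \<open>k \<ge> m\<close> consists of numbers \<open>\<ge> m\<close>. Induction on the support does the rest.
\<close>

lemma N_block_norms_le:
  assumes "x \<in> c00" and E: "successive UNIV E" "\<And>k m. m \<in> E k \<Longrightarrow> k \<le> m"
  shows "N (\<lambda>k. N (restrict_seq (E k) x)) \<le> N x"
  using assms(1)
proof (induction "card {k. N (restrict_seq (E k) x) \<noteq> 0}" arbitrary: x rule: less_induct)
  case less
  define c where "c k = N (restrict_seq (E k) x)" for k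
  have c: "c \<in> c00" unfolding c_def by (rule block_norms_c00[OF less.prems E(2)])
  have "N c \<le> N x"
  proof (rule N_leI[OF c])
    show "0 \<le> N x" using less.prems by simp
    show "\<bar>c k\<bar> \<le> N x" for k
      using less.prems N_restrict_le[OF less.prems, of "E k"] by (simp add: c_def)
  next
    fix K F
    assume F: "successive {..<K} F" "\<And>j m. j < K \<Longrightarrow> m \<in> F j \<Longrightarrow> K \<le> Suc m"
      "\<And>j. j < K \<Longrightarrow> \<not> {n. c n \<noteq> 0} \<subseteq> F j"
    define G where "G j = (\<Union>k\<in>F j. E k)" for j
    have disj: "E k \<inter> E l = {}" if "k \<noteq> l" for k l
      using successiveD[OF E(1), of k l] successiveD[OF E(1), of l k] that
      by (metis Int_emptyI UNIV_I less_irrefl linorder_neqE_nat)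
    have rG: "restrict_seq (E k) (restrict_seq (G j) x) =
        (if k \<in> F j then restrict_seq (E k) x else (\<lambda>_. 0))" for k j
      using disj[of k] by (fastforce simp: restrict_seq_def G_def fun_eq_iff)
    have rc: "restrict_seq (F j) c = (\<lambda>k. N (restrict_seq (E k) (restrict_seq (G j) x)))" for j
      unfolding rG by (auto simp: restrict_seq_def c_def)
    have "N (restrict_seq (F j) c) \<le> N (restrict_seq (G j) x)" if "j < K" for j
      unfolding rc
    proof (rule less.hyps)
      have "{k. N (restrict_seq (E k) (restrict_seq (G j) x)) \<noteq> 0} \<subset> {k. c k \<noteq> 0}"
        using F(3)[OF that] unfolding rG by (auto simp: c_def)
      moreover have "finite {k. c k \<noteq> 0}" using c by (simp add: c00_def)
      ultimately show "card {k. N (restrict_seq (E k) (restrict_seq (G j) x)) \<noteq> 0}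
          < card {k. N (restrict_seq (E k) x) \<noteq> 0}"
        unfolding c_def by (intro psubset_card_mono)
    qed (use less.prems in simp)
    then have "(\<Sum>j<K. N (restrict_seq (F j) c)) \<le> (\<Sum>j<K. N (restrict_seq (G j) x))"
      by (intro sum_mono) auto
    also have "\<dots> \<le> 2 * N x"
    proof (rule N_ge_successive[OF less.prems])
      show "successive {..<K} G"
        unfolding successive_def
      proof (intro ballI impI)
        fix i j m n assume *: "i \<in> {..<K}" "j \<in> {..<K}" "i < j" "m \<in> G i" "n \<in> G j"
        then obtain k l where "k \<in> F i" "m \<in> E k" "l \<in> F j" "n \<in> E l" by (auto simp: G_def)
        moreover from this * have "k < l" using successiveD[OF F(1), of i j k l] by simp
        ultimately show "m < n" using successiveD[OF E(1), of k l m n] by simp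
      qed
      show "K \<le> Suc m" if j: "j < K" and m: "m \<in> G j" for j m
      proof -
        obtain k where "k \<in> F j" "m \<in> E k" using m unfolding G_def by blast
        then show ?thesis using F(2)[OF j, of k] E(2)[of m k] by linarith
      qed
    qed
    finally show "(\<Sum>j<K. N (restrict_seq (F j) c)) \<le> 2 * N x" .
  qed
  then show ?case unfolding c_def .
qed


section \<open>Averages of blocks in Tsirelson space\<close>

lemma N_sum_scale:
  assumes "\<And>k. k \<in> A \<Longrightarrow> z k \<in> c00"
  shows "N (\<lambda>n. r * (\<Sum>k\<in>A. z k n)) \<le> \<bar>r\<bar> * (\<Sum>k\<in>A. N (z k))"
proof -
  have "N (\<lambda>n. r * (\<Sum>k\<in>A. z k n)) = \<bar>r\<bar> * N (\<lambda>n. \<Sum>k\<in>A. z k n)"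
    by (intro N_scale c00_sum assms)
  also have "\<dots> \<le> \<bar>r\<bar> * (\<Sum>k\<in>A. N (z k))"
    by (intro mult_left_mono N_sum assms) auto
  finally show ?thesis .
qed

text \<open>
  The estimate of Figiel and Johnson. An admissible family that meets \<open>z0\<close> has at most \<open>n0\<close> members.
  A block \<open>z i\<close> met by only one of them contributes at most half of its norm, and at most \<open>n0\<close> blocks are met
  by two or more. So for large \<open>r\<close> the norm is at most about \<open>3/2\<close> times \<open>D\<close>, whereas normalised vectors in \<open>\<ell>\<^sub>1\<close>
  would give the factor \<open>2\<close>.
\<close>

lemma N_average_le:
  fixes z :: "nat \<Rightarrow> nat \<Rightarrow> real" and D :: real and r n0 :: nat
  assumes r: "0 < r" and z0: "z0 \<in> c00" "\<And>n. n \<ge> n0 \<Longrightarrow> z0 n = 0" "N z0 \<le> D"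
    and z: "\<And>i. i < r \<Longrightarrow> z i \<in> c00" "\<And>i n. i < r \<Longrightarrow> n < n0 \<Longrightarrow> z i n = 0"
      "\<And>i. i < r \<Longrightarrow> N (z i) \<le> D"
    and suc: "successive {..<r} (\<lambda>i. {n. z i n \<noteq> 0})"
  shows "N (\<lambda>n. z0 n + 1 / r * (\<Sum>i<r. z i n)) \<le> D * (3 / 2 + n0 / (2 * r))"
proof -
  define y where "y n = 1 / r * (\<Sum>i<r. z i n)" for n
  have y: "y \<in> c00" unfolding y_def by (intro c00_scale c00_sum z) auto
  have D: "0 \<le> D" using z0 N_nonneg[OF z0(1)] by linarith
  have "N y \<le> \<bar>1 / r\<bar> * (\<Sum>i<r. N (z i))"
    unfolding y_def by (rule N_sum_scale) (use z in auto)
  also have "\<dots> \<le> \<bar>1 / r\<bar> * (\<Sum>i<r. D)"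
    by (intro mult_left_mono sum_mono z) auto
  also have "\<dots> = D" using r by simp
  finally have Ny: "N y \<le> D" .
  define B where "B = D * (3 / 2 + n0 / (2 * r))"
  have DB: "D \<le> B"
  proof -
    have "0 \<le> n0 / (2 * r)" by simp
    then have "1 \<le> 3 / 2 + n0 / (2 * r)" by linarith
    from mult_left_mono[OF this D] show ?thesis by (simp add: B_def)
  qed
  have "N (\<lambda>n. z0 n + y n) \<le> B"
  proof (rule N_leI)
    show "(\<lambda>n. z0 n + y n) \<in> c00" using z0 y by simp
    show "0 \<le> B" using D DB by linarith
    show "\<bar>z0 n + y n\<bar> \<le> B" for n
    proof (cases "n < n0")
      case True
      then have "y n = 0" using z by (auto simp: y_def)
      then show ?thesis using abs_le_N[OF z0(1), of n] z0(3) DB by simp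
    next
      case False
      then show ?thesis using abs_le_N[OF y, of n] z0(2)[of n] Ny DB by simp
    qed
  next
    fix K :: nat and F
    assume F: "successive {..<K} F" "\<And>j m. j < K \<Longrightarrow> m \<in> F j \<Longrightarrow> K \<le> Suc m"
    have split: "(\<Sum>j<K. N (restrict_seq (F j) (\<lambda>n. z0 n + y n))) \<le>
        (\<Sum>j<K. N (restrict_seq (F j) z0)) + (\<Sum>j<K. N (restrict_seq (F j) y))"
      unfolding restrict_seq_add sum.distrib[symmetric]
      by (intro sum_mono N_add c00_restrict z0 y)
    show "(\<Sum>j<K. N (restrict_seq (F j) (\<lambda>n. z0 n + y n))) \<le> 2 * B"
    proof (cases "K \<le> n0")
      case False
      have "restrict_seq (F j) z0 = (\<lambda>_. 0)" if "j < K" for j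
      proof (rule restrict_seq_eq_0)
        fix n assume "n \<in> F j"
        then have "n0 \<le> n" using F(2)[OF that, of n] False by linarith
        then show "z0 n = 0" by (rule z0)
      qed
      then have "(\<Sum>j<K. N (restrict_seq (F j) z0)) = 0" by simp
      moreover have "(\<Sum>j<K. N (restrict_seq (F j) y)) \<le> 2 * N y"
        by (rule N_ge_successive[OF y F])
      ultimately show ?thesis using split Ny DB by linarith
    next
      case True
      define bad where "bad = {i\<in>{..<r}. \<exists>j<K. \<exists>l<K. j < l \<and>
        (\<exists>n\<in>F j. z i n \<noteq> 0) \<and> (\<exists>n\<in>F l. z i n \<noteq> 0)}"
      have "\<exists>g. \<forall>i\<in>bad. g i < K \<and> (\<exists>l<K. g i < l \<and>
          (\<exists>n\<in>F (g i). z i n \<noteq> 0) \<and> (\<exists>n\<in>F l. z i n \<noteq> 0))"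
        by (rule bchoice) (auto simp: bad_def)
      then obtain g where g: "\<And>i. i \<in> bad \<Longrightarrow> g i < K \<and> (\<exists>l<K. g i < l \<and>
          (\<exists>n\<in>F (g i). z i n \<noteq> 0) \<and> (\<exists>n\<in>F l. z i n \<noteq> 0))" by blast
      \<comment> \<open>two blocks cannot both start in the same set and reach into a later one\<close>
      have g_ne: "g i \<noteq> g i'" if ii: "i \<in> bad" "i' \<in> bad" "i < i'" for i i'
      proof
        assume eq: "g i = g i'"
        obtain l n where l: "l < K" "g i < l" "n \<in> F l" "z i n \<noteq> 0" "g i < K"
          using g[OF ii(1)] by blast
        obtain n' where n': "n' \<in> F (g i)" "z i' n' \<noteq> 0"
          using g[OF ii(2)] eq by auto
        have "n' < n" using successiveD[OF F(1), of "g i" l n' n] l n' by simp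
        moreover have "n < n'"
          using successiveD[OF suc, of i i' n n'] ii l n' by (simp add: bad_def)
        ultimately show False by simp
      qed
      have "inj_on g bad"
      proof (rule inj_onI, rule ccontr)
        fix i i' assume "i \<in> bad" "i' \<in> bad" "g i = g i'" "i \<noteq> i'"
        then show False using g_ne[of i i'] g_ne[of i' i] by (cases "i < i'") auto
      qed
      then have "card bad \<le> card {..<K}"
        by (rule card_inj_on_le) (use g in auto)
      then have card_bad: "card bad \<le> n0" using True by simp
      have z_sum: "(\<Sum>j<K. N (restrict_seq (F j) (z i))) \<le> D + (if i \<in> bad then D else 0)"
        if i: "i < r" for i
      proof (cases "i \<in> bad")
        case True
        have "(\<Sum>j<K. N (restrict_seq (F j) (z i))) \<le> 2 * N (z i)"
          by (rule N_ge_successive[OF z(1)[OF i] F])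
        then show ?thesis using True z(3)[OF i] by simp
      next
        case False
        have uniq: "j = l" if "j < K" "l < K" "\<exists>n\<in>F j. z i n \<noteq> 0" "\<exists>n\<in>F l. z i n \<noteq> 0" for j l
        proof (rule ccontr)
          assume "j \<noteq> l"
          then consider "j < l" | "l < j" by linarith
          then show False using that False i unfolding bad_def by cases blast+
        qed
        have z0': "restrict_seq (F j) (z i) = (\<lambda>_. 0)" if "\<not> (\<exists>n\<in>F j. z i n \<noteq> 0)" for j
          using that by (intro restrict_seq_eq_0) blast
        show ?thesis
        proof (cases "\<exists>j<K. \<exists>n\<in>F j. z i n \<noteq> 0")
          case True
          then obtain j where j: "j < K" "\<exists>n\<in>F j. z i n \<noteq> 0" by blast
          have "N (restrict_seq (F l) (z i)) = 0" if "l < K" "l \<noteq> j" for l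
          proof -
            have "\<not> (\<exists>n\<in>F l. z i n \<noteq> 0)" using uniq[of l j] that j by blast
            from z0'[OF this] show ?thesis by simp
          qed
          then have "(\<Sum>l<K. N (restrict_seq (F l) (z i))) = (\<Sum>l\<in>{j}. N (restrict_seq (F l) (z i)))"
            using j by (intro sum.mono_neutral_right) auto
          also have "\<dots> \<le> N (z i)" by (simp add: N_restrict_le z i)
          finally show ?thesis using False z(3)[OF i] by simp
        next
          case none: False
          then have "(\<Sum>j<K. N (restrict_seq (F j) (z i))) = 0" by (simp add: z0')
          then show ?thesis using D by simp
        qed
      qed
      have "(\<Sum>j<K. N (restrict_seq (F j) y)) \<le>
          (\<Sum>j<K. \<bar>1 / r\<bar> * (\<Sum>i<r. N (restrict_seq (F j) (z i))))"
        unfolding y_def restrict_seq_scale restrict_seq_sum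
        by (intro sum_mono N_sum_scale c00_restrict z) auto
      also have "\<dots> = 1 / r * (\<Sum>i<r. \<Sum>j<K. N (restrict_seq (F j) (z i)))"
        by (subst sum.swap) (simp add: sum_distrib_left)
      also have "\<dots> \<le> 1 / r * (\<Sum>i<r. D + (if i \<in> bad then D else 0))"
        using z_sum by (intro mult_left_mono sum_mono) auto
      also have "(\<Sum>i<r. D + (if i \<in> bad then D else 0)) = r * D + card bad * D"
        by (simp add: sum.distrib sum.If_cases bad_def Int_def)
      also have "1 / r * (r * D + card bad * D) \<le> 1 / r * (r * D + n0 * D)"
        using card_bad D by (intro mult_left_mono add_left_mono mult_right_mono) auto
      also have "\<dots> = D + n0 * D / r" using r by (simp add: field_simps)
      finally have 1: "(\<Sum>j<K. N (restrict_seq (F j) y)) \<le> D + n0 * D / r" .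
      have "(\<Sum>j<K. N (restrict_seq (F j) z0)) \<le> 2 * N z0"
        by (rule N_ge_successive[OF z0(1) F])
      then have "(\<Sum>j<K. N (restrict_seq (F j) z0)) + (\<Sum>j<K. N (restrict_seq (F j) y)) \<le>
          3 * D + n0 * D / r"
        using 1 z0(3) by linarith
      also have "\<dots> = 2 * B" using r by (simp add: B_def field_simps)
      finally show ?thesis using split by linarith
    qed
  qed
  then show ?thesis unfolding B_def y_def .
qed

end

definition tail_average :: "(nat \<Rightarrow> nat \<Rightarrow> real) \<Rightarrow> nat \<Rightarrow> nat \<Rightarrow> (nat \<Rightarrow> real) \<Rightarrow> bool" where
  "tail_average w m b z \<longleftrightarrow> (\<exists>c. (\<forall>k. 0 \<le> c k) \<and> (\<forall>k<m. c k = 0) \<and> (\<forall>k\<ge>b. c k = 0) \<and>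
     (\<Sum>k<b. c k) = 1 \<and> z = (\<lambda>n. \<Sum>k<b. c k * w k n))"

lemma tail_average_weaken:
  assumes "tail_average w m b z" "m' \<le> m" "b \<le> b'"
  shows "tail_average w m' b' z"
proof -
  obtain c where c: "\<forall>k. 0 \<le> c k" "\<forall>k<m. c k = 0" "\<forall>k\<ge>b. c k = 0"
     "(\<Sum>k<b. c k) = 1" "z = (\<lambda>n. \<Sum>k<b. c k * w k n)"
    using assms(1) by (auto simp: tail_average_def)
  have "(\<Sum>k<b'. c k * f k) = (\<Sum>k<b. c k * f k)" for f :: "nat \<Rightarrow> real"
    using c(3) assms(3) by (intro sum.mono_neutral_right) auto
  from this[of "\<lambda>_. 1"] this show ?thesis
    unfolding tail_average_def using c assms by (intro exI[of _ c]) auto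
qed

lemma tail_average_convex:
  fixes r :: nat
  assumes z: "\<And>i. i < r \<Longrightarrow> tail_average w m (b i) (z i)"
    and l: "\<And>i. i < r \<Longrightarrow> 0 \<le> l i" "(\<Sum>i<r. l i) = 1"
  shows "\<exists>b'. tail_average w m b' (\<lambda>n. \<Sum>i<r. l i * z i n)"
proof -
  define b' where "b' = (\<Sum>i<r. b i)"
  have "b i \<le> b'" if "i < r" for i
    unfolding b'_def using that by (intro member_le_sum) auto
  then have "\<forall>i\<in>{..<r}. tail_average w m b' (z i)"
    using z tail_average_weaken by blast
  then have "\<forall>i\<in>{..<r}. \<exists>c. (\<forall>k. 0 \<le> c k) \<and> (\<forall>k<m. c k = 0) \<and> (\<forall>k\<ge>b'. c k = 0) \<and>
     (\<Sum>k<b'. c k) = 1 \<and> z i = (\<lambda>n. \<Sum>k<b'. c k * w k n)"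
    by (simp only: tail_average_def)
  from bchoice[OF this] obtain c where c: "\<forall>i\<in>{..<r}. (\<forall>k. 0 \<le> c i k) \<and> (\<forall>k<m. c i k = 0) \<and>
     (\<forall>k\<ge>b'. c i k = 0) \<and> (\<Sum>k<b'. c i k) = 1 \<and> z i = (\<lambda>n. \<Sum>k<b'. c i k * w k n)" by blast
  let ?c = "\<lambda>k. \<Sum>i<r. l i * c i k"
  have "(\<Sum>k<b'. ?c k) = (\<Sum>i<r. l i * (\<Sum>k<b'. c i k))"
    by (subst sum.swap) (simp add: sum_distrib_left)
  then have 1: "(\<Sum>k<b'. ?c k) = 1" using c l by simp
  have 2: "(\<Sum>i<r. l i * z i n) = (\<Sum>k<b'. ?c k * w k n)" for n
  proof -
    have "(\<Sum>i<r. l i * z i n) = (\<Sum>i<r. \<Sum>k<b'. l i * (c i k * w k n))"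
      using c by (intro sum.cong) (auto simp: sum_distrib_left)
    also have "\<dots> = (\<Sum>k<b'. ?c k * w k n)"
      by (subst sum.swap) (simp add: sum_distrib_right mult.assoc)
    finally show ?thesis .
  qed
  have "tail_average w m b' (\<lambda>n. \<Sum>i<r. l i * z i n)"
    unfolding tail_average_def
    by (rule exI[of _ ?c]) (use 1 2 c l in \<open>auto intro!: sum_nonneg\<close>)
  then show ?thesis by blast
qed

context tsirelson begin

text \<open>
  No block sequence of \<open>T\<close> spans \<open>\<ell>\<^sub>1\<close>. Let \<open>\<theta> k\<close> be the infimum of the norms of the averages of blocks
  with index at least \<open>k\<close>. If these norms stay away from 0, then \<open>\<theta>\<close> increases to a positive limit,
  and averages whose norms almost equal this limit behave almost isometrically like \<open>\<ell>\<^sub>1\<close> (James). This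
  contradicts the factor \<open>3/2\<close> above.
\<close>

lemma tail_averages_tend_to_0:
  assumes w: "\<And>k. w k \<in> c00" "\<And>k. N (w k) \<le> 1" "successive UNIV (\<lambda>k. {n. w k n \<noteq> 0})"
      "\<And>k n. w k n \<noteq> 0 \<Longrightarrow> k \<le> n"
    and "0 < \<epsilon>"
  shows "\<exists>b z. tail_average w m b z \<and> N z < \<epsilon>"
proof (rule ccontr)
  assume "\<nexists>b z. tail_average w m b z \<and> N z < \<epsilon>"
  then have big: "\<epsilon> \<le> N z" if "tail_average w m b z" for b z using that by (meson not_less)
  have c00: "z \<in> c00" if "tail_average w k b z" for k b z
    using that unfolding tail_average_def by (auto intro!: c00_sum c00_scale w(1))
  define S where "S k = {N z |b z. tail_average w k b z}" for k
  define \<theta> where "\<theta> k = Inf (S k)" for k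
  have unit: "tail_average w k (Suc k) (w k)" for k
  proof -
    have "(\<Sum>i<Suc k. (if i = k then 1 else 0) * f i) = f k" for f :: "nat \<Rightarrow> real"
      by (subst sum.mono_neutral_right[of _ "{k}"]) auto
    from this this[of "\<lambda>_. 1"] show ?thesis unfolding tail_average_def
      by (intro exI[of _ "\<lambda>i. if i = k then 1 else 0"]) auto
  qed
  then have ne: "N (w k) \<in> S k" for k unfolding S_def by blast
  have bdd: "bdd_below (S k)" for k
    by (rule bdd_belowI[of _ 0]) (auto simp: S_def dest!: c00)
  have \<theta>_le1: "\<theta> k \<le> 1" for k
    unfolding \<theta>_def using cInf_lower[OF ne bdd, of k] w(2)[of k] by linarith
  then have bddT: "bdd_above (range \<theta>)" by (intro bdd_aboveI[of _ 1]) auto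
  define T where "T = (SUP k. \<theta> k)"
  have \<theta>_le: "\<theta> k \<le> T" for k unfolding T_def by (rule cSUP_upper[OF _ bddT]) simp
  have "\<epsilon> \<le> \<theta> m"
    unfolding \<theta>_def by (rule cInf_greatest) (use unit[of m] big in \<open>auto simp: S_def\<close>)
  then have T: "0 < T" using \<theta>_le[of m] \<open>0 < \<epsilon>\<close> by linarith
  \<comment> \<open>\<open>1 / 2 * (17 / 16) * (3 / 2 + 1 / 16) < 15 / 16\<close> gives the contradiction\<close>
  have "\<exists>k\<in>UNIV. 15 / 16 * T < \<theta> k"
    unfolding T_def by (rule less_cSUP_iff[THEN iffD1, OF _ bddT]) (use T in \<open>auto simp: T_def\<close>)
  then obtain n where n: "15 / 16 * T < \<theta> n" by blast
  have "\<exists>b z. tail_average w k b z \<and> N z < 17 / 16 * T \<and> k \<le> b" for k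
  proof -
    have "Inf (S k) < 17 / 16 * T" using \<theta>_le[of k] T by (simp add: \<theta>_def)
    then obtain v where "v \<in> S k" "v < 17 / 16 * T"
      using cInf_lessD[of "S k"] ne[of k] by blast
    then obtain b z where z: "tail_average w k b z" "N z < 17 / 16 * T" by (auto simp: S_def)
    have "tail_average w k (max b k) z" by (rule tail_average_weaken[OF z(1)]) auto
    then show ?thesis using z(2) by (intro exI[of _ "max b k"] exI[of _ z]) auto
  qed
  then have "\<forall>k. \<exists>p. tail_average w k (fst p) (snd p) \<and> N (snd p) < 17 / 16 * T \<and> k \<le> fst p"
    by (metis fst_conv snd_conv)
  from choice[OF this] obtain p where p: "\<And>k. tail_average w k (fst (p k)) (snd (p k))"
      "\<And>k. N (snd (p k)) < 17 / 16 * T" "\<And>k. k \<le> fst (p k)" by blast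
  define b where "b k = fst (p k)" for k
  define Z where "Z k = snd (p k)" for k
  have Z: "tail_average w k (b k) (Z k)" "N (Z k) < 17 / 16 * T" "k \<le> b k" "Z k \<in> c00" for k
    using p[of k] c00 by (auto simp: b_def Z_def)
  have supp: "\<exists>i. k \<le> i \<and> i < b k \<and> w i j \<noteq> 0" if nz: "Z k j \<noteq> 0" for k j
  proof -
    obtain c where c: "\<forall>i<k. c i = 0" "Z k = (\<lambda>n. \<Sum>i<b k. c i * w i n)"
      using Z(1)[of k] unfolding tail_average_def by blast
    have "(\<Sum>i<b k. c i * w i j) \<noteq> 0" using nz c(2) by simp
    then obtain i where "i \<in> {..<b k}" "c i * w i j \<noteq> 0" by (rule sum.not_neutral_contains_not_neutral)
    then show ?thesis using c(1) by (intro exI[of _ i]) (auto simp: not_less[symmetric])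
  qed
  obtain n0 where n0: "\<forall>j\<ge>n0. Z n j = 0" using c00_bound[OF Z(4)[of n]] by blast
  define q where "q i = (b ^^ i) (max n n0)" for i
  have q_Suc: "q (Suc i) = b (q i)" for i by (simp add: q_def)
  have "q i \<le> q (Suc i)" for i using Z(3)[of "q i"] by (simp add: q_Suc)
  then have q_mono: "q i \<le> q j" if "i \<le> j" for i j using lift_Suc_mono_le[of q] that by blast
  have q0: "q 0 = max n n0" by (simp add: q_def)
  have q_ge: "n \<le> q i" "n0 \<le> q i" for i using q_mono[of 0 i] q0 by auto
  \<comment> \<open>this makes \<open>n0 / (2 * r)\<close> at most \<open>1 / 16\<close>\<close>
  define r where "r = 8 * n0 + 1"
  define y where "y i = Z (q i)" for i
  have "N (\<lambda>j. Z n j + 1 / real r * (\<Sum>i<r. y i j)) \<le> 17 / 16 * T * (3 / 2 + n0 / (2 * r))"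
  proof (rule N_average_le)
    show "0 < r" by (simp add: r_def)
    show "y i j = 0" if "j < n0" for i j
    proof (rule ccontr)
      assume "y i j \<noteq> 0"
      then obtain k where "q i \<le> k" "w k j \<noteq> 0" using supp by (auto simp: y_def)
      then show False using w(4)[of k j] q_ge[of i] that by linarith
    qed
    show "successive {..<r} (\<lambda>i. {n. y i n \<noteq> 0})"
      unfolding successive_def
    proof (intro ballI impI)
      fix i j l l' assume *: "i < j" "l \<in> {n. y i n \<noteq> 0}" "l' \<in> {n. y j n \<noteq> 0}"
      obtain k where k: "k < b (q i)" "w k l \<noteq> 0" using supp[of "q i" l] * by (auto simp: y_def)
      obtain k' where k': "q j \<le> k'" "w k' l' \<noteq> 0" using supp[of "q j" l'] * by (auto simp: y_def)
      have "k < k'" using k k' q_mono[of "Suc i" j] * by (simp add: q_Suc)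
      then show "l < l'" using successiveD[OF w(3), of k k' l l'] k k' by simp
    qed
  qed (use Z n0 in \<open>auto simp: y_def less_imp_le\<close>)
  also have "\<dots> \<le> 17 / 16 * T * (3 / 2 + 1 / 16)"
    using T by (intro mult_left_mono add_left_mono) (auto simp: r_def field_simps)
  finally have upper: "N (\<lambda>j. Z n j + 1 / real r * (\<Sum>i<r. y i j)) \<le> 425 / 256 * T" by simp
  \<comment> \<open>half of the vector just estimated is again an average of blocks beyond \<open>n\<close>\<close>
  define l where "l i = (if i = 0 then 1 / 2 else 1 / (2 * real r))" for i :: nat
  define X where "X i = (case i of 0 \<Rightarrow> Z n | Suc i \<Rightarrow> y i)" for i :: nat
  have l_sum: "(\<Sum>i<Suc r. l i) = 1"
    by (subst sum.lessThan_Suc_shift) (simp add: l_def r_def field_simps)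
  have X_sum: "(\<Sum>i<Suc r. l i * X i j) = 1 / 2 * (Z n j + 1 / real r * (\<Sum>i<r. y i j))" for j
    by (subst sum.lessThan_Suc_shift) (simp add: l_def X_def sum_distrib_left field_simps)
  have Xav: "tail_average w n (case i of 0 \<Rightarrow> b n | Suc i \<Rightarrow> b (q i)) (X i)" for i
    using Z(1)[of n] tail_average_weaken[OF Z(1) q_ge(1)]
    by (auto simp: X_def y_def split: nat.split)
  have l_nonneg: "0 \<le> l i" for i by (simp add: l_def)
  obtain b' where b': "tail_average w n b' (\<lambda>j. \<Sum>i<Suc r. l i * X i j)"
    using tail_average_convex[of "Suc r" w n _ X l, OF Xav l_nonneg l_sum] by blast
  then have "N (\<lambda>j. \<Sum>i<Suc r. l i * X i j) \<in> S n" unfolding S_def by blast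
  then have "\<theta> n \<le> N (\<lambda>j. \<Sum>i<Suc r. l i * X i j)"
    unfolding \<theta>_def by (rule cInf_lower[OF _ bdd])
  also have "\<dots> = 1 / 2 * N (\<lambda>j. Z n j + 1 / real r * (\<Sum>i<r. y i j))"
  proof -
    have "(\<lambda>j. Z n j + 1 / real r * (\<Sum>i<r. y i j)) \<in> c00"
      using Z(4) by (intro c00_add c00_scale c00_sum) (auto simp: y_def)
    from N_scale[OF this, of "1 / 2"] show ?thesis unfolding X_sum by simp
  qed
  finally show False using upper n T by linarith
qed

end

section \<open>The norm of the subsymmetrized dual\<close>

lemma mult_le_abs_mult: "x * y \<le> \<bar>x\<bar> * \<bar>y :: real\<bar>"
  using abs_ge_self[of "x * y"] by (simp add: abs_mult)

definition pair :: "(nat \<Rightarrow> real) \<Rightarrow> (nat \<Rightarrow> real) \<Rightarrow> real" where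
  "pair b w = (\<Sum>i | w i \<noteq> 0. b i * w i)"

lemma pair_eq: "finite A \<Longrightarrow> (\<And>i. w i \<noteq> 0 \<Longrightarrow> i \<in> A) \<Longrightarrow> pair b w = (\<Sum>i\<in>A. b i * w i)"
  unfolding pair_def by (intro sum.mono_neutral_left) auto

definition blocks :: "(nat \<Rightarrow> nat \<Rightarrow> real) \<Rightarrow> (nat \<Rightarrow> nat) \<Rightarrow> bool" where
  "blocks u L \<longleftrightarrow> strict_mono L \<and> (\<forall>k n. u k n \<noteq> 0 \<longrightarrow> L k \<le> n \<and> n < L (Suc k))"

definition combination :: "(nat \<Rightarrow> real) \<Rightarrow> (nat \<Rightarrow> nat \<Rightarrow> real) \<Rightarrow> nat set \<Rightarrow> nat \<Rightarrow> real" where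
  "combination a u A n = (\<Sum>k\<in>A. a k * u k n)"

lemma interval_unique:
  fixes L :: "nat \<Rightarrow> nat"
  assumes "strict_mono L" "L k \<le> n" "n < L (Suc k)" "L l \<le> n" "n < L (Suc l)"
  shows "k = l"
proof (rule ccontr)
  assume "k \<noteq> l"
  then consider "Suc k \<le> l" | "Suc l \<le> k" by linarith
  then show False
  proof cases
    case 1
    then have "L (Suc k) \<le> L l" using assms(1) by (simp add: strict_mono_less_eq)
    then show False using assms by linarith
  next
    case 2
    then have "L (Suc l) \<le> L k" using assms(1) by (simp add: strict_mono_less_eq)
    then show False using assms by linarith
  qed
qed

lemma blocksD: "blocks u L \<Longrightarrow> u k n \<noteq> 0 \<Longrightarrow> L k \<le> n \<and> n < L (Suc k)"
  unfolding blocks_def by blast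

lemma blocks_successive: "blocks u L \<Longrightarrow> successive A (\<lambda>k. {n. L k \<le> n \<and> n < L (Suc k)})"
  unfolding successive_def
proof (intro ballI impI)
  fix i j m n assume "blocks u L" "i < j" and m: "m \<in> {n. L i \<le> n \<and> n < L (Suc i)}"
    and n: "n \<in> {n. L j \<le> n \<and> n < L (Suc j)}"
  then have "L (Suc i) \<le> L j" by (simp add: blocks_def strict_mono_less_eq)
  then show "m < n" using m n by simp
qed

lemma blocks_c00: "blocks u L \<Longrightarrow> u k \<in> c00"
  by (rule c00_I_bound[of "L (Suc k)"]) (auto simp: blocks_def not_less[symmetric])

lemma combination_c00: "blocks u L \<Longrightarrow> combination a u A \<in> c00"
  unfolding combination_def[abs_def] by (intro c00_sum c00_scale blocks_c00)

lemma combination_at: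
  assumes "blocks u L" "finite A" "L k \<le> n" "n < L (Suc k)"
  shows "combination a u A n = (if k \<in> A then a k * u k n else 0)"
proof -
  have "a l * u l n = 0" if "l \<noteq> k" for l
    using interval_unique[of L k n l] assms that by (auto simp: blocks_def)
  then have "combination a u A n = (\<Sum>l\<in>A. if k = l then a l * u l n else 0)"
    unfolding combination_def by (intro sum.cong) auto
  then show ?thesis using assms by simp
qed

context tsirelson begin

text \<open>
  Only the number of sets matters for admissibility, not the indices that they carry.
\<close>

lemma N_ge_successive_on:
  assumes a: "a \<in> c00" and A: "finite A" "successive A F"
    "\<And>k m. k \<in> A \<Longrightarrow> m \<in> F k \<Longrightarrow> card A \<le> Suc m"
  shows "(\<Sum>k\<in>A. N (restrict_seq (F k) a)) \<le> 2 * N a"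
proof -
  have bij: "bij_betw (enumerate A) {..<card A} A" by (rule finite_bij_enumerate[OF A(1)])
  have "(\<Sum>k\<in>A. N (restrict_seq (F k) a)) =
      (\<Sum>j<card A. N (restrict_seq (F (enumerate A j)) a))"
    by (rule sum.reindex_bij_betw[OF bij, symmetric])
  also have "\<dots> \<le> 2 * N a"
  proof (rule N_ge_successive[OF a])
    show "successive {..<card A} (\<lambda>j. F (enumerate A j))"
      unfolding successive_def
    proof (intro ballI impI)
      fix i j m n assume "i \<in> {..<card A}" "j \<in> {..<card A}" "i < j"
        and mn: "m \<in> F (enumerate A i)" "n \<in> F (enumerate A j)"
      then have "enumerate A i < enumerate A j" "enumerate A i \<in> A" "enumerate A j \<in> A"
        using finite_enumerate_mono[of i j A] bij_betwE[OF bij] A(1) by auto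
      then show "m < n" using successiveD[OF A(2)] mn by blast
    qed
    show "card A \<le> Suc m" if "j < card A" "m \<in> F (enumerate A j)" for j m
      using A(3)[of "enumerate A j" m] that bij_betwE[OF bij] by auto
  qed
  finally show ?thesis .
qed

end

text \<open>
  \<open>M\<close> is the smallest function for which the pairings of all compressions of \<open>a\<close> with \<open>w\<close> are bounded by
  \<open>M a * N w\<close>. This form of the norm of \<open>Su(T\<^sup>*)\<close> turns its geometry into inequalities for \<open>N\<close>.
\<close>

locale subsymmetrized_dual = tsirelson +
  fixes M :: "(nat \<Rightarrow> real) \<Rightarrow> real"
  assumes M_pair: "\<And>a \<sigma> w. a \<in> c00 \<Longrightarrow> strict_mono \<sigma> \<Longrightarrow> w \<in> c00 \<Longrightarrow>
      pair (\<lambda>i. a (\<sigma> i)) w \<le> M a * N w"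
    and M_leI: "\<And>a B. a \<in> c00 \<Longrightarrow> (\<And>\<sigma> w. strict_mono \<sigma> \<Longrightarrow> w \<in> c00 \<Longrightarrow>
      pair (\<lambda>i. a (\<sigma> i)) w \<le> B * N w) \<Longrightarrow> M a \<le> B"
begin

lemma M_nonneg [simp]:
  assumes "a \<in> c00" shows "0 \<le> M a"
proof -
  have 1: "s * a 0 \<le> M a" if "\<bar>s\<bar> = 1" for s
  proof -
    let ?w = "\<lambda>i. if i = 0 then s else (0::real)"
    have "?w \<in> c00" by (rule c00_I_bound[of 1]) auto
    from M_pair[OF assms strict_mono_id this] have "pair a ?w \<le> M a * N ?w" by simp
    moreover have "N ?w = 1" using that by (subst N_unit_restrict[of _ 0]) (auto split: if_splits)
    moreover have "pair a ?w = a 0 * s" by (subst pair_eq[of "{0}"]) (auto split: if_splits)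
    ultimately show ?thesis by (simp add: mult.commute)
  qed
  show ?thesis using 1[of 1] 1[of "-1"] by simp
qed

lemma sum_abs_le_M:
  assumes a: "a \<in> c00" and \<sigma>: "strict_mono \<sigma>" and w: "w \<in> c00" and W: "finite W"
  shows "(\<Sum>i\<in>W. \<bar>a (\<sigma> i)\<bar> * \<bar>w i\<bar>) \<le> M a * N w"
proof -
  define v where "v i = (if i \<in> W then sgn (a (\<sigma> i)) * \<bar>w i\<bar> else 0)" for i
  have v: "v \<in> c00" by (rule c00_subset[OF w]) (auto simp: v_def)
  have "(\<Sum>i\<in>W. \<bar>a (\<sigma> i)\<bar> * \<bar>w i\<bar>) = (\<Sum>i\<in>W. a (\<sigma> i) * v i)"
    by (intro sum.cong) (auto simp: v_def abs_sgn mult.assoc)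
  also have "\<dots> = pair (\<lambda>i. a (\<sigma> i)) v"
    by (rule pair_eq[symmetric, OF W]) (auto simp: v_def split: if_splits)
  also have "\<dots> \<le> M a * N v" by (rule M_pair[OF a \<sigma> v])
  also have "\<dots> \<le> M a * N w"
    using v w a by (intro mult_left_mono N_mono) (auto simp: v_def abs_mult sgn_if)
  finally show ?thesis .
qed

lemma sum_le_M_restrict:
  assumes a: "a \<in> c00" and \<sigma>: "strict_mono \<sigma>" and w: "w \<in> c00" and W: "finite W"
    and E: "\<And>i. i \<in> W \<Longrightarrow> a (\<sigma> i) \<noteq> 0 \<Longrightarrow> i \<in> E"
  shows "\<bar>\<Sum>i\<in>W. a (\<sigma> i) * w i\<bar> \<le> M a * N (restrict_seq E w)"
proof -
  have "\<bar>\<Sum>i\<in>W. a (\<sigma> i) * w i\<bar> \<le> (\<Sum>i\<in>W. \<bar>a (\<sigma> i)\<bar> * \<bar>restrict_seq E w i\<bar>)"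
    by (rule order_trans[OF sum_abs]) (use E in \<open>fastforce simp: abs_mult restrict_seq_def intro!: sum_mono\<close>)
  also have "\<dots> \<le> M a * N (restrict_seq E w)"
    by (rule sum_abs_le_M[OF a \<sigma> c00_restrict[OF w] W])
  finally show ?thesis .
qed

lemma abs_le_M:
  assumes "a \<in> c00" shows "\<bar>a n\<bar> \<le> M a"
proof -
  let ?w = "\<lambda>i. if i = 0 then 1 else (0::real)"
  have w: "?w \<in> c00" by (rule c00_I_bound[of 1]) auto
  have "(\<Sum>i\<in>{0}. \<bar>a (i + n)\<bar> * \<bar>?w i\<bar>) \<le> M a * N ?w"
    by (rule sum_abs_le_M[OF assms _ w]) (auto simp: strict_mono_def)
  moreover have "N ?w = 1" by (subst N_unit_restrict[of _ 0]) (auto split: if_splits)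
  ultimately show ?thesis by simp
qed

text \<open>
  The dual form of \<open>N_block_norms_le\<close>, strengthened by the freedom to compress: the indices \<open>k\<close> of the
  sets may be arbitrary, since enumerating those with nonempty \<open>E k\<close> moves the \<open>j\<close>-th of them to
  position \<open>j\<close>, and the \<open>j\<close>-th nonempty set has no element below \<open>j\<close>.
\<close>

lemma sum_block_norms_le_M:
  assumes a: "a \<in> c00" and w: "w \<in> c00" and A: "finite A" and E: "successive A E"
  shows "(\<Sum>k\<in>A. \<bar>a k\<bar> * N (restrict_seq (E k) w)) \<le> M a * N w"
proof -
  define B where "B = {k\<in>A. E k \<noteq> {}}"
  have "finite B" using A by (simp add: B_def)
  then obtain m where m: "\<forall>k\<in>B. k < m" using finite_nat_set_iff_bounded by blast
  define I where "I = B \<union> {m..}"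
  have inf: "infinite I" by (simp add: I_def infinite_Ici)
  define \<sigma> where "\<sigma> = enumerate I"
  have \<sigma>: "strict_mono \<sigma>" unfolding \<sigma>_def by (rule strict_mono_enumerate[OF inf])
  have range: "range \<sigma> = I" unfolding \<sigma>_def by (rule range_enumerate[OF inf])
  define F where "F j = (if \<sigma> j \<in> B then E (\<sigma> j) else {})" for j
  have F: "successive UNIV F"
    unfolding successive_def
  proof (intro ballI impI)
    fix i j k l assume "i < j" "k \<in> F i" "l \<in> F j"
    then have "\<sigma> i < \<sigma> j" "\<sigma> i \<in> A" "\<sigma> j \<in> A" "k \<in> E (\<sigma> i)" "l \<in> E (\<sigma> j)"
      using \<sigma> by (auto simp: F_def B_def strict_mono_less split: if_splits)
    then show "k < l" using successiveD[OF E] by blast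
  qed
  have ge: "j \<le> n" if "n \<in> F j" for j n
    using that
  proof (induction j arbitrary: n)
    case (Suc j)
    then have Bj: "\<sigma> (Suc j) \<in> B" by (auto simp: F_def split: if_splits)
    then have "\<sigma> j < m" using \<sigma> m strict_monoD[of \<sigma> j "Suc j"] by force
    moreover have "\<sigma> j \<in> I" using range by blast
    ultimately have "\<sigma> j \<in> B" by (simp add: I_def)
    then have "F j \<noteq> {}" by (simp add: F_def B_def)
    then obtain n' where "n' \<in> F j" by blast
    then have "j \<le> n'" "n' < n" using Suc successiveD[OF F, of j "Suc j" n' n] by auto
    then show ?case by simp
  qed simp
  define J where "J = {j. \<sigma> j \<in> B}"
  have inj: "inj_on \<sigma> J" using \<sigma> by (simp add: strict_mono_imp_inj_on inj_on_subset)
  have img: "\<sigma> ` J = B" using range by (auto simp: J_def I_def)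
  have "finite J" using \<open>finite B\<close> inj img by (metis finite_imageD)
  define g where "g j = N (restrict_seq (F j) w)" for j
  have g: "g \<in> c00" unfolding g_def by (rule block_norms_c00[OF w ge])
  have "(\<Sum>k\<in>A. \<bar>a k\<bar> * N (restrict_seq (E k) w)) = (\<Sum>k\<in>B. \<bar>a k\<bar> * N (restrict_seq (E k) w))"
    using A by (intro sum.mono_neutral_right) (auto simp: B_def)
  also have "\<dots> = (\<Sum>j\<in>J. \<bar>a (\<sigma> j)\<bar> * N (restrict_seq (E (\<sigma> j)) w))"
    unfolding img[symmetric] by (simp add: sum.reindex[OF inj])
  also have "\<dots> = (\<Sum>j\<in>J. \<bar>a (\<sigma> j)\<bar> * \<bar>g j\<bar>)"
    using w by (intro sum.cong) (auto simp: g_def F_def J_def)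
  also have "\<dots> \<le> M a * N g" by (rule sum_abs_le_M[OF a \<sigma> g \<open>finite J\<close>])
  also have "\<dots> \<le> M a * N w"
    using a N_block_norms_le[OF w F ge] unfolding g_def by (intro mult_left_mono) auto
  finally show ?thesis .
qed

text \<open>
  An increasing map on a finite set of positions need not extend to all of \<open>\<nat>\<close>, for its values may
  leave too little room. It is nevertheless allowed in the pairing, as the singletons are successive
  sets.
\<close>

lemma sum_strict_mono_on_le_M:
  assumes a: "a \<in> c00" and w: "w \<in> c00" and S: "finite S" and \<pi>: "strict_mono_on S \<pi>"
  shows "(\<Sum>i\<in>S. \<bar>a (\<pi> i)\<bar> * \<bar>w i\<bar>) \<le> M a * N w"
proof -
  define E where "E k = {i\<in>S. \<pi> i = k}" for k
  have inj: "inj_on \<pi> S" by (rule strict_mono_on_imp_inj_on[OF \<pi>])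
  have E: "E (\<pi> i) = {i}" if "i \<in> S" for i
    using inj that by (auto simp: E_def inj_on_def)
  have "successive (\<pi> ` S) E"
    unfolding successive_def
  proof (intro ballI impI)
    fix k l m n assume "k < l" "m \<in> E k" "n \<in> E l"
    then have mn: "m \<in> S" "n \<in> S" "\<pi> m < \<pi> n" by (auto simp: E_def)
    show "m < n"
    proof (rule ccontr)
      assume "\<not> m < n"
      then have "n < m" using mn by (cases "m = n") auto
      then show False using strict_mono_onD[OF \<pi> mn(2,1)] mn by simp
    qed
  qed
  from sum_block_norms_le_M[OF a w finite_imageI[OF S] this]
  have "(\<Sum>i\<in>S. \<bar>a (\<pi> i)\<bar> * N (restrict_seq (E (\<pi> i)) w)) \<le> M a * N w"
    by (simp add: sum.reindex[OF inj])
  moreover have "N (restrict_seq (E (\<pi> i)) w) = \<bar>w i\<bar>" if "i \<in> S" for i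
    by (subst N_unit_restrict[of _ i]) (auto simp: E that restrict_seq_def split: if_splits)
  ultimately show ?thesis by simp
qed

lemma pair_combination:
  "pair (\<lambda>i. combination a u A (\<sigma> i)) w = (\<Sum>k\<in>A. a k * (\<Sum>i | w i \<noteq> 0. u k (\<sigma> i) * w i))"
proof -
  have "pair (\<lambda>i. combination a u A (\<sigma> i)) w = (\<Sum>i | w i \<noteq> 0. \<Sum>k\<in>A. a k * (u k (\<sigma> i) * w i))"
    by (simp add: pair_def combination_def sum_distrib_right mult.assoc)
  also have "\<dots> = (\<Sum>k\<in>A. a k * (\<Sum>i | w i \<noteq> 0. u k (\<sigma> i) * w i))"
    by (subst sum.swap) (simp add: sum_distrib_left)
  finally show ?thesis .
qed

lemma successive_preimage:
  assumes "strict_mono \<sigma>" "successive A F" "\<And>k. k \<in> A \<Longrightarrow> E k \<subseteq> \<sigma> -` F k"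
  shows "successive A E"
  unfolding successive_def
proof (intro ballI impI)
  fix i j m n assume "i \<in> A" "j \<in> A" "i < j" "m \<in> E i" "n \<in> E j"
  then have "\<sigma> m < \<sigma> n" using successiveD[OF assms(2), of i j "\<sigma> m" "\<sigma> n"] assms(3) by blast
  then show "m < n" using assms(1) by (simp add: strict_mono_less)
qed

text \<open>
  The unit vector basis dominates every bounded block sequence: pairing with \<open>w\<close> splits \<open>w\<close> into
  successive pieces, and each block sees only its own piece.
\<close>

lemma M_combination_le:
  assumes u: "blocks u L" and C: "\<And>k. k \<in> A \<Longrightarrow> M (u k) \<le> C" "0 \<le> C" and A: "finite A"
  shows "M (combination a u A) \<le> C * M (restrict_seq A a)"
proof (rule M_leI[OF combination_c00[OF u]])
  fix \<sigma> :: "nat \<Rightarrow> nat" and w assume \<sigma>: "strict_mono \<sigma>" and w: "w \<in> c00"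
  have fin: "finite {i. w i \<noteq> 0}" using w by (simp add: c00_def)
  define E where "E k = \<sigma> -` {n. L k \<le> n \<and> n < L (Suc k)}" for k
  have E: "successive A E"
    by (rule successive_preimage[OF \<sigma> blocks_successive[OF u]]) (simp add: E_def)
  have "pair (\<lambda>i. combination a u A (\<sigma> i)) w \<le> (\<Sum>k\<in>A. \<bar>a k\<bar> * (C * N (restrict_seq (E k) w)))"
    unfolding pair_combination
  proof (rule sum_mono)
    fix k assume k: "k \<in> A"
    have "\<bar>\<Sum>i | w i \<noteq> 0. u k (\<sigma> i) * w i\<bar> \<le> M (u k) * N (restrict_seq (E k) w)"
      by (rule sum_le_M_restrict[OF blocks_c00[OF u] \<sigma> w fin]) (use blocksD[OF u] in \<open>simp add: E_def\<close>)
    also have "\<dots> \<le> C * N (restrict_seq (E k) w)"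
      using C(1)[OF k] w by (intro mult_right_mono) auto
    finally have "\<bar>a k\<bar> * \<bar>\<Sum>i | w i \<noteq> 0. u k (\<sigma> i) * w i\<bar> \<le> \<bar>a k\<bar> * (C * N (restrict_seq (E k) w))"
      by (rule mult_left_mono) simp
    then show "a k * (\<Sum>i | w i \<noteq> 0. u k (\<sigma> i) * w i) \<le> \<bar>a k\<bar> * (C * N (restrict_seq (E k) w))"
      by (rule order_trans[OF mult_le_abs_mult])
  qed
  also have "\<dots> = C * (\<Sum>k\<in>A. \<bar>restrict_seq A a k\<bar> * N (restrict_seq (E k) w))"
    unfolding sum_distrib_left by (intro sum.cong) (auto simp: restrict_seq_def)
  also have "\<dots> \<le> C * (M (restrict_seq A a) * N w)"
    by (intro mult_left_mono sum_block_norms_le_M c00_restrict_finite A w E C(2))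
  finally show "pair (\<lambda>i. combination a u A (\<sigma> i)) w \<le> C * M (restrict_seq A a) * N w"
    by (simp add: mult.assoc)
qed

text \<open>
  Blocks with a peak of size \<open>\<delta>\<close> dominate the unit vector basis: compress to the positions \<open>p k\<close> of the
  peaks.
\<close>

lemma M_combination_ge:
  assumes u: "blocks u L" and A: "finite A" and \<delta>: "0 < \<delta>"
    and p: "\<And>k. L k \<le> p k \<and> p k < L (Suc k)" "\<And>k. \<delta> \<le> \<bar>u k (p k)\<bar>"
  shows "\<delta> * M (restrict_seq A a) \<le> M (combination a u A)"
proof -
  have "strict_mono p"
  proof (rule strict_monoI_Suc)
    show "p k < p (Suc k)" for k using p(1)[of k] p(1)[of "Suc k"] by linarith
  qed
  have at: "\<delta> * \<bar>restrict_seq A a k\<bar> \<le> \<bar>combination a u A (p k)\<bar>" for k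
    using combination_at[OF u A, of k "p k" a] p[of k] mult_left_mono[OF p(2)[of k], of "\<bar>a k\<bar>"]
    by (auto simp: restrict_seq_def abs_mult mult.commute)
  have "M (restrict_seq A a) \<le> M (combination a u A) / \<delta>"
  proof (rule M_leI)
    fix \<sigma> :: "nat \<Rightarrow> nat" and w assume \<sigma>: "strict_mono \<sigma>" and w: "w \<in> c00"
    have fin: "finite {i. w i \<noteq> 0}" using w by (simp add: c00_def)
    have "\<delta> * pair (\<lambda>i. restrict_seq A a (\<sigma> i)) w \<le>
        (\<Sum>i | w i \<noteq> 0. \<bar>combination a u A (p (\<sigma> i))\<bar> * \<bar>w i\<bar>)"
      unfolding pair_def sum_distrib_left
    proof (rule sum_mono)
      fix i
      have "\<delta> * (restrict_seq A a (\<sigma> i) * w i) \<le> \<delta> * \<bar>restrict_seq A a (\<sigma> i) * w i\<bar>"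
        using \<delta> by (intro mult_left_mono) auto
      also have "\<dots> \<le> \<bar>combination a u A (p (\<sigma> i))\<bar> * \<bar>w i\<bar>"
        using mult_right_mono[OF at[of "\<sigma> i"], of "\<bar>w i\<bar>"] by (simp add: abs_mult mult.assoc)
      finally show "\<delta> * (restrict_seq A a (\<sigma> i) * w i) \<le> \<bar>combination a u A (p (\<sigma> i))\<bar> * \<bar>w i\<bar>" .
    qed
    also have "\<dots> \<le> M (combination a u A) * N w"
      using strict_mono_compose[OF \<open>strict_mono p\<close> \<sigma>]
      by (intro sum_abs_le_M combination_c00[OF u] w fin)
    finally show "pair (\<lambda>i. restrict_seq A a (\<sigma> i)) w \<le> M (combination a u A) / \<delta> * N w"
      using \<delta> by (simp add: field_simps)
  qed (intro c00_restrict_finite A)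
  then show ?thesis using \<delta> by (simp add: field_simps)
qed

text \<open>
  Split a functional \<open>w\<close> at position \<open>K\<close>. The first \<open>K\<close> coordinates meet each of the at most \<open>K\<close> blocks
  in coordinates of size \<open>h / K\<^sup>2\<close>, so they contribute at most \<open>h * N w\<close>; the remainder is cut into at most
  \<open>K\<close> pieces beyond \<open>K\<close>, whose norms add up to at most \<open>2 * N w\<close>.
\<close>

lemma M_flat_combination_le:
  fixes K :: nat
  assumes u: "blocks u L" and A: "finite A" "card A \<le> K"
    and C: "\<And>k. k \<in> A \<Longrightarrow> M (u k) \<le> C" "0 \<le> C"
    and h: "\<And>k n. k \<in> A \<Longrightarrow> \<bar>u k n\<bar> * (real K)\<^sup>2 \<le> h" "0 \<le> h"
    and a: "\<And>k. k \<in> A \<Longrightarrow> \<bar>a k\<bar> \<le> 1"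
  shows "M (combination a u A) \<le> h + 2 * C"
proof (rule M_leI[OF combination_c00[OF u]])
  fix \<sigma> :: "nat \<Rightarrow> nat" and w assume \<sigma>: "strict_mono \<sigma>" and w: "w \<in> c00"
  have fin: "finite {i. w i \<noteq> 0}" using w by (simp add: c00_def)
  define E where "E k = {K..} \<inter> \<sigma> -` {n. L k \<le> n \<and> n < L (Suc k)}" for k
  have E: "successive A E"
    by (rule successive_preimage[OF \<sigma> blocks_successive[OF u]]) (simp add: E_def)
  let ?W0 = "{i. w i \<noteq> 0} \<inter> {..<K}" and ?W1 = "{i. w i \<noteq> 0} - {..<K}"
  have "pair (\<lambda>i. combination a u A (\<sigma> i)) w \<le> (\<Sum>k\<in>A. \<bar>\<Sum>i | w i \<noteq> 0. u k (\<sigma> i) * w i\<bar>)"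
    unfolding pair_combination
  proof (rule sum_mono)
    fix k assume "k \<in> A"
    have "a k * (\<Sum>i | w i \<noteq> 0. u k (\<sigma> i) * w i) \<le> \<bar>a k\<bar> * \<bar>\<Sum>i | w i \<noteq> 0. u k (\<sigma> i) * w i\<bar>"
      by (rule mult_le_abs_mult)
    also have "\<dots> \<le> 1 * \<bar>\<Sum>i | w i \<noteq> 0. u k (\<sigma> i) * w i\<bar>"
      by (intro mult_right_mono a \<open>k \<in> A\<close>) simp
    finally show "a k * (\<Sum>i | w i \<noteq> 0. u k (\<sigma> i) * w i) \<le> \<bar>\<Sum>i | w i \<noteq> 0. u k (\<sigma> i) * w i\<bar>" by simp
  qed
  also have "\<dots> \<le> (\<Sum>k\<in>A. \<bar>\<Sum>i\<in>?W0. u k (\<sigma> i) * w i\<bar> + \<bar>\<Sum>i\<in>?W1. u k (\<sigma> i) * w i\<bar>)"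
  proof (rule sum_mono)
    fix k
    have "(\<Sum>i | w i \<noteq> 0. u k (\<sigma> i) * w i) = (\<Sum>i\<in>?W0. u k (\<sigma> i) * w i) + (\<Sum>i\<in>?W1. u k (\<sigma> i) * w i)"
      by (rule sum.Int_Diff[OF fin])
    then show "\<bar>\<Sum>i | w i \<noteq> 0. u k (\<sigma> i) * w i\<bar> \<le>
        \<bar>\<Sum>i\<in>?W0. u k (\<sigma> i) * w i\<bar> + \<bar>\<Sum>i\<in>?W1. u k (\<sigma> i) * w i\<bar>" by simp
  qed
  also have "\<dots> = (\<Sum>k\<in>A. \<bar>\<Sum>i\<in>?W0. u k (\<sigma> i) * w i\<bar>) + (\<Sum>k\<in>A. \<bar>\<Sum>i\<in>?W1. u k (\<sigma> i) * w i\<bar>)"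
    by (rule sum.distrib)
  also have "(\<Sum>k\<in>A. \<bar>\<Sum>i\<in>?W0. u k (\<sigma> i) * w i\<bar>) \<le> h * N w"
  proof (cases "K = 0")
    case True
    then show ?thesis using h(2) w by simp
  next
    case False
    have "\<bar>\<Sum>i\<in>?W0. u k (\<sigma> i) * w i\<bar> \<le> K * (h / (real K)\<^sup>2 * N w)" if k: "k \<in> A" for k
    proof -
      have "\<bar>u k (\<sigma> i) * w i\<bar> \<le> h / (real K)\<^sup>2 * N w" for i
      proof -
        have "\<bar>u k (\<sigma> i)\<bar> \<le> h / (real K)\<^sup>2" using h(1)[OF k, of "\<sigma> i"] False by (simp add: field_simps)
        then show ?thesis unfolding abs_mult using abs_le_N[OF w, of i] h(2)
          by (intro mult_mono) auto
      qed
      then have "\<bar>\<Sum>i\<in>?W0. u k (\<sigma> i) * w i\<bar> \<le> (\<Sum>i\<in>?W0. h / (real K)\<^sup>2 * N w)"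
        by (intro order_trans[OF sum_abs] sum_mono)
      also have "\<dots> \<le> (\<Sum>i<K. h / (real K)\<^sup>2 * N w)"
        using h(2) w by (intro sum_mono2) auto
      finally show ?thesis by simp
    qed
    then have "(\<Sum>k\<in>A. \<bar>\<Sum>i\<in>?W0. u k (\<sigma> i) * w i\<bar>) \<le> (\<Sum>k\<in>A. K * (h / (real K)\<^sup>2 * N w))"
      by (intro sum_mono)
    also have "\<dots> = card A * (K * (h / (real K)\<^sup>2 * N w))" by simp
    also have "\<dots> \<le> K * (K * (h / (real K)\<^sup>2 * N w))"
      using A(2) h(2) w by (intro mult_right_mono) auto
    also have "\<dots> = h * N w" using False by (simp add: field_simps power2_eq_square)
    finally show ?thesis .
  qed
  also have "(\<Sum>k\<in>A. \<bar>\<Sum>i\<in>?W1. u k (\<sigma> i) * w i\<bar>) \<le> 2 * C * N w"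
  proof -
    have "(\<Sum>k\<in>A. \<bar>\<Sum>i\<in>?W1. u k (\<sigma> i) * w i\<bar>) \<le> (\<Sum>k\<in>A. C * N (restrict_seq (E k) w))"
    proof (rule sum_mono)
      fix k assume k: "k \<in> A"
      have "\<bar>\<Sum>i\<in>?W1. u k (\<sigma> i) * w i\<bar> \<le> M (u k) * N (restrict_seq (E k) w)"
        by (rule sum_le_M_restrict[OF blocks_c00[OF u] \<sigma> w])
          (use blocksD[OF u] fin in \<open>simp_all add: E_def\<close>)
      also have "\<dots> \<le> C * N (restrict_seq (E k) w)"
        using C(1)[OF k] w by (intro mult_right_mono) auto
      finally show "\<bar>\<Sum>i\<in>?W1. u k (\<sigma> i) * w i\<bar> \<le> C * N (restrict_seq (E k) w)" .
    qed
    also have "\<dots> = C * (\<Sum>k\<in>A. N (restrict_seq (E k) w))" by (simp add: sum_distrib_left)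
    also have "\<dots> \<le> C * (2 * N w)"
      using A by (intro mult_left_mono C(2) N_ge_successive_on[OF w _ E]) (auto simp: E_def)
    finally show ?thesis by simp
  qed
  finally show "pair (\<lambda>i. combination a u A (\<sigma> i)) w \<le> (h + 2 * C) * N w"
    by (simp add: algebra_simps)
qed


section \<open>Flat blocks and norming vectors\<close>

text \<open>
  A norming vector of a block living on \<open>[l, l')\<close> may start before \<open>l\<close>, since \<open>\<sigma>\<close> moves to the right.
  Flatness allows it to be cut at \<open>l\<close> with a small loss. No coordinate from \<open>l'\<close> on matters, as
  \<open>\<sigma> i \<ge> i\<close>. So norming vectors for different blocks become successive.
\<close>

lemma flat_block_norming:
  assumes u: "u \<in> c00" "\<And>n. u n \<noteq> 0 \<Longrightarrow> l \<le> n \<and> n < l'" and \<delta>: "0 < \<delta>" "\<delta> \<le> M u"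
    and flat: "\<And>n. \<bar>u n\<bar> * l \<le> \<delta> / 4"
  shows "\<exists>\<sigma> w. strict_mono \<sigma> \<and> N w \<le> 1 \<and> (\<forall>n. w n \<noteq> 0 \<longrightarrow> l \<le> n \<and> n < l') \<and>
    \<delta> / 4 \<le> (\<Sum>i\<in>{l..<l'}. \<bar>u (\<sigma> i)\<bar> * \<bar>w i\<bar>)"
proof -
  have "\<exists>\<sigma> v. strict_mono \<sigma> \<and> v \<in> c00 \<and> \<delta> / 2 * N v < pair (\<lambda>i. u (\<sigma> i)) v"
  proof (rule ccontr)
    assume neg: "\<nexists>\<sigma> v. strict_mono \<sigma> \<and> v \<in> c00 \<and> \<delta> / 2 * N v < pair (\<lambda>i. u (\<sigma> i)) v"
    have "M u \<le> \<delta> / 2"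
      by (rule M_leI[OF u(1)]) (use neg in \<open>meson not_le\<close>)
    then show False using \<delta> by simp
  qed
  then obtain \<sigma> v where \<sigma>: "strict_mono \<sigma>" and v: "v \<in> c00"
    and big: "\<delta> / 2 * N v < pair (\<lambda>i. u (\<sigma> i)) v" by blast
  have "N v \<noteq> 0"
  proof
    assume "N v = 0"
    then have "v i = 0" for i using abs_le_N[OF v, of i] by simp
    then show False using big by (simp add: pair_def \<open>N v = 0\<close>)
  qed
  then have Nv: "0 < N v" using N_nonneg[OF v] by linarith
  have fin: "finite {i. v i \<noteq> 0}" using v by (simp add: c00_def)
  let ?V = "{i. v i \<noteq> 0}"
  let ?t = "\<lambda>i. \<bar>u (\<sigma> i)\<bar> * \<bar>v i\<bar>"
  have "pair (\<lambda>i. u (\<sigma> i)) v \<le> (\<Sum>i\<in>?V. ?t i)"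
    unfolding pair_def by (intro sum_mono mult_le_abs_mult)
  also have "\<dots> \<le> (\<Sum>i\<in>{..<l} \<union> {l..<l'}. ?t i)"
  proof -
    have "i < l'" if "u (\<sigma> i) \<noteq> 0" for i
      using u(2)[OF that] strict_mono_imp_increasing[OF \<sigma>, of i] by linarith
    then have "(\<Sum>i\<in>?V. ?t i) = (\<Sum>i\<in>?V \<inter> ({..<l} \<union> {l..<l'}). ?t i)"
      using fin by (intro sum.mono_neutral_right) (auto simp: not_less)
    also have "\<dots> \<le> (\<Sum>i\<in>{..<l} \<union> {l..<l'}. ?t i)" by (intro sum_mono2) auto
    finally show ?thesis .
  qed
  also have "\<dots> = (\<Sum>i<l. ?t i) + (\<Sum>i\<in>{l..<l'}. ?t i)"
    by (intro sum.union_disjoint) auto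
  also have "(\<Sum>i<l. ?t i) \<le> \<delta> / 4 * N v"
  proof (cases "l = 0")
    case True
    then show ?thesis using \<delta> Nv by simp
  next
    case False
    have "(\<Sum>i<l. ?t i) \<le> (\<Sum>i<l. \<delta> / 4 / l * N v)"
      using flat False \<delta> by (intro sum_mono mult_mono abs_le_N v) (auto simp: field_simps)
    then show ?thesis using False by simp
  qed
  finally have main: "\<delta> / 4 * N v \<le> (\<Sum>i\<in>{l..<l'}. ?t i)" using big by (simp add: field_simps)
  define w where "w = restrict_seq {l..<l'} (\<lambda>i. 1 / N v * v i)"
  have "N w \<le> 1"
    using N_restrict_le[OF c00_scale[OF v, of "1 / N v"], of "{l..<l'}"] N_scale[OF v, of "1 / N v"] Nv
    by (simp add: w_def)
  moreover have "\<delta> / 4 \<le> (\<Sum>i\<in>{l..<l'}. \<bar>u (\<sigma> i)\<bar> * \<bar>w i\<bar>)"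
  proof -
    have "(\<Sum>i\<in>{l..<l'}. ?t i) / N v = (\<Sum>i\<in>{l..<l'}. \<bar>u (\<sigma> i)\<bar> * \<bar>w i\<bar>)"
      unfolding sum_divide_distrib using Nv by (intro sum.cong) (auto simp: w_def restrict_seq_def)
    then show ?thesis using main Nv by (metis pos_le_divide_eq)
  qed
  moreover have "\<forall>n. w n \<noteq> 0 \<longrightarrow> l \<le> n \<and> n < l'" by (auto simp: w_def restrict_seq_def)
  ultimately show ?thesis using \<sigma> by blast
qed

text \<open>
  Each block is normed through its own compression \<open>\<sigma> k\<close>. On the relevant positions the maps \<open>\<sigma> k\<close>
  fit together to one increasing map, because \<open>\<sigma> k\<close> takes values in the \<open>k\<close>-th interval there. Hence a
  single functional norms all blocks simultaneously.
\<close>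

lemma flat_blocks_norming:
  assumes u: "blocks u L" and \<delta>: "0 < \<delta>" "\<And>k. \<delta> \<le> M (u k)"
    and flat: "\<And>k n. \<bar>u k n\<bar> * L k \<le> \<delta> / 4"
  shows "\<exists>w. blocks w L \<and> (\<forall>k. N (w k) \<le> 1) \<and>
    (\<forall>A c. finite A \<longrightarrow> (\<forall>k\<in>A. 0 \<le> c k) \<longrightarrow>
      \<delta> / 4 * (\<Sum>k\<in>A. c k) \<le> M (combination (\<lambda>_. 1) u A) * N (combination c w A))"
proof -
  have L: "strict_mono L" using u by (simp add: blocks_def)
  have "\<forall>k. \<exists>p. strict_mono (fst p) \<and> N (snd p) \<le> 1 \<and>
    (\<forall>n. snd p n \<noteq> 0 \<longrightarrow> L k \<le> n \<and> n < L (Suc k)) \<and>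
    \<delta> / 4 \<le> (\<Sum>i\<in>{L k..<L (Suc k)}. \<bar>u k (fst p i)\<bar> * \<bar>snd p i\<bar>)"
    using flat_block_norming[OF blocks_c00[OF u] blocksD[OF u] \<delta> flat] by simp
  from choice[OF this] obtain p where p: "\<And>k. strict_mono (fst (p k))" "\<And>k. N (snd (p k)) \<le> 1"
    "\<And>k n. snd (p k) n \<noteq> 0 \<Longrightarrow> L k \<le> n \<and> n < L (Suc k)"
    "\<And>k. \<delta> / 4 \<le> (\<Sum>i\<in>{L k..<L (Suc k)}. \<bar>u k (fst (p k) i)\<bar> * \<bar>snd (p k) i\<bar>)" by blast
  define \<sigma> where "\<sigma> k = fst (p k)" for k
  define w where "w k = snd (p k)" for k
  have w: "blocks w L" using p(3) L by (simp add: blocks_def w_def)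
  have "\<delta> / 4 * (\<Sum>k\<in>A. c k) \<le> M (combination (\<lambda>_. 1) u A) * N (combination c w A)"
    if A: "finite A" and c: "\<forall>k\<in>A. 0 \<le> c k" for A c
  proof -
    define blk where "blk i = (LEAST k. i < L (Suc k))" for i
    have blk: "blk i = k" if i: "L k \<le> i" "i < L (Suc k)" for i k
      unfolding blk_def
    proof (rule Least_equality)
      show "i < L (Suc k)" by (rule i)
    next
      fix l assume "i < L (Suc l)"
      then have "L k < L (Suc l)" using i by linarith
      then show "k \<le> l" using L by (simp add: strict_mono_less)
    qed
    define S where "S k = {i. L k \<le> i \<and> i < L (Suc k) \<and> L k \<le> \<sigma> k i \<and> \<sigma> k i < L (Suc k)}" for k
    have finS: "finite (S k)" for k by (rule finite_subset[of _ "{..<L (Suc k)}"]) (auto simp: S_def)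
    have mono: "strict_mono_on (\<Union>k\<in>A. S k) (\<lambda>i. \<sigma> (blk i) i)"
    proof (rule strict_mono_onI)
      fix i j assume "i \<in> (\<Union>k\<in>A. S k)" "j \<in> (\<Union>k\<in>A. S k)" and ij: "i < j"
      then obtain k l where k: "i \<in> S k" and l: "j \<in> S l" by blast
      have [simp]: "blk i = k" "blk j = l" using k l blk by (auto simp: S_def)
      have "L k < L (Suc l)" using k l ij by (simp add: S_def)
      then have "k \<le> l" using L by (simp add: strict_mono_less)
      then consider "k = l" | "Suc k \<le> l" by linarith
      then show "\<sigma> (blk i) i < \<sigma> (blk j) j"
      proof cases
        case 1
        then show ?thesis using p(1)[of k] ij by (simp add: \<sigma>_def strict_mono_less)
      next
        case 2
        then have "L (Suc k) \<le> L l" using L by (simp add: strict_mono_less_eq)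
        then show ?thesis using k l by (simp add: S_def)
      qed
    qed
    have disj: "\<forall>k\<in>A. \<forall>l\<in>A. k \<noteq> l \<longrightarrow> S k \<inter> S l = {}"
    proof (intro ballI impI)
      fix k l :: nat assume "k \<noteq> l"
      then show "S k \<inter> S l = {}" using blk[of k] blk[of l] unfolding S_def by fastforce
    qed
    have "\<delta> / 4 * (\<Sum>k\<in>A. c k) = (\<Sum>k\<in>A. c k * (\<delta> / 4))"
      by (simp add: sum_distrib_left mult.commute)
    also have "\<dots> \<le> (\<Sum>k\<in>A. c k * (\<Sum>i\<in>{L k..<L (Suc k)}. \<bar>u k (\<sigma> k i)\<bar> * \<bar>w k i\<bar>))"
      using c p(4) by (intro sum_mono mult_left_mono) (auto simp: \<sigma>_def w_def)
    also have "\<dots> = (\<Sum>k\<in>A. c k * (\<Sum>i\<in>S k. \<bar>u k (\<sigma> k i)\<bar> * \<bar>w k i\<bar>))"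
    proof -
      have "(\<Sum>i\<in>{L k..<L (Suc k)}. \<bar>u k (\<sigma> k i)\<bar> * \<bar>w k i\<bar>) = (\<Sum>i\<in>S k. \<bar>u k (\<sigma> k i)\<bar> * \<bar>w k i\<bar>)" for k
      proof (rule sum.mono_neutral_right)
        show "\<forall>i\<in>{L k..<L (Suc k)} - S k. \<bar>u k (\<sigma> k i)\<bar> * \<bar>w k i\<bar> = 0"
          using blocksD[OF u, of k] by (fastforce simp: S_def)
      qed (auto simp: S_def)
      then show ?thesis by simp
    qed
    also have "\<dots> = (\<Sum>k\<in>A. \<Sum>i\<in>S k. \<bar>combination (\<lambda>_. 1) u A (\<sigma> (blk i) i)\<bar> * \<bar>combination c w A i\<bar>)"
      unfolding sum_distrib_left
    proof (intro sum.cong refl)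
      fix k i assume k: "k \<in> A" and i: "i \<in> S k"
      have "blk i = k" using i blk by (auto simp: S_def)
      moreover have "combination (\<lambda>_. 1) u A (\<sigma> k i) = u k (\<sigma> k i)"
        using k i by (subst combination_at[OF u A, of k]) (auto simp: S_def)
      moreover have "combination c w A i = c k * w k i"
        using k i by (subst combination_at[OF w A, of k]) (auto simp: S_def)
      ultimately show "c k * (\<bar>u k (\<sigma> k i)\<bar> * \<bar>w k i\<bar>) =
          \<bar>combination (\<lambda>_. 1) u A (\<sigma> (blk i) i)\<bar> * \<bar>combination c w A i\<bar>"
        using c k by (simp add: abs_mult)
    qed
    also have "\<dots> = (\<Sum>i\<in>(\<Union>k\<in>A. S k). \<bar>combination (\<lambda>_. 1) u A (\<sigma> (blk i) i)\<bar> * \<bar>combination c w A i\<bar>)"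
      using A finS disj by (intro sum.UNION_disjoint[symmetric]) auto
    also have "\<dots> \<le> M (combination (\<lambda>_. 1) u A) * N (combination c w A)"
      using A finS by (intro sum_strict_mono_on_le_M combination_c00[OF u] combination_c00[OF w] mono) auto
    finally show ?thesis .
  qed
  then show ?thesis using w p(2) by (intro exI[of _ w]) (auto simp: w_def)
qed

text \<open>
  If the sums of the blocks were bounded, the norming vectors \<open>w k\<close> would satisfy a lower \<open>\<ell>\<^sub>1\<close> estimate
  on averages, but their averages can be made arbitrarily small.
\<close>

lemma flat_blocks_unbounded:
  assumes u: "blocks u L" and \<delta>: "0 < \<delta>" "\<And>k. \<delta> \<le> M (u k)"
    and flat: "\<And>k n. \<bar>u k n\<bar> * L k \<le> \<delta> / 4"
  shows "\<exists>b. R \<le> M (combination (\<lambda>_. 1) u {m..<b})"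
proof -
  obtain w where w: "blocks w L" "\<And>k. N (w k) \<le> 1"
    and lower: "\<And>A c. finite A \<Longrightarrow> (\<forall>k\<in>A. 0 \<le> c k) \<Longrightarrow>
      \<delta> / 4 * (\<Sum>k\<in>A. c k) \<le> M (combination (\<lambda>_. 1) u A) * N (combination c w A)"
    using flat_blocks_norming[OF assms] by blast
  define R' where "R' = \<bar>R\<bar> + 1"
  have R': "0 < R'" "R < R'" by (auto simp: R'_def)
  have "successive UNIV (\<lambda>k. {n. w k n \<noteq> 0})"
    unfolding successive_def
  proof (intro ballI impI)
    fix i j m n assume "i < j" "m \<in> {n. w i n \<noteq> 0}" "n \<in> {n. w j n \<noteq> 0}"
    then show "m < n"
      using successiveD[OF blocks_successive[OF w(1), of UNIV], of i j m n]
        blocksD[OF w(1), of i m] blocksD[OF w(1), of j n] by simp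
  qed
  moreover have "k \<le> n" if "w k n \<noteq> 0" for k n
    using blocksD[OF w(1) that] w(1) strict_mono_imp_increasing[of L k] by (simp add: blocks_def)
  ultimately obtain b z where z: "tail_average w m b z" "N z < \<delta> / 4 / R'"
    using tail_averages_tend_to_0[of w "\<delta> / 4 / R'" m] blocks_c00[OF w(1)] w(2) \<delta>(1) R' by force
  obtain c where c: "\<forall>k. 0 \<le> c k" "\<forall>k<m. c k = 0" "(\<Sum>k<b. c k) = 1"
      "z = (\<lambda>n. \<Sum>k<b. c k * w k n)"
    using z(1) by (auto simp: tail_average_def)
  have cut: "(\<Sum>k<b. c k * f k) = (\<Sum>k\<in>{m..<b}. c k * f k)" for f
    using c(2) by (intro sum.mono_neutral_right) (auto simp: not_le)
  have z_eq: "z = combination c w {m..<b}" using c(4) cut by (simp add: combination_def[abs_def])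
  moreover have "(\<Sum>k\<in>{m..<b}. c k) = 1" using c(3) cut[of "\<lambda>_. 1"] by simp
  ultimately have 1: "\<delta> / 4 \<le> M (combination (\<lambda>_. 1) u {m..<b}) * N z"
    using lower[of "{m..<b}" c] c(1) by simp
  have "R \<le> M (combination (\<lambda>_. 1) u {m..<b})"
  proof (rule ccontr)
    assume "\<not> R \<le> M (combination (\<lambda>_. 1) u {m..<b})"
    then have "M (combination (\<lambda>_. 1) u {m..<b}) * N z \<le> R' * N z"
      using R' z_eq combination_c00[OF w(1)] by (intro mult_right_mono) auto
    also have "\<dots> < R' * (\<delta> / 4 / R')" using z(2) R' by (intro mult_strict_left_mono)
    finally show False using 1 R' by simp
  qed
  then show ?thesis by blast
qed

end

section \<open>The basis constant\<close>

lemma basic_sequence_expansion_unique: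
  assumes "basic_sequence x" "v \<in> closure (span (range x))"
    "(\<lambda>j. a j *\<^sub>R x j) sums v" "(\<lambda>j. b j *\<^sub>R x j) sums v"
  shows "a = b"
  using assms unfolding basic_sequence_def by blast

lemma basic_sequence_expansion_exists:
  assumes "basic_sequence x" "v \<in> closure (span (range x))"
  shows "\<exists>a. (\<lambda>j. a j *\<^sub>R x j) sums v"
  using assms unfolding basic_sequence_def by blast

lemma basic_sequence_nonzero:
  assumes "basic_sequence x" shows "x j \<noteq> 0"
proof
  assume 0: "x j = 0"
  have "0 \<in> closure (span (range x))" using closure_subset span_zero by blast
  moreover have "(\<lambda>i. (0::real) *\<^sub>R x i) sums 0" by simp
  moreover have "(\<lambda>i. (if i = j then 1 else 0::real) *\<^sub>R x i) sums 0"
    using 0 by (simp add: if_distrib[of "\<lambda>r. r *\<^sub>R _"] cong: if_cong)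
  ultimately have "(\<lambda>i. (0::real)) = (\<lambda>i. if i = j then 1 else 0)"
    by (rule basic_sequence_expansion_unique[OF assms])
  then show False by (metis zero_neq_one)
qed

lemma sum_in_closed_span: "(\<Sum>j\<in>A. a j *\<^sub>R x j) \<in> closure (span (range x))"
  by (rule subsetD[OF closure_subset]) (intro span_sum span_scale span_base rangeI)

lemma sums_in_closed_span:
  assumes "(\<lambda>j. a j *\<^sub>R x j) sums v" shows "v \<in> closure (span (range x))"
  using assms unfolding sums_def
  by (rule closed_sequentially[OF closed_closure sum_in_closed_span])

lemma closure_span_add:
  fixes v :: "'a::real_normed_vector"
  assumes "v \<in> closure (span S)" "w \<in> closure (span S)"
  shows "v + w \<in> closure (span S)"
proof -
  obtain f g where f: "\<And>n. f n \<in> span S" "f \<longlonglongrightarrow> v" and g: "\<And>n. g n \<in> span S" "g \<longlonglongrightarrow> w"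
    using assms unfolding closure_sequential by blast
  have "(\<lambda>n. f n + g n) \<longlonglongrightarrow> v + w" by (intro tendsto_add f g)
  then show ?thesis
    unfolding closure_sequential by (intro exI[of _ "\<lambda>n. f n + g n"]) (simp add: span_add f g)
qed

lemma closure_span_scale:
  fixes v :: "'a::real_normed_vector"
  assumes "v \<in> closure (span S)"
  shows "t *\<^sub>R v \<in> closure (span S)"
proof -
  obtain f where f: "\<And>n. f n \<in> span S" "f \<longlonglongrightarrow> v"
    using assms unfolding closure_sequential by blast
  have "(\<lambda>n. t *\<^sub>R f n) \<longlonglongrightarrow> t *\<^sub>R v" by (intro tendsto_intros f)
  then show ?thesis
    unfolding closure_sequential by (intro exI[of _ "\<lambda>n. t *\<^sub>R f n"]) (simp add: span_scale f)
qed

text \<open>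
  The image of the ball of radius \<open>r\<close> in the space of coefficient sequences with convergent series,
  normed by the largest partial sum. The next lemmas carry out the proof of the open mapping theorem
  for the summation map of that space.
\<close>

definition bounded_expansions :: "(nat \<Rightarrow> 'a::banach) \<Rightarrow> real \<Rightarrow> 'a set" where
  "bounded_expansions x r =
     {v. \<exists>a. (\<lambda>j. a j *\<^sub>R x j) sums v \<and> (\<forall>n. norm (\<Sum>j<n. a j *\<^sub>R x j) \<le> r)}"

lemma bounded_expansions_diff:
  assumes "v \<in> bounded_expansions x r" "w \<in> bounded_expansions x s"
  shows "v - w \<in> bounded_expansions x (r + s)"
proof -
  obtain a b where a: "(\<lambda>j. a j *\<^sub>R x j) sums v" "\<And>n. norm (\<Sum>j<n. a j *\<^sub>R x j) \<le> r"
    and b: "(\<lambda>j. b j *\<^sub>R x j) sums w" "\<And>n. norm (\<Sum>j<n. b j *\<^sub>R x j) \<le> s"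
    using assms by (auto simp: bounded_expansions_def)
  have "(\<lambda>j. (a j - b j) *\<^sub>R x j) sums (v - w)"
    using sums_diff[OF a(1) b(1)] by (simp add: scaleR_diff_left)
  moreover have "norm (\<Sum>j<n. (a j - b j) *\<^sub>R x j) \<le> r + s" for n
    using norm_triangle_ineq4[of "\<Sum>j<n. a j *\<^sub>R x j" "\<Sum>j<n. b j *\<^sub>R x j"] a(2)[of n] b(2)[of n]
    by (simp add: scaleR_diff_left sum_subtractf)
  ultimately show ?thesis
    unfolding bounded_expansions_def mem_Collect_eq by (intro exI[of _ "\<lambda>j. a j - b j"] conjI allI)
qed

lemma bounded_expansions_scale:
  assumes "v \<in> bounded_expansions x r" "0 \<le> t"
  shows "t *\<^sub>R v \<in> bounded_expansions x (t * r)"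
proof -
  obtain a where a: "(\<lambda>j. a j *\<^sub>R x j) sums v" "\<And>n. norm (\<Sum>j<n. a j *\<^sub>R x j) \<le> r"
    using assms by (auto simp: bounded_expansions_def)
  have "(\<lambda>j. (t * a j) *\<^sub>R x j) sums (t *\<^sub>R v)"
    using sums_scaleR_right[OF a(1), of t] by simp
  moreover have "norm (\<Sum>j<n. (t * a j) *\<^sub>R x j) \<le> t * r" for n
  proof -
    have "(\<Sum>j<n. (t * a j) *\<^sub>R x j) = t *\<^sub>R (\<Sum>j<n. a j *\<^sub>R x j)"
      by (simp add: scaleR_sum_right)
    then show ?thesis using mult_left_mono[OF a(2)[of n] assms(2)] assms(2) by simp
  qed
  ultimately show ?thesis
    unfolding bounded_expansions_def mem_Collect_eq by (intro exI[of _ "\<lambda>j. t * a j"] conjI allI)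
qed

text \<open>
  The closures of the sets of vectors with partial sums bounded by \<open>k\<close> cover the closed span, so by
  Baire one of them contains a ball, and differences move the ball to the origin.
\<close>

lemma bounded_expansions_dense_in_ball:
  assumes x: "basic_sequence x"
  shows "\<exists>r>0. \<exists>C\<ge>0. \<forall>v\<in>closure (span (range x)). norm v < r \<longrightarrow> v \<in> closure (bounded_expansions x C)"
proof -
  let ?Y = "closure (span (range x))"
  let ?A = "\<lambda>k::nat. bounded_expansions x (real k)"
  have AY: "?A k \<subseteq> ?Y" for k
    using sums_in_closed_span unfolding bounded_expansions_def by blast
  have clAY: "closure (?A k) \<subseteq> ?Y" for k
    using AY by (simp add: closure_minimal)
  have cover: "?Y \<subseteq> (\<Union>k. closure (?A k))"
  proof
    fix v assume "v \<in> ?Y"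
    then obtain a where a: "(\<lambda>j. a j *\<^sub>R x j) sums v"
      using basic_sequence_expansion_exists[OF x] by blast
    then have "convergent (\<lambda>n. \<Sum>j<n. a j *\<^sub>R x j)" by (auto simp: sums_def convergent_def)
    then have "Bseq (\<lambda>n. \<Sum>j<n. a j *\<^sub>R x j)" by (rule convergent_imp_Bseq)
    then obtain c where c: "\<And>n. norm (\<Sum>j<n. a j *\<^sub>R x j) \<le> c" by (auto simp: Bseq_def)
    obtain k where "c \<le> real k" using real_arch_simple by blast
    then have "v \<in> ?A k" using a c order_trans unfolding bounded_expansions_def by blast
    then show "v \<in> (\<Union>k. closure (?A k))" using closure_subset by blast
  qed
  have "\<exists>k. top_of_set ?Y interior_of closure (?A k) \<noteq> {}"
  proof (rule ccontr)
    assume "\<nexists>k. top_of_set ?Y interior_of closure (?A k) \<noteq> {}"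
    then have "top_of_set ?Y interior_of \<Union>(range (\<lambda>k. closure (?A k))) = {}"
    proof (intro Baire_category_alt disjI1)
      show "completely_metrizable_space (top_of_set ?Y)"
        by (rule completely_metrizable_space_closedin[OF completely_metrizable_space_euclidean]) simp
    qed (use clAY in \<open>auto simp: closedin_closed_eq\<close>)
    moreover have "\<Union>(range (\<lambda>k. closure (?A k))) = ?Y" using cover clAY by blast
    moreover have "top_of_set ?Y interior_of ?Y = ?Y"
      using interior_of_topspace[of "top_of_set ?Y"] by simp
    ultimately have "?Y = {}" by simp
    then show False using span_zero closure_subset by fastforce
  qed
  then obtain k U v where U: "openin (top_of_set ?Y) U" "v \<in> U" "U \<subseteq> closure (?A k)"
    by (auto simp: interior_of_def)
  then obtain r where r: "r > 0" "ball v r \<inter> ?Y \<subseteq> U"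
    using openin_contains_ball[of ?Y U] by (metis)
  have vY: "v \<in> ?Y" using U clAY by blast
  have "y \<in> closure (bounded_expansions x (real k + real k))" if y: "y \<in> ?Y" "norm y < r" for y
    unfolding closure_approachable
  proof (intro allI impI)
    fix e :: real assume e: "0 < e"
    have "v + y \<in> ?Y" by (rule closure_span_add[OF vY y(1)])
    then have "v + y \<in> closure (?A k)" using r(2) U(3) y by (auto simp: dist_norm subset_iff)
    then obtain p where p: "p \<in> ?A k" "dist p (v + y) < e / 2"
      using e unfolding closure_approachable by (meson half_gt_zero)
    have "v \<in> closure (?A k)" using U by blast
    then obtain q where q: "q \<in> ?A k" "dist q v < e / 2"
      using e unfolding closure_approachable by (meson half_gt_zero)
    have "dist (p - q) y < e"
      using p(2) q(2) norm_triangle_ineq4[of "p - (v + y)" "q - v"] by (simp add: dist_norm algebra_simps)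
    then show "\<exists>z\<in>bounded_expansions x (real k + real k). dist z y < e"
      using bounded_expansions_diff[OF p(1) q(1)] by blast
  qed
  then show ?thesis using r(1) by (intro exI[of _ r] conjI exI[of _ "real k + real k"]) auto
qed

lemma expansion_step:
  assumes x: "basic_sequence x"
  shows "\<exists>C\<ge>0. \<forall>v\<in>closure (span (range x)). \<forall>s>0. norm v \<le> s \<longrightarrow>
    (\<exists>p\<in>bounded_expansions x (C * s). norm (v - p) \<le> s / 2)"
proof -
  obtain r C where r: "r > 0" and C: "C \<ge> 0"
    and dense: "\<And>v. v \<in> closure (span (range x)) \<Longrightarrow> norm v < r \<Longrightarrow> v \<in> closure (bounded_expansions x C)"
    using bounded_expansions_dense_in_ball[OF x] by blast
  have "\<exists>p\<in>bounded_expansions x (2 * C / r * s). norm (v - p) \<le> s / 2"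
    if v: "v \<in> closure (span (range x))" and s: "0 < s" "norm v \<le> s" for v s
  proof -
    define t where "t = 2 * s / r"
    have t: "0 < t" using s r by (simp add: t_def)
    have "norm ((1 / t) *\<^sub>R v) = norm v / t" using t by simp
    also have "\<dots> \<le> s / t" using s t by (simp add: divide_right_mono)
    also have "\<dots> = r / 2" using s r by (simp add: t_def)
    also have "\<dots> < r" using r by simp
    finally have "(1 / t) *\<^sub>R v \<in> closure (bounded_expansions x C)"
      by (intro dense closure_span_scale v)
    moreover have "0 < s / (2 * t)" using s t by simp
    ultimately obtain q where q: "q \<in> bounded_expansions x C" "dist q ((1 / t) *\<^sub>R v) < s / (2 * t)"
      unfolding closure_approachable by blast
    have "v - t *\<^sub>R q = t *\<^sub>R ((1 / t) *\<^sub>R v - q)" using t by (simp add: scaleR_diff_right)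
    then have "norm (v - t *\<^sub>R q) = t * dist q ((1 / t) *\<^sub>R v)"
      using t by (simp add: dist_norm norm_minus_commute)
    also have "\<dots> \<le> t * (s / (2 * t))" using q(2) t by (intro mult_left_mono) auto
    also have "\<dots> = s / 2" using t by simp
    finally have near: "norm (v - t *\<^sub>R q) \<le> s / 2" .
    have "t * C = 2 * C / r * s" by (simp add: t_def)
    then have "t *\<^sub>R q \<in> bounded_expansions x (2 * C / r * s)"
      using bounded_expansions_scale[OF q(1) less_imp_le[OF t]] by (simp only:)
    then show ?thesis using near by blast
  qed
  then show ?thesis using r C by (intro exI[of _ "2 * C / r"]) auto
qed

text \<open>
  Successive approximation: the error is halved in every step, the expansions of the corrections add
  up coefficientwise, and dominated convergence identifies the sum of the resulting series.
\<close>

lemma basic_sequence_expansion_bound: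
  assumes x: "basic_sequence x"
  shows "\<exists>C\<ge>0. \<forall>v\<in>closure (span (range x)). \<forall>s>0. norm v \<le> s \<longrightarrow> v \<in> bounded_expansions x (C * s)"
proof -
  let ?Y = "closure (span (range x))"
  obtain C where C: "C \<ge> 0" and step: "\<And>v s. v \<in> ?Y \<Longrightarrow> 0 < s \<Longrightarrow> norm v \<le> s \<Longrightarrow>
      \<exists>p\<in>bounded_expansions x (C * s). norm (v - p) \<le> s / 2"
    using expansion_step[OF x] by blast
  have "v \<in> bounded_expansions x (2 * C * s)"
    if v: "v \<in> ?Y" and s: "0 < s" "norm v \<le> s" for v s
  proof -
    define P where "P i y p a \<longleftrightarrow> norm (y - p) \<le> s / 2 ^ Suc i \<and> (\<lambda>j. a j *\<^sub>R x j) sums p \<and>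
      (\<forall>n. norm (\<Sum>j<n. a j *\<^sub>R x j) \<le> C * (s / 2 ^ i))" for i :: nat and y p and a :: "nat \<Rightarrow> real"
    have "\<exists>p a. P i y p a" if y: "y \<in> ?Y" "norm y \<le> s / 2 ^ i" for i y
    proof -
      have "0 < s / 2 ^ i" using s by simp
      then obtain p where "p \<in> bounded_expansions x (C * (s / 2 ^ i))" "norm (y - p) \<le> s / 2 ^ i / 2"
        using step[OF y(1) _ y(2)] by blast
      then show ?thesis unfolding bounded_expansions_def P_def by (auto simp: mult.commute)
    qed
    then have "\<forall>iy. \<exists>pa. snd iy \<in> ?Y \<and> norm (snd iy) \<le> s / 2 ^ fst iy \<longrightarrow>
        P (fst iy) (snd iy) (fst pa) (snd pa)"
      by (metis fst_conv snd_conv)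
    from choice[OF this] obtain f where f: "\<And>i y. y \<in> ?Y \<Longrightarrow> norm y \<le> s / 2 ^ i \<Longrightarrow>
        P i y (fst (f (i, y))) (snd (f (i, y)))" by (metis fst_conv snd_conv)
    define y where "y = rec_nat v (\<lambda>i y. y - fst (f (i, y)))"
    have y0: "y 0 = v" and ySuc: "\<And>i. y (Suc i) = y i - fst (f (i, y i))"
      by (simp_all add: y_def)
    have inv: "y i \<in> ?Y \<and> norm (y i) \<le> s / 2 ^ i" for i
    proof (induction i)
      case (Suc i)
      then have P: "P i (y i) (fst (f (i, y i))) (snd (f (i, y i)))" using f by blast
      then have "fst (f (i, y i)) \<in> ?Y" unfolding P_def using sums_in_closed_span by blast
      then have "y i + (-1) *\<^sub>R fst (f (i, y i)) \<in> ?Y"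
        using Suc by (intro closure_span_add closure_span_scale) auto
      then show ?case using P by (simp add: ySuc P_def)
    qed (use v s y0 in auto)
    define p where "p i = fst (f (i, y i))" for i
    define a where "a i = snd (f (i, y i))" for i
    have P: "P i (y i) (p i) (a i)" for i using f inv by (simp add: p_def a_def)
    have a_sums: "(\<lambda>j. a i j *\<^sub>R x j) sums p i" for i using P by (simp add: P_def)
    have a_bound: "norm (\<Sum>j<n. a i j *\<^sub>R x j) \<le> C * (s / 2 ^ i)" for i n using P by (simp add: P_def)
    have geo: "(\<lambda>i. C * (s / 2 ^ i)) sums (2 * C * s)"
      using sums_mult[OF geometric_sums[of "1 / 2 :: real"], of "C * s"] by (simp add: power_one_over field_simps)
    have y_lim: "y \<longlonglongrightarrow> 0"
    proof (rule Lim_null_comparison)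
      show "\<forall>\<^sub>F i in sequentially. norm (y i) \<le> s / 2 ^ i" using inv by simp
      show "(\<lambda>i. s / 2 ^ i) \<longlonglongrightarrow> 0" by real_asymp
    qed
    have "(\<lambda>n. \<Sum>i<n. p i) = (\<lambda>n. v - y n)"
    proof
      show "(\<Sum>i<n. p i) = v - y n" for n by (induction n) (simp_all add: y0 ySuc p_def)
    qed
    then have p_sums: "p sums v" using tendsto_diff[OF tendsto_const y_lim, of v] by (simp add: sums_def)
    have summ: "summable (\<lambda>i. a i j)" for j
    proof (rule summable_comparison_test')
      show "summable (\<lambda>i. 2 * (C * (s / 2 ^ i)) / norm (x j))"
        by (intro summable_divide summable_mult sums_summable[OF geo])
      fix i :: nat
      have "norm (a i j *\<^sub>R x j) = norm ((\<Sum>k<Suc j. a i k *\<^sub>R x k) - (\<Sum>k<j. a i k *\<^sub>R x k))" by simp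
      also have "\<dots> \<le> C * (s / 2 ^ i) + C * (s / 2 ^ i)"
        using a_bound by (intro order_trans[OF norm_triangle_ineq4] add_mono)
      finally show "norm (a i j) \<le> 2 * (C * (s / 2 ^ i)) / norm (x j)"
        using basic_sequence_nonzero[OF x, of j] by (simp add: field_simps)
    qed
    define b where "b j = (\<Sum>i. a i j)" for j
    have b_sums: "(\<lambda>i. \<Sum>j<n. a i j *\<^sub>R x j) sums (\<Sum>j<n. b j *\<^sub>R x j)" for n
      unfolding b_def by (intro sums_sum sums_scaleR_left summable_sums summ)
    have b_bound: "norm (\<Sum>j<n. b j *\<^sub>R x j) \<le> 2 * C * s" for n
    proof -
      have "norm (\<Sum>i. \<Sum>j<n. a i j *\<^sub>R x j) \<le> (\<Sum>i. C * (s / 2 ^ i))"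
        using a_bound geo by (intro norm_suminf_le) (auto simp: sums_iff)
      then show ?thesis using geo b_sums[of n] by (simp add: sums_iff)
    qed
    have p_bound: "norm (p i) \<le> C * (s / 2 ^ i)" for i
      using a_bound a_sums[of i] unfolding sums_def
      by (intro LIMSEQ_le_const2[OF tendsto_norm]) blast+
    have diff_lim: "(\<lambda>n. \<Sum>i. norm ((\<Sum>j<n. a i j *\<^sub>R x j) - p i)) \<longlonglongrightarrow> (\<Sum>i. 0::real)"
      and diff_summ: "\<forall>\<^sub>F n in sequentially. summable (\<lambda>i. norm (norm ((\<Sum>j<n. a i j *\<^sub>R x j) - p i)))"
    proof -
      have lim: "(\<lambda>n. norm ((\<Sum>j<n. a i j *\<^sub>R x j) - p i)) \<longlonglongrightarrow> 0" for i
        using a_sums[of i] by (simp add: sums_def LIM_zero tendsto_norm_zero)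
      have bd: "norm (norm ((\<Sum>j<n. a i j *\<^sub>R x j) - p i)) \<le> 2 * (C * (s / 2 ^ i))" for i n
        using norm_triangle_ineq4[of "\<Sum>j<n. a i j *\<^sub>R x j" "p i"] a_bound[of i n] p_bound[of i] by simp
      have "summable (\<lambda>i. 2 * (C * (s / 2 ^ i)))"
        by (intro summable_mult sums_summable[OF geo])
      note tannerys_theorem[of "\<lambda>i n. norm ((\<Sum>j<n. a i j *\<^sub>R x j) - p i)" "\<lambda>_. 0" sequentially
          "\<lambda>i. 2 * (C * (s / 2 ^ i))", OF lim _ this]
      moreover have "\<forall>\<^sub>F (i, n) in sequentially \<times>\<^sub>F sequentially.
          norm (norm ((\<Sum>j<n. a i j *\<^sub>R x j) - p i)) \<le> 2 * (C * (s / 2 ^ i))"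
        using bd by (intro always_eventually) auto
      ultimately show "(\<lambda>n. \<Sum>i. norm ((\<Sum>j<n. a i j *\<^sub>R x j) - p i)) \<longlonglongrightarrow> (\<Sum>i. 0::real)"
        "\<forall>\<^sub>F n in sequentially. summable (\<lambda>i. norm (norm ((\<Sum>j<n. a i j *\<^sub>R x j) - p i)))" by auto
    qed
    have "(\<lambda>n. (\<Sum>j<n. b j *\<^sub>R x j) - v) \<longlonglongrightarrow> 0"
    proof (rule Lim_null_comparison)
      show "\<forall>\<^sub>F n in sequentially. norm ((\<Sum>j<n. b j *\<^sub>R x j) - v) \<le>
          (\<Sum>i. norm ((\<Sum>j<n. a i j *\<^sub>R x j) - p i))"
        using diff_summ
      proof eventually_elim
        case (elim n)
        have "(\<Sum>j<n. b j *\<^sub>R x j) - v = (\<Sum>i. (\<Sum>j<n. a i j *\<^sub>R x j) - p i)"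
          using sums_diff[OF b_sums p_sums] by (simp add: sums_iff)
        then show ?case using elim by (simp add: summable_norm)
      qed
      show "(\<lambda>n. \<Sum>i. norm ((\<Sum>j<n. a i j *\<^sub>R x j) - p i)) \<longlonglongrightarrow> 0" using diff_lim by simp
    qed
    then have "(\<lambda>j. b j *\<^sub>R x j) sums v" by (simp add: sums_def LIM_zero_iff)
    then show ?thesis using b_bound unfolding bounded_expansions_def by blast
  qed
  then show ?thesis using C by (intro exI[of _ "2 * C"]) auto
qed

lemma sums_cutoff:
  fixes x :: "nat \<Rightarrow> 'a::real_normed_vector"
  shows "(\<lambda>j. (if j < n then b j else 0) *\<^sub>R x j) sums (\<Sum>j<n. b j *\<^sub>R x j)"
proof -
  have "(\<lambda>j. (if j < n then b j else 0) *\<^sub>R x j) sums (\<Sum>j<n. (if j < n then b j else 0) *\<^sub>R x j)"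
    by (rule sums_finite) auto
  then show ?thesis by simp
qed

text \<open>
  By uniqueness, the expansion with bounded partial sums constructed above is the given one, so the
  partial sum projections are uniformly bounded (Banach).
\<close>

theorem basis_constant:
  assumes x: "basic_sequence x"
  shows "\<exists>K>0. \<forall>b m n. m \<le> n \<longrightarrow> norm (\<Sum>j<m. b j *\<^sub>R x j) \<le> K * norm (\<Sum>j<n. b j *\<^sub>R x j)"
proof -
  obtain C where C: "C \<ge> 0" and exp: "\<And>v s. v \<in> closure (span (range x)) \<Longrightarrow> 0 < s \<Longrightarrow>
      norm v \<le> s \<Longrightarrow> v \<in> bounded_expansions x (C * s)"
    using basic_sequence_expansion_bound[OF x] by blast
  have "norm (\<Sum>j<m. b j *\<^sub>R x j) \<le> (C + 1) * norm (\<Sum>j<n. b j *\<^sub>R x j)" if "m \<le> n" for b m n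
  proof -
    define v where "v = (\<Sum>j<n. b j *\<^sub>R x j)"
    define c where "c j = (if j < n then b j else 0)" for j
    have vY: "v \<in> closure (span (range x))" unfolding v_def by (rule sum_in_closed_span)
    have c: "(\<lambda>j. c j *\<^sub>R x j) sums v" unfolding c_def v_def by (rule sums_cutoff)
    have m: "(\<Sum>j<m. b j *\<^sub>R x j) = (\<Sum>j<m. c j *\<^sub>R x j)"
      using that by (intro sum.cong) (auto simp: c_def)
    show ?thesis
    proof (cases "v = 0")
      case True
      then have "(\<lambda>j. (0::real) *\<^sub>R x j) sums v" by simp
      then have "c = (\<lambda>j. 0)" by (rule basic_sequence_expansion_unique[OF x vY c])
      then show ?thesis using m C by simp
    next
      case False
      then obtain a where a: "(\<lambda>j. a j *\<^sub>R x j) sums v" "\<And>n. norm (\<Sum>j<n. a j *\<^sub>R x j) \<le> C * norm v"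
        using exp[OF vY, of "norm v"] by (auto simp: bounded_expansions_def)
      then have "c = a" by (intro basic_sequence_expansion_unique[OF x vY c])
      then have "norm (\<Sum>j<m. b j *\<^sub>R x j) \<le> C * norm v" using a(2) m by simp
      also have "\<dots> \<le> (C + 1) * norm v" by (intro mult_right_mono) auto
      finally show ?thesis by (simp only: v_def)
    qed
  qed
  then show ?thesis using C by (intro exI[of _ "C + 1"]) auto
qed

section \<open>Subsymmetric sequences\<close>

lemma subsymmetric_basic: "subsymmetric x \<Longrightarrow> basic_sequence x"
  by (simp add: subsymmetric_def unconditional_basic_def)

lemma subsymmetric_summable_on:
  "subsymmetric x \<Longrightarrow> summable (\<lambda>j. a j *\<^sub>R x j) \<Longrightarrow> (\<lambda>j. a j *\<^sub>R x j) summable_on UNIV"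
  by (simp add: subsymmetric_def unconditional_basic_def)

lemma subsymmetric_subseq_iff:
  "subsymmetric x \<Longrightarrow> strict_mono \<sigma> \<Longrightarrow>
    summable (\<lambda>j. a j *\<^sub>R x (\<sigma> j)) \<longleftrightarrow> summable (\<lambda>j. a j *\<^sub>R x j)"
  by (simp add: subsymmetric_def equivalent_basic_def)

text \<open>
  The form in which subsymmetry is exploited: a subsequence is chosen term by term, each term
  sufficiently good relative to its index.
\<close>

lemma ex_strict_mono_choice:
  assumes "\<And>i n. \<exists>k>n. P i k"
  shows "\<exists>\<sigma>. strict_mono \<sigma> \<and> (\<forall>i::nat. P i (\<sigma> i :: nat))"
proof -
  have "\<exists>f. \<forall>i. P i (f i) \<and> f i < f (Suc i)"
    by (rule dependent_nat_choice) (use assms in blast)+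
  then show ?thesis by (auto simp: strict_mono_Suc_iff)
qed

lemma LIMSEQ_even_odd:
  fixes f :: "nat \<Rightarrow> 'a::metric_space"
  assumes "(\<lambda>n. f (2 * n)) \<longlonglongrightarrow> l" "(\<lambda>n. f (2 * n + 1)) \<longlonglongrightarrow> l"
  shows "f \<longlonglongrightarrow> l"
proof (rule metric_LIMSEQ_I)
  fix r :: real assume "0 < r"
  then obtain M N where "\<And>n. n \<ge> M \<Longrightarrow> dist (f (2 * n)) l < r" "\<And>n. n \<ge> N \<Longrightarrow> dist (f (2 * n + 1)) l < r"
    using metric_LIMSEQ_D[OF assms(1)] metric_LIMSEQ_D[OF assms(2)] by meson
  then have "dist (f n) l < r" if "n \<ge> 2 * M + 2 * N" for n
    using that by (cases "even n") (auto elim!: evenE oddE)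
  then show "\<exists>no. \<forall>n\<ge>no. dist (f n) l < r" by blast
qed

lemma summable_half_powers: "summable (\<lambda>j. c * (1 / 2) ^ j :: real)"
  by (intro summable_mult summable_geometric) simp

text \<open>
  Otherwise some subsequence decreases so fast that the coefficients \<open>1 / norm (x j)\<close> make it
  absolutely summable, whereas on \<open>x\<close> itself they produce unit vectors.
\<close>

lemma subsymmetric_bounded_below:
  assumes x: "subsymmetric x"
  shows "\<exists>d>0. \<forall>j. d \<le> norm (x j)"
proof (rule ccontr)
  assume neg: "\<not> (\<exists>d>0. \<forall>j. d \<le> norm (x j))"
  have nz: "norm (x j) > 0" for j
    using basic_sequence_nonzero[OF subsymmetric_basic[OF x]] by simp
  have "\<exists>k>n. norm (x k) < (1 / 2) ^ i * norm (x i)" for i n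
  proof -
    define d where "d = Min (insert ((1 / 2) ^ i * norm (x i)) ((\<lambda>j. norm (x j)) ` {..n}))"
    have "0 < d" unfolding d_def using nz by (subst Min_gr_iff) auto
    then obtain k where "norm (x k) < d" using neg by (meson not_le)
    then have "norm (x k) < (1 / 2) ^ i * norm (x i)" "\<forall>j\<le>n. norm (x k) < norm (x j)"
      unfolding d_def by (auto simp: Min_gr_iff)
    then show ?thesis by (intro exI[of _ k]) (auto simp: not_le[symmetric])
  qed
  then obtain \<sigma> where \<sigma>: "strict_mono \<sigma>" "\<And>i. norm (x (\<sigma> i)) < (1 / 2) ^ i * norm (x i)"
    using ex_strict_mono_choice[of "\<lambda>i k. norm (x k) < (1 / 2) ^ i * norm (x i)"] by blast
  have "summable (\<lambda>j. (1 / norm (x j)) *\<^sub>R x (\<sigma> j))"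
  proof (rule summable_comparison_test'[OF summable_half_powers[of 1]])
    show "norm ((1 / norm (x j)) *\<^sub>R x (\<sigma> j)) \<le> 1 * (1 / 2) ^ j" for j
      using \<sigma>(2)[of j] nz[of j] by (simp add: pos_divide_le_eq less_imp_le)
  qed
  then have "summable (\<lambda>j. (1 / norm (x j)) *\<^sub>R x j)"
    by (rule subsymmetric_subseq_iff[OF x \<sigma>(1), THEN iffD1])
  from tendsto_norm_zero[OF summable_LIMSEQ_zero[OF this]] have "(\<lambda>j. norm ((1 / norm (x j)) *\<^sub>R x j)) \<longlonglongrightarrow> 0" .
  moreover have "norm ((1 / norm (x j)) *\<^sub>R x j) = 1" for j using nz[of j] by simp
  ultimately have "(\<lambda>j::nat. 1::real) \<longlonglongrightarrow> 0" by simp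
  then show False using LIMSEQ_unique tendsto_const zero_neq_one by blast
qed

lemma subsymmetric_bounded_above:
  assumes x: "subsymmetric x"
  shows "\<exists>D. \<forall>j. norm (x j) \<le> D"
proof (rule ccontr)
  assume neg: "\<not> (\<exists>D. \<forall>j. norm (x j) \<le> D)"
  have nz: "norm (x j) > 0" for j
    using basic_sequence_nonzero[OF subsymmetric_basic[OF x]] by simp
  have "\<exists>k>n. 2 ^ i * norm (x i) < norm (x k)" for i n
  proof -
    define D where "D = Max (insert (2 ^ i * norm (x i)) ((\<lambda>j. norm (x j)) ` {..n}))"
    obtain k where "D < norm (x k)" using neg by (meson not_le)
    then have "2 ^ i * norm (x i) < norm (x k)" "\<forall>j\<le>n. norm (x j) < norm (x k)"
      unfolding D_def by auto
    then show ?thesis by (intro exI[of _ k]) (auto simp: not_le[symmetric])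
  qed
  then obtain \<sigma> where \<sigma>: "strict_mono \<sigma>" "\<And>i. 2 ^ i * norm (x i) < norm (x (\<sigma> i))"
    using ex_strict_mono_choice[of "\<lambda>i k. 2 ^ i * norm (x i) < norm (x k)"] by blast
  have "summable (\<lambda>j. (1 / norm (x (\<sigma> j))) *\<^sub>R x j)"
  proof (rule summable_comparison_test'[OF summable_half_powers[of 1]])
    show "norm ((1 / norm (x (\<sigma> j))) *\<^sub>R x j) \<le> 1 * (1 / 2) ^ j" for j
      using \<sigma>(2)[of j] nz[of "\<sigma> j"] by (simp add: power_one_over field_simps less_imp_le)
  qed
  then have "summable (\<lambda>j. (1 / norm (x (\<sigma> j))) *\<^sub>R x (\<sigma> j))"
    by (rule subsymmetric_subseq_iff[OF x \<sigma>(1), THEN iffD2])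
  from tendsto_norm_zero[OF summable_LIMSEQ_zero[OF this]]
  have "(\<lambda>j. norm ((1 / norm (x (\<sigma> j))) *\<^sub>R x (\<sigma> j))) \<longlonglongrightarrow> 0" .
  moreover have "norm ((1 / norm (x (\<sigma> j))) *\<^sub>R x (\<sigma> j)) = 1" for j using nz[of "\<sigma> j"] by simp
  ultimately have "(\<lambda>j::nat. 1::real) \<longlonglongrightarrow> 0" by simp
  then show False using LIMSEQ_unique tendsto_const zero_neq_one by blast
qed

lemma basis_constant_difference:
  assumes "basic_sequence x"
  shows "\<exists>K>0. \<forall>m n. m < n \<longrightarrow> norm (x m) \<le> K * norm (x m - x n)"
proof -
  obtain K where K: "K > 0" "\<And>b m n. m \<le> n \<Longrightarrow>
      norm (\<Sum>j<m. b j *\<^sub>R x j) \<le> K * norm (\<Sum>j<n. b j *\<^sub>R x j)"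
    using basis_constant[OF assms] by blast
  have "norm (x m) \<le> K * norm (x m - x n)" if mn: "m < n" for m n
  proof -
    define b where "b j = (if j = m then 1 else if j = n then - 1 else 0 :: real)" for j
    have "(\<Sum>j<Suc m. b j *\<^sub>R x j) = (\<Sum>j\<in>{m}. b j *\<^sub>R x j)"
      using mn by (intro sum.mono_neutral_right) (auto simp: b_def)
    moreover have "(\<Sum>j<Suc n. b j *\<^sub>R x j) = (\<Sum>j\<in>{m,n}. b j *\<^sub>R x j)"
      using mn by (intro sum.mono_neutral_right) (auto simp: b_def)
    ultimately show ?thesis using K(2)[of "Suc m" "Suc n" b] mn by (simp add: b_def)
  qed
  then show ?thesis using K(1) by blast
qed

text \<open>
  From a convergent series of differences one recovers the series over the \<open>x (\<alpha> j)\<close>: its terms tend to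
  0 by the basis constant, so the interleaved series with coefficients \<open>a j, - a j\<close> converges, and
  unconditionality lets one keep only every other term.
\<close>

lemma subsymmetric_difference_iff:
  assumes x: "subsymmetric x" and \<alpha>\<beta>: "\<And>i. \<alpha> i < \<beta> i" "\<And>i. \<beta> i < \<alpha> (Suc i)"
  shows "summable (\<lambda>j. a j *\<^sub>R (x (\<alpha> j) - x (\<beta> j))) \<longleftrightarrow> summable (\<lambda>j. a j *\<^sub>R x j)"
proof
  have \<alpha>: "strict_mono \<alpha>"
  proof (rule strict_monoI_Suc)
    show "\<alpha> i < \<alpha> (Suc i)" for i using \<alpha>\<beta>(1)[of i] \<alpha>\<beta>(2)[of i] by linarith
  qed
  have \<beta>: "strict_mono \<beta>"
  proof (rule strict_monoI_Suc)
    show "\<beta> i < \<beta> (Suc i)" for i using \<alpha>\<beta>(1)[of "Suc i"] \<alpha>\<beta>(2)[of i] by linarith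
  qed
  show "summable (\<lambda>j. a j *\<^sub>R (x (\<alpha> j) - x (\<beta> j)))" if "summable (\<lambda>j. a j *\<^sub>R x j)"
    using that subsymmetric_subseq_iff[OF x \<alpha>, of a] subsymmetric_subseq_iff[OF x \<beta>, of a]
    by (simp add: scaleR_diff_right summable_diff)
  assume S: "summable (\<lambda>j. a j *\<^sub>R (x (\<alpha> j) - x (\<beta> j)))"
  define s where "s i = (if even i then \<alpha> (i div 2) else \<beta> (i div 2))" for i :: nat
  define c where "c i = (if even i then a (i div 2) else - a (i div 2))" for i :: nat
  have s: "strict_mono s"
  proof (rule strict_monoI_Suc)
    show "s i < s (Suc i)" for i
      using \<alpha>\<beta> by (cases "even i") (auto simp: s_def elim!: oddE evenE)
  qed
  have even_sum: "(\<Sum>i<2 * n. f i) = (\<Sum>j<n. f (2 * j) + f (2 * j + 1))" for f :: "nat \<Rightarrow> 'a" and n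
    by (induction n) (simp_all add: add.assoc)
  have cs: "(\<Sum>i<2 * n. c i *\<^sub>R x (s i)) = (\<Sum>j<n. a j *\<^sub>R (x (\<alpha> j) - x (\<beta> j)))" for n
    unfolding even_sum by (simp add: c_def s_def scaleR_diff_right)
  obtain K where K: "K > 0" "\<And>m n. m < n \<Longrightarrow> norm (x m) \<le> K * norm (x m - x n)"
    using basis_constant_difference[OF subsymmetric_basic[OF x]] by blast
  have term0: "(\<lambda>n. a n *\<^sub>R x (\<alpha> n)) \<longlonglongrightarrow> 0"
  proof (rule Lim_null_comparison)
    have "norm (a n *\<^sub>R x (\<alpha> n)) \<le> K * norm (a n *\<^sub>R (x (\<alpha> n) - x (\<beta> n)))" for n
      using mult_left_mono[OF K(2)[OF \<alpha>\<beta>(1)[of n]], of "\<bar>a n\<bar>"] by (simp add: mult.left_commute)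
    then show "\<forall>\<^sub>F n in sequentially. norm (a n *\<^sub>R x (\<alpha> n)) \<le> K * norm (a n *\<^sub>R (x (\<alpha> n) - x (\<beta> n)))"
      by simp
    show "(\<lambda>n. K * norm (a n *\<^sub>R (x (\<alpha> n) - x (\<beta> n)))) \<longlonglongrightarrow> 0"
      using tendsto_mult_right_zero[OF tendsto_norm_zero[OF summable_LIMSEQ_zero[OF S]]] by blast
  qed
  obtain l where l: "(\<lambda>n. \<Sum>j<n. a j *\<^sub>R (x (\<alpha> j) - x (\<beta> j))) \<longlonglongrightarrow> l"
    using S by (auto simp: summable_def sums_def)
  have "(\<lambda>n. \<Sum>i<n. c i *\<^sub>R x (s i)) \<longlonglongrightarrow> l"
  proof (rule LIMSEQ_even_odd)
    show "(\<lambda>n. \<Sum>i<2 * n. c i *\<^sub>R x (s i)) \<longlonglongrightarrow> l" using l by (simp add: cs)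
    have "(\<lambda>n. (\<Sum>j<n. a j *\<^sub>R (x (\<alpha> j) - x (\<beta> j))) + a n *\<^sub>R x (\<alpha> n)) \<longlonglongrightarrow> l + 0"
      by (intro tendsto_add l term0)
    moreover have "(\<Sum>i<2 * n + 1. c i *\<^sub>R x (s i)) =
        (\<Sum>j<n. a j *\<^sub>R (x (\<alpha> j) - x (\<beta> j))) + a n *\<^sub>R x (\<alpha> n)" for n
      using cs[of n] by (simp add: c_def s_def)
    ultimately show "(\<lambda>n. \<Sum>i<2 * n + 1. c i *\<^sub>R x (s i)) \<longlonglongrightarrow> l" by simp
  qed
  then have "summable (\<lambda>i. c i *\<^sub>R x (s i))" by (auto simp: summable_def sums_def)
  then have "summable (\<lambda>i. c i *\<^sub>R x i)"
    by (rule subsymmetric_subseq_iff[OF x s, THEN iffD1])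
  then have "(\<lambda>i. c i *\<^sub>R x i) summable_on UNIV" by (rule subsymmetric_summable_on[OF x])
  then have "(\<lambda>i. c i *\<^sub>R x i) summable_on {i. even i}"
    by (rule summable_on_subset_banach) simp
  then have "(\<lambda>i. (if even i then c i else 0) *\<^sub>R x i) summable_on UNIV"
    by (rule summable_on_cong_neutral[THEN iffD1, rotated -1]) auto
  then have "summable (\<lambda>i. (if even i then c i else 0) *\<^sub>R x i)"
    using has_sum_imp_sums unfolding summable_on_def summable_def by blast
  then have "summable (\<lambda>i. (if even i then c i else 0) *\<^sub>R x (s i))"
    by (rule subsymmetric_subseq_iff[OF x s, THEN iffD2])
  then obtain l' where "(\<lambda>n. \<Sum>i<n. (if even i then c i else 0) *\<^sub>R x (s i)) \<longlonglongrightarrow> l'"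
    by (auto simp: summable_def sums_def)
  then have "(\<lambda>n. \<Sum>i<2 * n. (if even i then c i else 0) *\<^sub>R x (s i)) \<longlonglongrightarrow> l'"
    by (rule filterlim_compose) (simp add: filterlim_at_top_mult_tendsto_pos mult_nat_left_at_top)
  moreover have "(\<Sum>i<2 * n. (if even i then c i else 0) *\<^sub>R x (s i)) = (\<Sum>j<n. a j *\<^sub>R x (\<alpha> j))" for n
    unfolding even_sum by (simp add: c_def s_def)
  ultimately have "summable (\<lambda>j. a j *\<^sub>R x (\<alpha> j))" by (auto simp: summable_def sums_def)
  then show "summable (\<lambda>j. a j *\<^sub>R x j)"
    by (rule subsymmetric_subseq_iff[OF x \<alpha>, THEN iffD1])
qed

text \<open>
  The coefficients of a convergent series are bounded if the vectors are bounded away from 0. So a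
  summable error changes the series by an absolutely convergent one.
\<close>

lemma summable_perturbation:
  fixes y z :: "nat \<Rightarrow> 'a::banach"
  assumes S: "summable (\<lambda>j. a j *\<^sub>R y j)" and d: "0 < d" "\<And>j. d \<le> norm (y j)"
    and err: "\<And>j. norm (y j - z j) \<le> \<epsilon> j" "summable \<epsilon>"
  shows "summable (\<lambda>j. a j *\<^sub>R z j)"
proof -
  have "Bseq (\<lambda>j. a j *\<^sub>R y j)"
    using summable_LIMSEQ_zero[OF S] by (intro convergent_imp_Bseq) (auto simp: convergent_def)
  then obtain B where B: "\<And>j. norm (a j *\<^sub>R y j) \<le> B" by (auto simp: Bseq_def)
  have a: "\<bar>a j\<bar> \<le> B / d" for j
  proof -
    have "\<bar>a j\<bar> * d \<le> \<bar>a j\<bar> * norm (y j)" by (intro mult_left_mono d) simp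
    also have "\<dots> \<le> B" using B[of j] by simp
    finally show ?thesis using d by (simp add: field_simps)
  qed
  have "summable (\<lambda>j. a j *\<^sub>R (y j - z j))"
  proof (rule summable_comparison_test')
    show "summable (\<lambda>j. B / d * \<epsilon> j)" by (intro summable_mult err)
    show "norm (a j *\<^sub>R (y j - z j)) \<le> B / d * \<epsilon> j" for j
      unfolding norm_scaleR using a[of j] err(1)[of j] by (intro mult_mono) (auto intro: order_trans[OF abs_ge_zero])
  qed
  from summable_diff[OF S this] show ?thesis by (simp add: scaleR_diff_right)
qed

lemma summable_domination:
  fixes f :: "nat \<Rightarrow> 'a::banach" and g :: "nat \<Rightarrow> 'b::banach"
  assumes "summable g" and le: "\<And>m n. norm (sum f {m..<n}) \<le> C * norm (sum g {m..<n})"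
  shows "summable f"
  unfolding summable_Cauchy
proof (intro allI impI)
  fix \<epsilon> :: real assume "0 < \<epsilon>"
  then have "0 < \<epsilon> / (\<bar>C\<bar> + 1)" by simp
  then obtain N where N: "\<And>m n. m \<ge> N \<Longrightarrow> norm (sum g {m..<n}) < \<epsilon> / (\<bar>C\<bar> + 1)"
    using assms(1) unfolding summable_Cauchy by meson
  have "norm (sum f {m..<n}) < \<epsilon>" if "m \<ge> N" for m n
  proof -
    have "norm (sum f {m..<n}) \<le> (\<bar>C\<bar> + 1) * norm (sum g {m..<n})"
      by (rule order_trans[OF le mult_right_mono]) auto
    also have "\<dots> < (\<bar>C\<bar> + 1) * (\<epsilon> / (\<bar>C\<bar> + 1))"
      by (intro mult_strict_left_mono N that) simp
    also have "\<dots> = \<epsilon>"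
    proof -
      have "\<bar>C\<bar> + 1 \<noteq> 0" by linarith
      then show ?thesis by simp
    qed
    finally show ?thesis .
  qed
  then show "\<exists>N. \<forall>m\<ge>N. \<forall>n. norm (sum f {m..<n}) < \<epsilon>" by blast
qed

section \<open>Completions\<close>

lemma lin_comb_add:
  assumes "a \<in> c00" "b \<in> c00"
  shows "lin_comb e (\<lambda>n. a n + b n) = lin_comb e a + lin_comb e b"
proof -
  let ?A = "{n. a n \<noteq> 0} \<union> {n. b n \<noteq> 0}"
  have A: "finite ?A" using assms by (simp add: c00_def)
  show ?thesis
    by (subst (1 2 3) lin_comb_eq[OF A]) (auto simp: scaleR_add_left sum.distrib)
qed

lemma lin_comb_scale:
  assumes "a \<in> c00"
  shows "lin_comb e (\<lambda>n. r * a n) = r *\<^sub>R lin_comb e a"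
proof -
  have A: "finite {n. a n \<noteq> 0}" using assms by (simp add: c00_def)
  show ?thesis by (subst (1 2) lin_comb_eq[OF A]) (auto simp: scaleR_sum_right)
qed

lemma lin_comb_diff:
  assumes "a \<in> c00" "b \<in> c00"
  shows "lin_comb e (\<lambda>n. a n - b n) = lin_comb e a - lin_comb e b"
  using lin_comb_add[OF assms(1) c00_scale[OF assms(2), of "-1"], of e] lin_comb_scale[OF assms(2), of e "-1"]
  by simp

lemma lin_comb_sum:
  assumes "\<And>k. k \<in> A \<Longrightarrow> z k \<in> c00"
  shows "lin_comb e (\<lambda>n. \<Sum>k\<in>A. z k n) = (\<Sum>k\<in>A. lin_comb e (z k))"
  using assms
proof (induction A rule: infinite_finite_induct)
  case (insert k A)
  have "lin_comb e (\<lambda>n. z k n + (\<Sum>k\<in>A. z k n)) = lin_comb e (z k) + lin_comb e (\<lambda>n. \<Sum>k\<in>A. z k n)"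
    by (intro lin_comb_add c00_sum) (use insert.prems in blast)+
  then show ?case using insert by simp
qed (simp_all add: lin_comb_def)

lemma lin_comb_combination:
  assumes "blocks u L"
  shows "lin_comb e (combination a u A) = (\<Sum>k\<in>A. a k *\<^sub>R lin_comb e (u k))"
  unfolding combination_def[abs_def]
  by (subst lin_comb_sum) (simp_all add: lin_comb_scale blocks_c00[OF assms])

lemma lin_comb_restrict: "finite A \<Longrightarrow> lin_comb e (restrict_seq A a) = (\<Sum>k\<in>A. a k *\<^sub>R e k)"
  by (subst lin_comb_eq[of A]) (auto simp: restrict_seq_def split: if_splits)

lemma span_eq_lin_comb:
  assumes "v \<in> span (range e)" shows "\<exists>p\<in>c00. v = lin_comb e p"
  using assms
proof (induction rule: span_induct_alt)
  case base
  then show ?case by (intro bexI[of _ "\<lambda>_. 0"]) (auto simp: lin_comb_def)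
next
  case (step c x y)
  then obtain p k where p: "p \<in> c00" "y = lin_comb e p" "x = e k" by blast
  have k: "restrict_seq {k} (\<lambda>_. c) \<in> c00" by (simp add: c00_restrict_finite)
  have "c *\<^sub>R x + y = lin_comb e (\<lambda>n. restrict_seq {k} (\<lambda>_. c) n + p n)"
    using p k by (simp add: lin_comb_add lin_comb_restrict)
  then show ?case using p k by (intro bexI[of _ "\<lambda>n. restrict_seq {k} (\<lambda>_. c) n + p n"]) auto
qed

lemma completion_approx:
  assumes "c00_completion M e" "0 < \<epsilon>"
  shows "\<exists>p\<in>c00. norm (v - lin_comb e p) < \<epsilon>"
proof -
  have "v \<in> closure (span (range e))" using assms by (simp add: c00_completion_def)
  then obtain w where "w \<in> span (range e)" "dist w v < \<epsilon>"
    using assms(2) unfolding closure_approachable by blast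
  then show ?thesis using span_eq_lin_comb[of w e] by (auto simp: dist_norm norm_minus_commute)
qed

section \<open>Extracting a block sequence\<close>

lemma completion_norm: "c00_completion M e \<Longrightarrow> a \<in> c00 \<Longrightarrow> norm (lin_comb e a) = M a"
  by (simp add: c00_completion_def)

text \<open>
  After approximation by finitely supported vectors, a diagonal subsequence makes all coordinates
  converge, so that the differences of consecutive approximants have coordinates tending to 0.
\<close>

lemma null_difference_sequence:
  fixes x :: "nat \<Rightarrow> 's::banach" and \<eta> :: real
  assumes e: "c00_completion M e" and coord: "\<And>a n. a \<in> c00 \<Longrightarrow> \<bar>a n\<bar> \<le> M a"
    and x: "\<And>j. norm (x j) \<le> D" and \<eta>: "0 < \<eta>"
  shows "\<exists>s q. strict_mono s \<and> (\<forall>k. q k \<in> c00) \<and>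
    (\<forall>k. norm (x (s (2 * k)) - x (s (2 * k + 1)) - lin_comb e (q k)) \<le> \<eta> * (1 / 2) ^ k) \<and>
    (\<forall>n. (\<lambda>k. q k n) \<longlonglongrightarrow> 0)"
proof -
  have "\<forall>j. \<exists>p. p \<in> c00 \<and> norm (x j - lin_comb e p) < \<eta> / 2 * (1 / 2) ^ j"
  proof
    fix j
    have "0 < \<eta> / 2 * (1 / 2) ^ j" using \<eta> by simp
    then show "\<exists>p. p \<in> c00 \<and> norm (x j - lin_comb e p) < \<eta> / 2 * (1 / 2) ^ j"
      using completion_approx[OF e] by blast
  qed
  from choice[OF this] obtain p where p: "\<And>j. p j \<in> c00"
      "\<And>j. norm (x j - lin_comb e (p j)) < \<eta> / 2 * (1 / 2) ^ j" by blast
  have "norm (p j n) \<le> D + \<eta>" for j n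
  proof -
    have "\<eta> / 2 * (1 / 2) ^ j \<le> \<eta> / 2 * 1" using \<eta> by (intro mult_left_mono power_le_one) auto
    then have "norm (lin_comb e (p j)) \<le> D + \<eta>"
      using norm_triangle_ineq2[of "lin_comb e (p j)" "x j"] p(2)[of j] x[of j] \<eta>
      unfolding norm_minus_commute[of "lin_comb e (p j)"] by linarith
    then show ?thesis using coord[OF p(1), of j n] completion_norm[OF e p(1)] by simp
  qed
  then obtain s where s: "strict_mono s" and lim: "\<And>n. \<exists>l. (\<lambda>k. p (s k) n) \<longlonglongrightarrow> l"
    using function_convergent_subsequence[of "UNIV :: nat set" p "D + \<eta>"] by (metis UNIV_I countableI_type)
  define q where "q k n = p (s (2 * k)) n - p (s (2 * k + 1)) n" for k n
  have qe: "q k = (\<lambda>n. p (s (2 * k)) n - p (s (2 * k + 1)) n)" for k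
    by (simp add: q_def fun_eq_iff)
  have q: "q k \<in> c00" for k unfolding qe by (intro c00_diff p)
  have "norm (x (s (2 * k)) - x (s (2 * k + 1)) - lin_comb e (q k)) \<le> \<eta> * (1 / 2) ^ k" for k
  proof -
    have le: "\<eta> / 2 * (1 / 2) ^ s i \<le> \<eta> / 2 * (1 / 2) ^ k" if "k \<le> i" for i
      using that strict_mono_imp_increasing[OF s, of i] \<eta>
      by (intro mult_left_mono power_decreasing) auto
    have "x (s (2 * k)) - x (s (2 * k + 1)) - lin_comb e (q k) =
        (x (s (2 * k)) - lin_comb e (p (s (2 * k)))) - (x (s (2 * k + 1)) - lin_comb e (p (s (2 * k + 1))))"
      unfolding qe by (subst lin_comb_diff) (simp_all add: p)
    then have "norm (x (s (2 * k)) - x (s (2 * k + 1)) - lin_comb e (q k)) \<le>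
        norm (x (s (2 * k)) - lin_comb e (p (s (2 * k)))) +
        norm (x (s (2 * k + 1)) - lin_comb e (p (s (2 * k + 1))))"
      by (simp only: norm_triangle_ineq4)
    also have "\<dots> \<le> \<eta> / 2 * (1 / 2) ^ k + \<eta> / 2 * (1 / 2) ^ k"
      using le[of "2 * k"] le[of "2 * k + 1"] p(2)[of "s (2 * k)"] p(2)[of "s (2 * k + 1)"]
      by (intro add_mono) linarith+
    finally show ?thesis by simp
  qed
  moreover have "(\<lambda>k. q k n) \<longlonglongrightarrow> 0" for n
  proof -
    obtain l where l: "(\<lambda>k. p (s k) n) \<longlonglongrightarrow> l" using lim by blast
    have "strict_mono (\<lambda>k::nat. 2 * k)" "strict_mono (\<lambda>k::nat. 2 * k + 1)"
      by (auto simp: strict_mono_def)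
    from tendsto_diff[OF this[THEN LIMSEQ_subseq_LIMSEQ[OF l]]]
    show ?thesis by (simp add: q_def o_def)
  qed
  ultimately show ?thesis using s q by blast
qed

text \<open>
  The side condition \<open>Q\<close> lets the same construction produce peaked or flat blocks. It may depend on
  the position \<open>L i\<close> where the next block begins, which is known before the block is chosen.
\<close>

lemma gliding_hump:
  fixes q :: "nat \<Rightarrow> nat \<Rightarrow> real" and \<eta> :: real
  assumes e: "c00_completion M e" and q: "\<And>k. q k \<in> c00" "\<And>n. (\<lambda>k. q k n) \<longlonglongrightarrow> 0"
    and \<eta>: "0 < \<eta>" and Q: "\<And>i L m. \<exists>k\<ge>m. Q i L k"
  shows "\<exists>\<kappa> L. strict_mono \<kappa> \<and> strict_mono L \<and> (\<forall>i. Q i (L i) (\<kappa> i) \<and>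
    M (restrict_seq {..<L i} (q (\<kappa> i))) \<le> \<eta> * (1 / 2) ^ i \<and> (\<forall>n\<ge>L (Suc i). q (\<kappa> i) n = 0))"
proof -
  have next_k: "\<exists>k>m. M (restrict_seq {..<l} (q k)) \<le> \<eta> * (1 / 2) ^ i \<and> Q i l k" for i l m
  proof -
    have "(\<lambda>k. \<Sum>n<l. q k n *\<^sub>R e n) \<longlonglongrightarrow> (\<Sum>n<l. 0 *\<^sub>R e n)"
      by (intro tendsto_sum tendsto_scaleR q tendsto_const)
    then have "(\<lambda>k. norm (\<Sum>n<l. q k n *\<^sub>R e n)) \<longlonglongrightarrow> 0" by (simp add: tendsto_norm_zero)
    moreover have "0 < \<eta> * (1 / 2) ^ i" using \<eta> by simp
    ultimately have "\<forall>\<^sub>F k in sequentially. norm (\<Sum>n<l. q k n *\<^sub>R e n) < \<eta> * (1 / 2) ^ i"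
      by (rule order_tendstoD(2))
    then obtain k0 where k0: "\<And>k. k \<ge> k0 \<Longrightarrow> norm (\<Sum>n<l. q k n *\<^sub>R e n) < \<eta> * (1 / 2) ^ i"
      by (auto simp: eventually_sequentially)
    obtain k where k: "k \<ge> max k0 (Suc m)" "Q i l k" using Q by blast
    have "M (restrict_seq {..<l} (q k)) = norm (\<Sum>n<l. q k n *\<^sub>R e n)"
      using completion_norm[OF e c00_restrict[OF q(1)], of "{..<l}" k] by (simp add: lin_comb_restrict)
    then show ?thesis using k0[of k] k by (intro exI[of _ k]) auto
  qed
  define P where "P i kl \<longleftrightarrow> M (restrict_seq {..<snd kl} (q (fst kl))) \<le> \<eta> * (1 / 2) ^ i \<and>
    Q i (snd kl) (fst kl)" for i and kl :: "nat \<times> nat"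
  define R where "R kl kl' \<longleftrightarrow> fst kl < fst kl' \<and> snd kl < snd kl' \<and>
    (\<forall>n\<ge>snd kl'. q (fst kl) n = 0)" for kl kl' :: "nat \<times> nat"
  have "\<exists>f. \<forall>i. P i (f i) \<and> R (f i) (f (Suc i))"
  proof (rule dependent_nat_choice)
    show "\<exists>kl. P 0 kl" using next_k[where i = 0] unfolding P_def by (metis fst_conv snd_conv)
  next
    fix kl i assume "P i kl"
    obtain l0 where l0: "\<forall>n\<ge>l0. q (fst kl) n = 0" using c00_bound[OF q(1)] by blast
    define l where "l = max l0 (Suc (snd kl))"
    obtain k where "k > fst kl" "M (restrict_seq {..<l} (q k)) \<le> \<eta> * (1 / 2) ^ Suc i" "Q (Suc i) l k"
      using next_k by blast
    then show "\<exists>kl'. P (Suc i) kl' \<and> R kl kl'"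
      using l0 by (intro exI[of _ "(k, l)"]) (auto simp: P_def R_def l_def)
  qed
  then obtain f where f: "\<And>i. P i (f i)" "\<And>i. R (f i) (f (Suc i))" by blast
  show ?thesis
  proof (rule exI[of _ "\<lambda>i. fst (f i)"], rule exI[of _ "\<lambda>i. snd (f i)"], intro conjI allI impI)
    show "strict_mono (\<lambda>i. fst (f i))" "strict_mono (\<lambda>i. snd (f i))"
      using f(2) by (auto simp: strict_mono_Suc_iff R_def)
    fix i
    show "Q i (snd (f i)) (fst (f i))"
      "M (restrict_seq {..<snd (f i)} (q (fst (f i)))) \<le> \<eta> * (1 / 2) ^ i"
      using f(1)[of i] by (simp_all add: P_def)
    fix n assume "n \<ge> snd (f (Suc i))"
    then show "q (fst (f i)) n = 0" using f(2)[of i] by (simp add: R_def)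
  qed
qed

lemma ex_interval_index:
  fixes J :: "nat \<Rightarrow> nat"
  assumes "strict_mono J" "J 0 = 0"
  shows "\<exists>g. \<forall>j. J (g j) \<le> j \<and> j < J (Suc (g j))"
proof -
  have "\<exists>n. J n \<le> j \<and> j < J (Suc n)" for j
  proof -
    have "j < J (Suc j)" using strict_mono_imp_increasing[OF assms(1), of "Suc j"] by linarith
    define n where "n = (LEAST n. j < J (Suc n))"
    have 1: "j < J (Suc n)" unfolding n_def by (rule LeastI) fact
    have "J n \<le> j"
    proof (cases n)
      case (Suc m)
      then have "\<not> j < J (Suc m)" using not_less_Least[of m "\<lambda>n. j < J (Suc n)"] by (simp add: n_def)
      then show ?thesis using Suc by simp
    qed (use assms in simp)
    then show ?thesis using 1 by blast
  qed
  then show ?thesis by metis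
qed

context subsymmetrized_dual begin

section \<open>Peaked and flat blocks\<close>

lemma blocks_equivalent_to_basis:
  fixes e :: "nat \<Rightarrow> 's::banach"
  assumes e: "c00_completion M e" and u: "blocks u L" and C: "\<And>k. M (u k) \<le> C"
    and \<delta>: "0 < \<delta>" and p: "\<And>k. L k \<le> p k \<and> p k < L (Suc k)" "\<And>k. \<delta> \<le> \<bar>u k (p k)\<bar>"
  shows "summable (\<lambda>k. a k *\<^sub>R lin_comb e (u k)) \<longleftrightarrow> summable (\<lambda>k. a k *\<^sub>R e k)"
proof -
  have C0: "0 \<le> C" using C[of 0] M_nonneg[OF blocks_c00[OF u]] order_trans by blast
  have nu: "norm (\<Sum>k\<in>{m..<n}. a k *\<^sub>R lin_comb e (u k)) = M (combination a u {m..<n})" for m n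
    using completion_norm[OF e combination_c00[OF u]] by (simp add: lin_comb_combination[OF u])
  have ne: "norm (\<Sum>k\<in>{m..<n}. a k *\<^sub>R e k) = M (restrict_seq {m..<n} a)" for m n
    using completion_norm[OF e c00_restrict_finite, of "{m..<n}" a] by (simp add: lin_comb_restrict)
  show ?thesis
  proof
    assume "summable (\<lambda>k. a k *\<^sub>R lin_comb e (u k))"
    then show "summable (\<lambda>k. a k *\<^sub>R e k)"
    proof (rule summable_domination[where C = "1 / \<delta>"])
      show "norm (\<Sum>k\<in>{m..<n}. a k *\<^sub>R e k) \<le> 1 / \<delta> * norm (\<Sum>k\<in>{m..<n}. a k *\<^sub>R lin_comb e (u k))" for m n
        using M_combination_ge[OF u _ \<delta> p, of "{m..<n}" a] \<delta> unfolding nu ne by (simp add: field_simps)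
    qed
  next
    assume "summable (\<lambda>k. a k *\<^sub>R e k)"
    then show "summable (\<lambda>k. a k *\<^sub>R lin_comb e (u k))"
    proof (rule summable_domination[where C = C])
      show "norm (\<Sum>k\<in>{m..<n}. a k *\<^sub>R lin_comb e (u k)) \<le> C * norm (\<Sum>k\<in>{m..<n}. a k *\<^sub>R e k)" for m n
        using M_combination_le[OF u C C0, of "{m..<n}" a] unfolding nu ne by simp
    qed
  qed
qed

text \<open>
  Choose intervals \<open>[J n, J (n + 1))\<close> over which the sum of the blocks has norm at least \<open>2\<^sup>n\<close>, and give
  all coefficients there the value \<open>2\<^sup>-\<^sup>n\<close>: the series diverges. Along \<open>\<sigma> j = J (j + 1)\<close> the indices
  \<open>\<sigma> j\<close> for \<open>j\<close> in the \<open>n\<close>-th interval are at least \<open>J (n + 1)\<close>, hence at least the number of blocks in that interval. So by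
  flatness the \<open>n\<close>-th interval contributes only a multiple of \<open>2\<^sup>-\<^sup>n\<close> and the series converges.
\<close>

lemma flat_blocks_not_subsymmetric:
  fixes e :: "nat \<Rightarrow> 's::banach"
  assumes e: "c00_completion M e" and u: "blocks u L" and C: "\<And>k. M (u k) \<le> C"
    and \<delta>: "0 < \<delta>" "\<And>k. \<delta> \<le> M (u k)"
    and flat: "\<And>k n. \<bar>u k n\<bar> * (real (L k) + (real k + 1)\<^sup>2) \<le> \<delta> / 4"
  shows "\<exists>a \<sigma>. strict_mono \<sigma> \<and> \<not> summable (\<lambda>k. a k *\<^sub>R lin_comb e (u k)) \<and>
    summable (\<lambda>k. a k *\<^sub>R lin_comb e (u (\<sigma> k)))"
proof -
  have C0: "0 \<le> C" using C[of 0] M_nonneg[OF blocks_c00[OF u]] order_trans by blast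
  have flat1: "\<bar>u k n\<bar> * real (L k) \<le> \<delta> / 4" for k n
    by (rule order_trans[OF mult_left_mono flat[of k n]]) auto
  have flat2: "\<bar>u k n\<bar> * (real K)\<^sup>2 \<le> \<delta> / 4" if "K \<le> Suc k" for k n K
  proof (rule order_trans[OF mult_left_mono flat[of k n]])
    have "(real K)\<^sup>2 \<le> (real k + 1)\<^sup>2" using that by (intro power_mono) auto
    then show "(real K)\<^sup>2 \<le> real (L k) + (real k + 1)\<^sup>2" by linarith
  qed simp
  have "\<exists>f. \<forall>n. (n = 0 \<longrightarrow> f n = 0) \<and> (f n < f (Suc n) \<and> 2 ^ n \<le> M (combination (\<lambda>_. 1) u {f n..<f (Suc n)}))"
  proof (rule dependent_nat_choice)
    fix m n :: nat
    obtain b where b: "2 ^ n \<le> M (combination (\<lambda>_. 1) u {m..<b})"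
      using flat_blocks_unbounded[OF u \<delta> flat1] by blast
    have "m < b"
    proof (rule ccontr)
      assume "\<not> m < b"
      then have "combination (\<lambda>_. 1) u {m..<b} = (\<lambda>_. 0)" by (simp add: combination_def fun_eq_iff)
      moreover have "M (\<lambda>_. 0) \<le> 0" by (rule M_leI) (simp_all add: pair_def)
      moreover have "(0::real) < 2 ^ n" by simp
      ultimately show False using b by (metis leD order_trans)
    qed
    then show "\<exists>b. (Suc n = 0 \<longrightarrow> b = 0) \<and> m < b \<and> 2 ^ n \<le> M (combination (\<lambda>_. 1) u {m..<b})"
      using b by auto
  qed simp
  then obtain J where J0: "J 0 = 0" and JS: "\<And>n. J n < J (Suc n)"
    and big: "\<And>n. 2 ^ n \<le> M (combination (\<lambda>_. 1) u {J n..<J (Suc n)})" by blast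
  have J: "strict_mono J" using JS by (simp add: strict_mono_Suc_iff)
  obtain g where g: "\<And>j. J (g j) \<le> j" "\<And>j. j < J (Suc (g j))"
    using ex_interval_index[OF J J0] by blast
  have g_eq: "g j = n" if "J n \<le> j" "j < J (Suc n)" for j n
    using interval_unique[OF J g that] .
  have J_ge: "n \<le> J n" for n using strict_mono_imp_increasing[OF J] .
  define a where "a j = (1 / 2 :: real) ^ g j" for j
  define \<sigma> where "\<sigma> j = J (Suc j)" for j
  have \<sigma>: "strict_mono \<sigma>" using J by (simp add: \<sigma>_def strict_mono_def)
  have div: "\<not> summable (\<lambda>k. a k *\<^sub>R lin_comb e (u k))"
  proof
    assume "summable (\<lambda>k. a k *\<^sub>R lin_comb e (u k))"
    then obtain n0 where n0: "\<And>m n. m \<ge> n0 \<Longrightarrow> norm (\<Sum>k\<in>{m..<n}. a k *\<^sub>R lin_comb e (u k)) < 1"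
      unfolding summable_Cauchy by (meson zero_less_one)
    have "(\<Sum>k\<in>{J n0..<J (Suc n0)}. a k *\<^sub>R lin_comb e (u k)) =
        (\<Sum>k\<in>{J n0..<J (Suc n0)}. (1 / 2) ^ n0 *\<^sub>R (1 *\<^sub>R lin_comb e (u k)))"
      using g_eq by (intro sum.cong) (auto simp: a_def)
    also have "\<dots> = (1 / 2) ^ n0 *\<^sub>R lin_comb e (combination (\<lambda>_. 1) u {J n0..<J (Suc n0)})"
      by (simp add: lin_comb_combination[OF u] scaleR_sum_right)
    finally have "norm (\<Sum>k\<in>{J n0..<J (Suc n0)}. a k *\<^sub>R lin_comb e (u k)) =
        (1 / 2) ^ n0 * M (combination (\<lambda>_. 1) u {J n0..<J (Suc n0)})"
      using completion_norm[OF e combination_c00[OF u]] by simp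
    also have "\<dots> \<ge> (1 / 2) ^ n0 * 2 ^ n0" by (intro mult_left_mono big) simp
    finally show False using n0[OF J_ge, of "J (Suc n0)"] by (simp add: power_mult_distrib[symmetric])
  qed
  define B where "B = \<delta> / 4 + 2 * C"
  have piece: "norm (\<Sum>j\<in>A. a j *\<^sub>R lin_comb e (u (\<sigma> j))) \<le> B * (1 / 2) ^ n"
    if A: "A \<subseteq> {J n..<J (Suc n)}" for A n
  proof -
    have finA: "finite A" using A finite_subset by blast
    have inj: "inj_on \<sigma> A" using \<sigma> by (simp add: strict_mono_imp_inj_on inj_on_subset)
    have "(\<Sum>j\<in>A. a j *\<^sub>R lin_comb e (u (\<sigma> j))) = (\<Sum>j\<in>A. (1 / 2) ^ n *\<^sub>R (1 *\<^sub>R lin_comb e (u (\<sigma> j))))"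
      using g_eq A by (intro sum.cong) (auto simp: a_def subset_iff)
    also have "\<dots> = (1 / 2) ^ n *\<^sub>R lin_comb e (combination (\<lambda>_. 1) u (\<sigma> ` A))"
      by (simp add: lin_comb_combination[OF u] scaleR_sum_right sum.reindex[OF inj])
    finally have "norm (\<Sum>j\<in>A. a j *\<^sub>R lin_comb e (u (\<sigma> j))) =
        (1 / 2) ^ n * M (combination (\<lambda>_. 1) u (\<sigma> ` A))"
      using completion_norm[OF e combination_c00[OF u]] by simp
    also have "\<dots> \<le> (1 / 2) ^ n * B"
    proof (rule mult_left_mono)
      have "card A \<le> card {J n..<J (Suc n)}" using A by (intro card_mono) auto
      then have card: "card (\<sigma> ` A) \<le> J (Suc n)" using card_image[OF inj] by simp
      have "J (Suc n) \<le> Suc k" if "k \<in> \<sigma> ` A" for k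
      proof -
        obtain j where j: "j \<in> A" "k = J (Suc j)" using \<open>k \<in> \<sigma> ` A\<close> by (auto simp: \<sigma>_def)
        then have "n \<le> j" using A J_ge[of n] by (auto simp: subset_iff)
        then have "J (Suc n) \<le> J (Suc j)" using J by (simp add: strict_mono_less_eq)
        then show ?thesis using j by simp
      qed
      then show "M (combination (\<lambda>_. 1) u (\<sigma> ` A)) \<le> B"
        unfolding B_def using finA C C0 \<delta>(1) flat2
        by (intro M_flat_combination_le[OF u _ card]) auto
    qed simp
    finally show ?thesis by (simp add: mult.commute)
  qed
  have conv: "summable (\<lambda>k. a k *\<^sub>R lin_comb e (u (\<sigma> k)))"
    unfolding summable_Cauchy
  proof (intro allI impI)
    fix \<epsilon> :: real assume "0 < \<epsilon>"
    then obtain n0 where n0: "\<And>n. norm (\<Sum>i\<in>{n0..<n}. B * (1 / 2) ^ i) < \<epsilon>"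
      using summable_half_powers[of B] unfolding summable_Cauchy by blast
    have "norm (\<Sum>j\<in>{m..<n}. a j *\<^sub>R lin_comb e (u (\<sigma> j))) < \<epsilon>" if m: "m \<ge> J n0" for m n
    proof -
      let ?f = "\<lambda>j. a j *\<^sub>R lin_comb e (u (\<sigma> j))"
      have "g j \<in> {n0..<n}" if j: "j \<in> {m..<n}" for j
      proof -
        have "J n0 < J (Suc (g j))" using m j g(2)[of j] by auto
        then have "n0 \<le> g j" using J by (simp add: strict_mono_less)
        moreover have "g j < n" using J_ge[of "g j"] g(1)[of j] j by auto
        ultimately show ?thesis by simp
      qed
      then have "g ` {m..<n} \<subseteq> {n0..<n}" by blast
      then have "(\<Sum>j\<in>{m..<n}. ?f j) = (\<Sum>i\<in>{n0..<n}. \<Sum>j\<in>{j\<in>{m..<n}. g j = i}. ?f j)"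
        by (intro sum.group[symmetric]) auto
      also have "norm \<dots> \<le> (\<Sum>i\<in>{n0..<n}. B * (1 / 2) ^ i)"
        using g by (intro sum_norm_le piece) auto
      also have "\<dots> < \<epsilon>" using n0[of n] by (simp add: abs_less_iff)
      finally show ?thesis .
    qed
    then show "\<exists>N. \<forall>m\<ge>N. \<forall>n. norm (\<Sum>j\<in>{m..<n}. a j *\<^sub>R lin_comb e (u (\<sigma> j))) < \<epsilon>" by blast
  qed
  show ?thesis using \<sigma> div conv by blast
qed

theorem subsymmetric_equivalent_to_basis:
  fixes e x :: "nat \<Rightarrow> 's::banach"
  assumes e: "c00_completion M e" and x: "subsymmetric x"
  shows "equivalent_basic x e"
proof -
  obtain d0 where d0: "d0 > 0" "\<And>j. d0 \<le> norm (x j)" using subsymmetric_bounded_below[OF x] by blast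
  obtain D where D: "\<And>j. norm (x j) \<le> D" using subsymmetric_bounded_above[OF x] by blast
  obtain K where K: "K > 0" "\<And>m n. m < n \<Longrightarrow> norm (x m) \<le> K * norm (x m - x n)"
    using basis_constant_difference[OF subsymmetric_basic[OF x]] by blast
  define d where "d = d0 / K"
  have d: "d > 0" using d0 K by (simp add: d_def)
  have d_le: "d \<le> norm (x m - x n)" if "m < n" for m n
    using K(2)[OF that] d0(2)[of m] K(1) by (simp add: d_def field_simps)
  \<comment> \<open>the differences have norm at least \<open>d\<close>; two errors \<open>\<eta>\<close> leave the blocks with norm at least \<open>3 * d / 4\<close>\<close>
  define \<eta> where "\<eta> = d / 8"
  have \<eta>: "\<eta> > 0" using d by (simp add: \<eta>_def)
  obtain s q where s: "strict_mono s" and q: "\<And>k. q k \<in> c00"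
    and near: "\<And>k. norm (x (s (2 * k)) - x (s (2 * k + 1)) - lin_comb e (q k)) \<le> \<eta> * (1 / 2) ^ k"
    and q0: "\<And>n. (\<lambda>k. q k n) \<longlonglongrightarrow> 0"
    using null_difference_sequence[where x = x, OF e abs_le_M D \<eta>] by blast
  \<comment> \<open>one gliding hump serves both cases, with different side conditions on the blocks\<close>
  have hump: "\<exists>u L \<kappa> \<alpha> \<beta>. blocks u L \<and> (\<forall>i. Q i (L i) (\<kappa> i)) \<and>
      (\<forall>i. u i = restrict_seq {L i..} (q (\<kappa> i))) \<and>
      (\<forall>i. \<alpha> i < \<beta> i) \<and> (\<forall>i. \<beta> i < \<alpha> (Suc i)) \<and> (\<forall>i. M (u i) \<le> 2 * D + \<eta> + \<eta>) \<and>
      (\<forall>i. norm (x (\<alpha> i) - x (\<beta> i) - lin_comb e (u i)) \<le> d / 4 * (1 / 2) ^ i)"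
    if Q: "\<And>i L m. \<exists>k\<ge>m. Q i L k" for Q :: "nat \<Rightarrow> nat \<Rightarrow> nat \<Rightarrow> bool"
  proof -
    obtain \<kappa> L where \<kappa>: "strict_mono \<kappa>" and L: "strict_mono L" and QL: "\<And>i. Q i (L i) (\<kappa> i)"
      and small: "\<And>i. M (restrict_seq {..<L i} (q (\<kappa> i))) \<le> \<eta> * (1 / 2) ^ i"
      and zero: "\<And>i n. n \<ge> L (Suc i) \<Longrightarrow> q (\<kappa> i) n = 0"
      using gliding_hump[where Q = Q, OF e q q0 \<eta> Q] by blast
    define u where "u i = restrict_seq {L i..} (q (\<kappa> i))" for i
    define \<alpha> where "\<alpha> i = s (2 * \<kappa> i)" for i
    define \<beta> where "\<beta> i = s (2 * \<kappa> i + 1)" for i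
    have u: "blocks u L"
      unfolding blocks_def
    proof (intro conjI allI impI L)
      fix k n assume "u k n \<noteq> 0"
      then have "L k \<le> n" "q (\<kappa> k) n \<noteq> 0" by (auto simp: u_def restrict_seq_def split: if_splits)
      then show "L k \<le> n" "n < L (Suc k)" using zero[of k n] by (auto simp: not_le[symmetric])
    qed
    have err: "norm (x (\<alpha> i) - x (\<beta> i) - lin_comb e (u i)) \<le> d / 4 * (1 / 2) ^ i" for i
    proof -
      have "lin_comb e (restrict_seq {..<L i} (q (\<kappa> i))) = lin_comb e (q (\<kappa> i)) - lin_comb e (u i)"
      proof -
        have "restrict_seq {..<L i} (q (\<kappa> i)) = (\<lambda>n. q (\<kappa> i) n - u i n)"
          by (auto simp: restrict_seq_def u_def)
        then show ?thesis using q blocks_c00[OF u] by (simp only: lin_comb_diff)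
      qed
      then have "norm (lin_comb e (q (\<kappa> i)) - lin_comb e (u i)) \<le> \<eta> * (1 / 2) ^ i"
        using completion_norm[OF e c00_restrict[OF q], of "{..<L i}" "\<kappa> i"] small[of i] by simp
      moreover have "\<eta> * (1 / 2) ^ \<kappa> i \<le> \<eta> * (1 / 2) ^ i"
        using \<eta> strict_mono_imp_increasing[OF \<kappa>, of i] by (intro mult_left_mono power_decreasing) auto
      moreover have "x (\<alpha> i) - x (\<beta> i) - lin_comb e (u i) =
          (x (\<alpha> i) - x (\<beta> i) - lin_comb e (q (\<kappa> i))) + (lin_comb e (q (\<kappa> i)) - lin_comb e (u i))" by simp
      then have "norm (x (\<alpha> i) - x (\<beta> i) - lin_comb e (u i)) \<le>
          norm (x (\<alpha> i) - x (\<beta> i) - lin_comb e (q (\<kappa> i))) + norm (lin_comb e (q (\<kappa> i)) - lin_comb e (u i))"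
        by (simp only: norm_triangle_ineq)
      moreover have "norm (x (\<alpha> i) - x (\<beta> i) - lin_comb e (q (\<kappa> i))) \<le> \<eta> * (1 / 2) ^ \<kappa> i"
        using near[of "\<kappa> i"] by (simp add: \<alpha>_def \<beta>_def)
      ultimately have "norm (x (\<alpha> i) - x (\<beta> i) - lin_comb e (u i)) \<le> 2 * (\<eta> * (1 / 2) ^ i)" by linarith
      then show ?thesis by (simp add: \<eta>_def)
    qed
    have "M (u i) \<le> 2 * D + \<eta> + \<eta>" for i
    proof -
      have "d / 4 * (1 / 2) ^ i \<le> d / 4 * 1" using d by (intro mult_left_mono power_le_one) auto
      then have "norm (x (\<alpha> i) - x (\<beta> i) - lin_comb e (u i)) \<le> \<eta> + \<eta>"
        using err[of i] by (simp add: \<eta>_def)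
      moreover have "norm (x (\<alpha> i) - x (\<beta> i)) \<le> D + D"
        by (intro order_trans[OF norm_triangle_ineq4] add_mono D)
      ultimately have "norm (lin_comb e (u i)) \<le> 2 * D + \<eta> + \<eta>"
        using norm_triangle_ineq2[of "lin_comb e (u i)" "x (\<alpha> i) - x (\<beta> i)"]
        by (simp add: norm_minus_commute)
      then show ?thesis using completion_norm[OF e blocks_c00[OF u]] by simp
    qed
    moreover have "\<alpha> i < \<beta> i" for i using s by (simp add: \<alpha>_def \<beta>_def strict_mono_less)
    moreover have "\<beta> i < \<alpha> (Suc i)" for i
    proof -
      have "\<kappa> i < \<kappa> (Suc i)" using \<kappa> by (simp add: strict_mono_less)
      then have "2 * \<kappa> i + 1 < 2 * \<kappa> (Suc i)" by linarith
      then show ?thesis using s by (simp only: \<alpha>_def \<beta>_def strict_mono_less)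
    qed
    ultimately show ?thesis using u QL err u_def by blast
  qed
  have errs: "summable (\<lambda>i. d / 4 * (1 / 2) ^ i)" by (rule summable_half_powers)
  have near_d: "3 * d / 4 \<le> norm v"
    if "m < n" "norm (x m - x n - v) \<le> d / 4 * (1 / 2) ^ i" for m n v and i :: nat
  proof -
    have "d / 4 * (1 / 2) ^ i \<le> d / 4 * 1" using d by (intro mult_left_mono power_le_one) auto
    then show ?thesis using d_le[OF that(1)] that(2) norm_triangle_ineq2[of "x m - x n" v] by linarith
  qed
  \<comment> \<open>passing between the differences and the blocks, possibly along a subsequence\<close>
  have transfer: "summable (\<lambda>i. a i *\<^sub>R lin_comb e (u (\<sigma> i))) \<longleftrightarrow> summable (\<lambda>i. a i *\<^sub>R x i)"
    if \<sigma>: "strict_mono \<sigma>" and \<alpha>\<beta>: "\<forall>i. \<alpha> i < \<beta> i" "\<forall>i. \<beta> i < \<alpha> (Suc i)"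
      and err: "\<forall>i. norm (x (\<alpha> i) - x (\<beta> i) - lin_comb e (u i)) \<le> d / 4 * (1 / 2) ^ i"
    for \<sigma> \<alpha> \<beta> :: "nat \<Rightarrow> nat" and u and a :: "nat \<Rightarrow> real"
  proof -
    have \<alpha>: "strict_mono \<alpha>"
      unfolding strict_mono_Suc_iff using \<alpha>\<beta> less_trans by blast
    have next_\<sigma>: "\<beta> (\<sigma> i) < \<alpha> (\<sigma> (Suc i))" for i
    proof -
      have "Suc (\<sigma> i) \<le> \<sigma> (Suc i)" using \<sigma> by (simp add: Suc_le_eq strict_mono_less)
      then have "\<alpha> (Suc (\<sigma> i)) \<le> \<alpha> (\<sigma> (Suc i))" using \<alpha> by (simp add: strict_mono_less_eq)
      then show ?thesis using \<alpha>\<beta>(2) order.strict_trans2 by blast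
    qed
    have err\<sigma>: "norm (x (\<alpha> (\<sigma> i)) - x (\<beta> (\<sigma> i)) - lin_comb e (u (\<sigma> i))) \<le> d / 4 * (1 / 2) ^ i" for i
    proof -
      have "d / 4 * (1 / 2) ^ \<sigma> i \<le> d / 4 * (1 / 2) ^ i"
        using d strict_mono_imp_increasing[OF \<sigma>, of i] by (intro mult_left_mono power_decreasing) auto
      then show ?thesis using err order_trans by blast
    qed
    have "summable (\<lambda>i. a i *\<^sub>R lin_comb e (u (\<sigma> i))) \<longleftrightarrow>
        summable (\<lambda>i. a i *\<^sub>R (x (\<alpha> (\<sigma> i)) - x (\<beta> (\<sigma> i))))"
    proof
      assume "summable (\<lambda>i. a i *\<^sub>R lin_comb e (u (\<sigma> i)))"
      then show "summable (\<lambda>i. a i *\<^sub>R (x (\<alpha> (\<sigma> i)) - x (\<beta> (\<sigma> i))))"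
      proof (rule summable_perturbation[OF _ _ _ _ errs])
        show "3 * d / 4 \<le> norm (lin_comb e (u (\<sigma> i)))" for i
          using \<alpha>\<beta>(1) err\<sigma>[of i] by (intro near_d) auto
        show "norm (lin_comb e (u (\<sigma> i)) - (x (\<alpha> (\<sigma> i)) - x (\<beta> (\<sigma> i)))) \<le> d / 4 * (1 / 2) ^ i" for i
          using err\<sigma>[of i] by (simp add: norm_minus_commute)
      qed (use d in simp)
    next
      assume "summable (\<lambda>i. a i *\<^sub>R (x (\<alpha> (\<sigma> i)) - x (\<beta> (\<sigma> i))))"
      then show "summable (\<lambda>i. a i *\<^sub>R lin_comb e (u (\<sigma> i)))"
        by (rule summable_perturbation[OF _ d _ err\<sigma> errs]) (use d_le \<alpha>\<beta>(1) in blast)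
    qed
    also have "\<dots> \<longleftrightarrow> summable (\<lambda>i. a i *\<^sub>R x i)"
      by (rule subsymmetric_difference_iff[OF x]) (use \<alpha>\<beta>(1) next_\<sigma> in blast)+
    finally show ?thesis .
  qed
  show ?thesis
  proof (cases "\<exists>\<delta>>0. \<forall>m. \<exists>k\<ge>m. \<exists>n. \<delta> \<le> \<bar>q k n\<bar>")
    case True
    then obtain \<delta> where \<delta>: "\<delta> > 0" and often: "\<And>m. \<exists>k\<ge>m. \<exists>n. \<delta> \<le> \<bar>q k n\<bar>" by blast
    \<comment> \<open>only finitely many \<open>q k\<close> can have their large coordinate before \<open>l\<close>\<close>
    have far: "\<exists>k\<ge>m. \<exists>n\<ge>l. \<delta> \<le> \<bar>q k n\<bar>" for l m
    proof -
      have "\<forall>\<^sub>F k in sequentially. \<forall>n\<in>{..<l}. \<bar>q k n\<bar> < \<delta>"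
      proof (rule eventually_ball_finite[rule_format])
        show "\<forall>\<^sub>F k in sequentially. \<bar>q k n\<bar> < \<delta>" for n
          using order_tendstoD(2)[OF tendsto_rabs_zero[OF q0] \<delta>] .
      qed simp
      then obtain k0 where k0: "\<And>k n. k \<ge> k0 \<Longrightarrow> n < l \<Longrightarrow> \<bar>q k n\<bar> < \<delta>"
        by (auto simp: eventually_sequentially)
      obtain k n where k: "k \<ge> max k0 m" "\<delta> \<le> \<bar>q k n\<bar>" using often by blast
      then have "l \<le> n" using k0[of k n] by (meson max.bounded_iff not_le)
      then show ?thesis using k by (meson max.bounded_iff)
    qed
    obtain u L \<kappa> \<alpha> \<beta> where u: "blocks u L" and peak: "\<forall>i. \<exists>n\<ge>L i. \<delta> \<le> \<bar>q (\<kappa> i) n\<bar>"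
      and u_eq: "\<forall>i. u i = restrict_seq {L i..} (q (\<kappa> i))"
      and \<alpha>\<beta>: "\<forall>i. \<alpha> i < \<beta> i" "\<forall>i. \<beta> i < \<alpha> (Suc i)" and C: "\<forall>i. M (u i) \<le> 2 * D + \<eta> + \<eta>"
      and err: "\<forall>i. norm (x (\<alpha> i) - x (\<beta> i) - lin_comb e (u i)) \<le> d / 4 * (1 / 2) ^ i"
      using hump[of "\<lambda>i L k. \<exists>n\<ge>L. \<delta> \<le> \<bar>q k n\<bar>", OF far] by (elim exE conjE) (rule that)
    have "\<forall>i. \<exists>n. \<delta> \<le> \<bar>u i n\<bar>"
      using peak u_eq by (fastforce simp: restrict_seq_def)
    from choice[OF this] obtain p where p: "\<And>i. \<delta> \<le> \<bar>u i (p i)\<bar>" by blast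
    have "u i (p i) \<noteq> 0" for i using p[of i] \<delta> by auto
    then have pL: "L i \<le> p i \<and> p i < L (Suc i)" for i using blocksD[OF u] by blast
    show ?thesis
      unfolding equivalent_basic_def
      using transfer[OF strict_mono_id \<alpha>\<beta> err] blocks_equivalent_to_basis[OF e u spec[OF C] \<delta> pL p]
      by simp
  next
    case False
    have thin: "\<exists>k\<ge>m. \<forall>n. \<bar>q k n\<bar> * (real l + (real i + 1)\<^sup>2) \<le> (d / 2) / 4" for i l m
    proof -
      define r where "r = real l + (real i + 1)\<^sup>2"
      have r: "0 < r" by (simp add: r_def add_nonneg_pos)
      then have "0 < d / 2 / 4 / r" using d by simp
      then obtain m' where m': "\<And>k n. k \<ge> m' \<Longrightarrow> \<bar>q k n\<bar> < d / 2 / 4 / r"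
        using False by (meson not_le)
      then have "\<bar>q (max m m') n\<bar> * r \<le> d / 2 / 4" for n
        using r less_imp_le[OF m'[of "max m m'" n]] by (simp add: pos_le_divide_eq)
      then show ?thesis unfolding r_def[symmetric] by (intro exI[of _ "max m m'"]) simp
    qed
    obtain u L \<kappa> \<alpha> \<beta> where u: "blocks u L"
      and flat: "\<forall>i n. \<bar>q (\<kappa> i) n\<bar> * (real (L i) + (real i + 1)\<^sup>2) \<le> (d / 2) / 4"
      and u_eq: "\<forall>i. u i = restrict_seq {L i..} (q (\<kappa> i))"
      and \<alpha>\<beta>: "\<forall>i. \<alpha> i < \<beta> i" "\<forall>i. \<beta> i < \<alpha> (Suc i)" and C: "\<forall>i. M (u i) \<le> 2 * D + \<eta> + \<eta>"
      and err: "\<forall>i. norm (x (\<alpha> i) - x (\<beta> i) - lin_comb e (u i)) \<le> d / 4 * (1 / 2) ^ i"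
      using hump[of "\<lambda>i L k. \<forall>n. \<bar>q k n\<bar> * (real L + (real i + 1)\<^sup>2) \<le> (d / 2) / 4", OF thin]
      by (elim exE conjE) (rule that)
    have "d / 2 \<le> M (u i)" for i
      using near_d[OF spec[OF \<alpha>\<beta>(1)] spec[OF err], of i] completion_norm[OF e blocks_c00[OF u]] d by simp
    moreover have "\<bar>u i n\<bar> * (real (L i) + (real i + 1)\<^sup>2) \<le> (d / 2) / 4" for i n
    proof (rule order_trans[OF mult_right_mono])
      show "\<bar>u i n\<bar> \<le> \<bar>q (\<kappa> i) n\<bar>" using u_eq abs_restrict_seq_le by simp
    qed (use flat in auto)
    ultimately obtain a \<sigma> where "strict_mono \<sigma>" "\<not> summable (\<lambda>k. a k *\<^sub>R lin_comb e (u k))"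
        "summable (\<lambda>k. a k *\<^sub>R lin_comb e (u (\<sigma> k)))"
      using flat_blocks_not_subsymmetric[OF e u spec[OF C], of "d / 2"] d by auto
    then show ?thesis
      using transfer[OF strict_mono_id \<alpha>\<beta> err, of a] transfer[OF _ \<alpha>\<beta> err, of \<sigma> a] by simp
  qed
qed

end

section \<open>The subsymmetrized dual of Tsirelson space\<close>

lemma biorthogonal_lin_comb_apply:
  assumes f: "biorthogonal t f" and b: "b \<in> c00" and w: "w \<in> c00"
  shows "blinfun_apply (lin_comb f b) (lin_comb t w) = pair b w"
proof -
  have fin: "finite {n. b n \<noteq> 0}" "finite {n. w n \<noteq> 0}" using b w by (simp_all add: c00_def)
  have coord: "blinfun_apply (f i) (lin_comb t w) = w i" for i
  proof -
    have "blinfun_apply (f i) (lin_comb t w) = (\<Sum>j | w j \<noteq> 0. if i = j then w j else 0)"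
      unfolding lin_comb_def blinfun.sum_right blinfun.scaleR_right
      using f by (intro sum.cong) (auto simp: biorthogonal_def)
    also have "\<dots> = w i" by (subst sum.delta'[OF fin(2)]) auto
    finally show ?thesis .
  qed
  have "blinfun_apply (lin_comb f b) (lin_comb t w) = (\<Sum>i | b i \<noteq> 0. b i * w i)"
    unfolding lin_comb_def[of f] blinfun.sum_left blinfun.scaleR_left by (simp add: coord)
  also have "\<dots> = (\<Sum>i\<in>{n. b n \<noteq> 0} \<union> {n. w n \<noteq> 0}. b i * w i)"
    using fin by (intro sum.mono_neutral_left) auto
  also have "\<dots> = pair b w" using fin by (intro pair_eq[symmetric]) auto
  finally show ?thesis .
qed

lemma completion_functional_norm_le:
  fixes \<phi> :: "'t::banach \<Rightarrow>\<^sub>L real"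
  assumes t: "c00_completion N t"
    and le: "\<And>w. w \<in> c00 \<Longrightarrow> blinfun_apply \<phi> (lin_comb t w) \<le> B * N w" and B: "0 \<le> B"
  shows "norm \<phi> \<le> B"
proof (rule norm_blinfun_bound[OF B])
  fix v
  have abs_le: "\<bar>blinfun_apply \<phi> (lin_comb t w)\<bar> \<le> B * norm (lin_comb t w)" if w: "w \<in> c00" for w
    using le[OF w] le[OF c00_scale[OF w, of "-1"]] completion_norm[OF t w]
      completion_norm[OF t c00_scale[OF w, of "-1"]] lin_comb_scale[OF w, of t "-1"]
    by (simp add: abs_le_iff blinfun.minus_right)
  have "v \<in> closure (span (range t))" using t by (simp add: c00_completion_def)
  then obtain y where y: "\<And>n. y n \<in> span (range t)" "y \<longlonglongrightarrow> v" unfolding closure_sequential by blast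
  have "norm (blinfun_apply \<phi> (y n)) \<le> B * norm (y n)" for n
    using span_eq_lin_comb[OF y(1)[of n]] abs_le by auto
  moreover have "(\<lambda>n. norm (blinfun_apply \<phi> (y n))) \<longlonglongrightarrow> norm (blinfun_apply \<phi> v)"
    by (intro tendsto_intros y)
  moreover have "(\<lambda>n. B * norm (y n)) \<longlonglongrightarrow> B * norm v" by (intro tendsto_intros y)
  ultimately show "norm (blinfun_apply \<phi> v) \<le> B * norm v"
    by (intro LIMSEQ_le[of _ _ "\<lambda>n. B * norm (y n)"]) auto
qed

lemma c00_compose_strict_mono:
  fixes \<sigma> :: "nat \<Rightarrow> nat"
  assumes "a \<in> c00" "strict_mono \<sigma>" shows "(\<lambda>i. a (\<sigma> i)) \<in> c00"
proof -
  obtain m where m: "\<forall>n\<ge>m. a n = 0" using c00_bound[OF assms(1)] by blast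
  show ?thesis
    by (rule c00_I_bound[of m]) (use m strict_mono_imp_increasing[OF assms(2)] order_trans in blast)
qed

text \<open>
  The linear combinations of the unit vectors are dense in \<open>T\<close>, so a finite combination of the
  biorthogonal functionals has as its norm the supremum of its pairings with the unit ball of \<open>c\<^sub>0\<^sub>0\<close>. The
  crude bound by \<open>\<Sum>n. \<bar>a n\<bar>\<close> makes the supremum over all compressions finite.
\<close>

lemma subsymmetrized_dual_subsymm_norm:
  fixes t :: "nat \<Rightarrow> 't::banach"
  assumes N: "tsirelson_norm N" and t: "c00_completion N t" and f: "biorthogonal t f"
  shows "subsymmetrized_dual N (subsymm_norm f)"
proof -
  interpret tsirelson N by unfold_locales (rule N)
  have bound: "norm (lin_comb f (\<lambda>i. a (\<sigma> i))) \<le> (\<Sum>n | a n \<noteq> 0. \<bar>a n\<bar>)"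
    if a: "a \<in> c00" and \<sigma>: "strict_mono \<sigma>" for a and \<sigma> :: "nat \<Rightarrow> nat"
  proof (rule completion_functional_norm_le[OF t])
    fix w :: "nat \<Rightarrow> real" assume w: "w \<in> c00"
    have fin: "finite {i. w i \<noteq> 0}" "finite {n. a n \<noteq> 0}" using w a by (simp_all add: c00_def)
    have inj: "inj_on \<sigma> {i. w i \<noteq> 0}" using \<sigma> by (simp add: strict_mono_imp_inj_on inj_on_subset)
    have "pair (\<lambda>i. a (\<sigma> i)) w \<le> (\<Sum>i | w i \<noteq> 0. \<bar>a (\<sigma> i)\<bar> * N w)"
      unfolding pair_def
    proof (rule sum_mono)
      fix i
      have "a (\<sigma> i) * w i \<le> \<bar>a (\<sigma> i)\<bar> * \<bar>w i\<bar>" by (rule mult_le_abs_mult)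
      also have "\<dots> \<le> \<bar>a (\<sigma> i)\<bar> * N w" by (intro mult_left_mono abs_le_N w) simp
      finally show "a (\<sigma> i) * w i \<le> \<bar>a (\<sigma> i)\<bar> * N w" .
    qed
    also have "\<dots> = (\<Sum>i | w i \<noteq> 0. \<bar>a (\<sigma> i)\<bar>) * N w" by (simp add: sum_distrib_right)
    also have "(\<Sum>i | w i \<noteq> 0. \<bar>a (\<sigma> i)\<bar>) = (\<Sum>n\<in>\<sigma> ` {i. w i \<noteq> 0}. \<bar>a n\<bar>)"
      by (simp add: sum.reindex[OF inj])
    also have "\<dots> \<le> (\<Sum>n\<in>\<sigma> ` {i. w i \<noteq> 0} \<union> {n. a n \<noteq> 0}. \<bar>a n\<bar>)"
      using fin by (intro sum_mono2) auto
    also have "\<dots> = (\<Sum>n | a n \<noteq> 0. \<bar>a n\<bar>)"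
      using fin by (intro sum.mono_neutral_right) auto
    finally have "pair (\<lambda>i. a (\<sigma> i)) w \<le> (\<Sum>n | a n \<noteq> 0. \<bar>a n\<bar>) * N w"
      using w by (simp add: mult_right_mono)
    then show "blinfun_apply (lin_comb f (\<lambda>i. a (\<sigma> i))) (lin_comb t w) \<le> (\<Sum>n | a n \<noteq> 0. \<bar>a n\<bar>) * N w"
      by (simp only: biorthogonal_lin_comb_apply[OF f c00_compose_strict_mono[OF a \<sigma>] w])
  qed (simp add: sum_nonneg)
  show ?thesis
  proof unfold_locales
    fix a :: "nat \<Rightarrow> real" and \<sigma> :: "nat \<Rightarrow> nat" and w :: "nat \<Rightarrow> real"
    assume a: "a \<in> c00" and \<sigma>: "strict_mono \<sigma>" and w: "w \<in> c00"
    have "pair (\<lambda>i. a (\<sigma> i)) w = blinfun_apply (lin_comb f (\<lambda>i. a (\<sigma> i))) (lin_comb t w)"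
      by (simp only: biorthogonal_lin_comb_apply[OF f c00_compose_strict_mono[OF a \<sigma>] w])
    also have "\<dots> \<le> norm (blinfun_apply (lin_comb f (\<lambda>i. a (\<sigma> i))) (lin_comb t w))" by simp
    also have "\<dots> \<le> norm (lin_comb f (\<lambda>i. a (\<sigma> i))) * norm (lin_comb t w)" by (rule norm_blinfun)
    also have "\<dots> \<le> subsymm_norm f a * norm (lin_comb t w)"
    proof (rule mult_right_mono)
      show "norm (lin_comb f (\<lambda>i. a (\<sigma> i))) \<le> subsymm_norm f a"
        unfolding subsymm_norm_def
        by (rule cSUP_upper) (use \<sigma> bound[OF a] in \<open>auto intro!: bdd_aboveI2\<close>)
    qed simp
    finally show "pair (\<lambda>i. a (\<sigma> i)) w \<le> subsymm_norm f a * N w"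
      by (simp only: completion_norm[OF t w])
  next
    fix a :: "nat \<Rightarrow> real" and B
    assume a: "a \<in> c00"
      and le: "\<And>\<sigma> w. strict_mono \<sigma> \<Longrightarrow> w \<in> c00 \<Longrightarrow> pair (\<lambda>i. a (\<sigma> i)) w \<le> B * N w"
    have B: "0 \<le> B"
    proof -
      let ?w = "\<lambda>s i. if i = (0::nat) then s else (0::real)"
      have w: "?w s \<in> c00" for s by (rule c00_I_bound[of 1]) auto
      have "s * a 0 \<le> B" if "\<bar>s\<bar> = 1" for s
      proof -
        have "N (?w s) = 1" using that by (subst N_unit_restrict[of _ 0]) (auto split: if_splits)
        moreover have "pair a (?w s) = a 0 * s" by (subst pair_eq[of "{0}"]) (auto split: if_splits)
        ultimately show ?thesis using le[OF strict_mono_id w[of s]] by (simp add: mult.commute)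
      qed
      from this[of 1] this[of "-1"] show ?thesis by simp
    qed
    show "subsymm_norm f a \<le> B"
      unfolding subsymm_norm_def
    proof (rule cSUP_least)
      show "{\<sigma> :: nat \<Rightarrow> nat. strict_mono \<sigma>} \<noteq> {}" using strict_mono_id by blast
      fix \<sigma> :: "nat \<Rightarrow> nat" assume "\<sigma> \<in> {\<sigma>. strict_mono \<sigma>}"
      then have \<sigma>: "strict_mono \<sigma>" by simp
      show "norm (lin_comb f (\<lambda>i. a (\<sigma> i))) \<le> B"
      proof (rule completion_functional_norm_le[OF t _ B])
        fix w :: "nat \<Rightarrow> real" assume w: "w \<in> c00"
        show "blinfun_apply (lin_comb f (\<lambda>i. a (\<sigma> i))) (lin_comb t w) \<le> B * N w"
          using le[OF \<sigma> w] by (simp only: biorthogonal_lin_comb_apply[OF f c00_compose_strict_mono[OF a \<sigma>] w])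
      qed
    qed
  qed
qed

theorem theorem2:
  fixes N :: "(nat \<Rightarrow> real) \<Rightarrow> real"
    and t :: "nat \<Rightarrow> 't::banach"
    and tstar :: "nat \<Rightarrow> ('t \<Rightarrow>\<^sub>L real)"
    and e :: "nat \<Rightarrow> 's::banach"
    and x :: "nat \<Rightarrow> 's"
  assumes "tsirelson_norm N"
    and "c00_completion N t"
    and "biorthogonal t tstar"
    and "c00_completion (subsymm_norm tstar) e"
    and "subsymmetric x"
  shows "equivalent_basic x e"
proof -
  interpret subsymmetrized_dual N "subsymm_norm tstar"
    by (rule subsymmetrized_dual_subsymm_norm[OF assms(1-3)])
  show ?thesis by (rule subsymmetric_equivalent_to_basis[OF assms(4,5)])
qed

end
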